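(* There exists $C>0$ such that if $\lambda=\lambda(n)\ge C\log^2 n/\sqrt n$, then, as $n\to\infty$, \[ Z(\lambda)=\left(1+o\left(\frac{1}{\sqrt N}\right)\right)Z(C_n,\lambda). \]
   Context: $B_n=(2^{[n]},\subseteq)$ is the Boolean lattice, $N=\binom{n}{\lfloor n/2\rfloor}$, $\log=\log_2$. An antichain is a (possibly empty) family of pairwise inclusion-incomparable subsets of $[n]$. For $U\subseteq B_n$ and $\lambda>0$, $Z(U,\lambda)=\sum_{A}\lambda^{|A|}$, where the sum is over all antichains $A\subseteq U$; $Z(\lambda)=Z(B_n,\lambda)$. $C_n$ is the union of the layers $\binom{[n]}{i}$ with $\lfloor n/2\rfloor-1\le i\le\lceil n/2\rceil+1$ (three layers if $n$ is even, four if $n$ is odd). *)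

theory Defs
  imports "HOL-Analysis.Analysis" "HOL-Library.Landau_Symbols"
begin

definition boolean_lattice :: "nat \<Rightarrow> nat set set" where
  "boolean_lattice n = Pow {1..n}"

definition antichain :: "'a set set \<Rightarrow> bool" where
  "antichain \<A> \<longleftrightarrow> pairwise (\<lambda>A B. \<not> A \<subseteq> B \<and> \<not> B \<subseteq> A) \<A>"

text \<open>Meant for finite \<open>U\<close> only: the sum and \<open>card\<close> degenerate otherwise.\<close>

definition antichain_Z :: "'a set set \<Rightarrow> real \<Rightarrow> real" where
  "antichain_Z U x = (\<Sum>\<A> | \<A> \<subseteq> U \<and> antichain \<A>. x ^ card \<A>)"

text \<open>The bounds are compared in \<open>int\<close>, so that the lower one is not truncated for \<open>n \<le> 1\<close>.\<close>

definition central_layers :: "nat \<Rightarrow> nat set set" where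
  "central_layers n =
     {A \<in> boolean_lattice n.
        \<lfloor>real n / 2\<rfloor> - 1 \<le> int (card A) \<and> int (card A) \<le> \<lceil>real n / 2\<rceil> + 1}"

end

theory Submission
  imports Defs "HOL-Real_Asymp.Real_Asymp"
begin

text \<open>
  Elements \<open>s\<close> of the outer layers are removed one at a time, from the top layer downwards; the
  lower layers are then handled by complementation. If an antichain contains \<open>s\<close> of size \<open>j + 2\<close>,
  let \<open>K\<close> be the component of \<open>s\<close> among its elements of sizes \<open>j + 1\<close> and \<open>j + 2\<close>, linked when they
  share a \<open>j\<close>-subset. Replacing \<open>K\<close> by an arbitrary subset of its \<open>j\<close>-shadow \<open>R K\<close> gives again an
  antichain, so adding \<open>s\<close> to \<open>U\<close> increases \<open>Z\<close> at most by the factor \<open>1 +\<close> the sum over \<open>K\<close> of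
  \<open>\<lambda>\<^sup>|\<^sup>K\<^sup>| (1 + \<lambda>)\<^sup>-\<^sup>|\<^sup>R\<^sup>K\<^sup>|\<close>.

  That sum is bounded by graph containers. The bipartite graph between two consecutive layers has no
  4-cycle and its lower degrees are smaller than its upper degree \<open>D\<close>. For a closed linked set
  \<open>A\<close> with neighbourhood \<open>G\<close> put \<open>t = |G| - |A|\<close>, so \<open>|G| \<le> t D\<close>. A few well chosen vertices of \<open>G\<close> and \<open>A\<close>,
  which form a connected set up to bounded distance, determine sets \<open>F \<subseteq> G\<close> and \<open>S \<supseteq> A\<close> whose errors
  are of order \<open>t\<close>. This pair is refined, each round costing \<open>O(t / D)\<close> vertices and halving the bound on
  \<open>|S| - |F|\<close>, until that bound drops below \<open>\<Gamma> t\<close>. Then either \<open>|S| \<le> |G| - \<Gamma> t\<close>, or \<open>F\<close> misses so little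
  of \<open>G\<close> that the missing part, and with it \<open>A\<close> itself, can be listed. All optimal choices are
  found by minimising suitable potentials.
\<close>

section \<open>Counting lemmas and connected sets\<close>

text \<open>Why two layers are pushed down at once: between adjacent layers one only gets
  \<open>D <= 5 * t\<close>, and inserting one element is then charged a factor of about
  \<open>1 + exp (- (800 * L ^ 3))\<close>, far too much for exponentially many insertions. A set of
  size \<open>j + 2\<close> has about \<open>D ^ 2 / 2\<close> subsets of size \<open>j\<close>;
  this forces \<open>t\<close> up to order \<open>D ^ 2\<close> and brings the factor exponentially
  close to 1. The price is that polymers occupy two layers, so the weight of those fitting into a
  container \<open>C\<close> is no longer bounded by \<open>(1 + lam) ^ card C\<close>. The
  adjacent-layer estimate is good enough to repair that, at the cost of a factor
  \<open>exp (\<delta> * card C)\<close> with tiny \<open>\<delta>\<close>. Containers need lower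
  degrees below the upper degree, that is \<open>n <= 2 * j\<close>, and this fixes the layers of
  \<open>C_n\<close>. The size of \<open>lam\<close> comes from weighing containers: if
  \<open>l\<close> bounds \<open>ln (1 + lam)\<close> from below, the saving per unit of
  \<open>t\<close> is \<open>l * \<Gamma> = l ^ 2 / (32 * L)\<close>, which must beat an enumeration
  cost of order \<open>L ^ 2 / D\<close>.\<close>

lemma double_count:
  assumes "finite P" "finite Q"
  shows "(\<Sum>x\<in>P. card {y\<in>Q. r x y}) = (\<Sum>y\<in>Q. card {x\<in>P. r x y})"
proof -
  have "(\<Sum>x\<in>P. card {y\<in>Q. r x y}) = (\<Sum>x\<in>P. \<Sum>y\<in>Q. if r x y then 1 else 0)"
    using assms by (intro sum.cong refl) (simp add: sum.If_cases Int_def)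
  also have "\<dots> = (\<Sum>y\<in>Q. \<Sum>x\<in>P. if r x y then 1 else 0)"
    by (rule sum.swap)
  also have "\<dots> = (\<Sum>y\<in>Q. card {x\<in>P. r x y})"
    using assms by (intro sum.cong refl) (simp add: sum.If_cases Int_def)
  finally show ?thesis .
qed

lemma finite_minimizer:
  fixes f :: "'a \<Rightarrow> real"
  assumes "finite S" "S \<noteq> {}"
  obtains x where "x \<in> S" "\<And>y. y \<in> S \<Longrightarrow> f x \<le> f y"
  using arg_min_if_finite[OF assms, of f] by (meson not_less)

lemma sum_Pow_power:
  fixes x :: real
  assumes "finite V"
  shows "(\<Sum>H\<in>Pow V. x ^ card H) = (1 + x) ^ card V"
  using assms
proof (induction V rule: finite_induct)
  case (insert v V)
  have inj: "inj_on (insert v) (Pow V)"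
    using insert.hyps by (auto simp: inj_on_def)
  have disj: "Pow V \<inter> insert v ` Pow V = {}"
    using insert.hyps by auto
  have "(\<Sum>H\<in>Pow (insert v V). x ^ card H)
      = (\<Sum>H\<in>Pow V. x ^ card H) + (\<Sum>H\<in>insert v ` Pow V. x ^ card H)"
    unfolding Pow_insert using insert.hyps disj by (intro sum.union_disjoint) auto
  also have "(\<Sum>H\<in>insert v ` Pow V. x ^ card H) = (\<Sum>H\<in>Pow V. x ^ card (insert v H))"
    by (subst sum.reindex[OF inj]) simp
  also have "\<dots> = (\<Sum>H\<in>Pow V. x * x ^ card H)"
  proof (intro sum.cong refl)
    fix H assume "H \<in> Pow V"
    then have "v \<notin> H" "finite H" using insert.hyps finite_subset by auto
    then show "x ^ card (insert v H) = x * x ^ card H" by simp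
  qed
  finally show ?case
    using insert by (simp add: sum_distrib_left[symmetric] algebra_simps)
qed simp

text \<open>With weights \<open>x ^ card H\<close> for \<open>x = 1 / r\<close>, every counted set
  contributes at least \<open>x powr q\<close>, while all subsets together contribute at most
  \<open>exp (x * card V)\<close>. A real bound \<open>q\<close> avoids rounding later.\<close>

lemma card_small_subsets:
  fixes r q :: real
  assumes "finite V" "real (card V) \<le> r * q" "1 \<le> r" "0 < q"
  shows "real (card {H. H \<subseteq> V \<and> real (card H) \<le> q}) \<le> (exp 1 * r) powr q"
proof -
  define x where "x = 1 / r"
  have x: "0 < x" "x \<le> 1" using assms by (auto simp: x_def)
  let ?S = "{H. H \<subseteq> V \<and> real (card H) \<le> q}"
  have fin: "finite ?S" by (rule finite_subset[of _ "Pow V"]) (use assms in auto)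
  have "real (card ?S) * x powr q = (\<Sum>H\<in>?S. x powr q)" by simp
  also have "\<dots> \<le> (\<Sum>H\<in>?S. x ^ card H)"
  proof (intro sum_mono)
    fix H assume "H \<in> ?S"
    then have "x powr q \<le> x powr real (card H)"
      using x by (intro powr_mono') auto
    then show "x powr q \<le> x ^ card H" using x by (simp add: powr_realpow)
  qed
  also have "\<dots> \<le> (\<Sum>H\<in>Pow V. x ^ card H)"
    using x assms by (intro sum_mono2) auto
  also have "\<dots> = (1 + x) ^ card V" by (rule sum_Pow_power) fact
  also have "\<dots> \<le> exp x ^ card V" using x by (intro power_mono) auto
  also have "\<dots> = exp (real (card V) * x)" by (simp add: exp_of_nat_mult)
  also have "\<dots> \<le> exp q"
  proof -
    have "real (card V) * x \<le> q" using assms by (simp add: x_def field_simps)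
    then show ?thesis by simp
  qed
  finally have "real (card ?S) \<le> exp q / x powr q"
    using x by (simp add: field_simps)
  also have "\<dots> = (exp 1 * r) powr q"
    using assms by (simp add: x_def powr_mult powr_divide exp_powr_real)
  finally show ?thesis .
qed

text \<open>Connectedness is encoded by cuts, not by paths: this suits both growing a set from
  \<open>v\<close> and transporting connectedness to another set whose cuts can be pulled
  back.\<close>

definition conn_from :: "('a \<Rightarrow> 'a \<Rightarrow> bool) \<Rightarrow> 'a \<Rightarrow> 'a set \<Rightarrow> bool" where
  "conn_from r v W \<longleftrightarrow> v \<in> W \<and>
     (\<forall>W0. v \<in> W0 \<and> W0 \<subset> W \<longrightarrow> (\<exists>x\<in>W0. \<exists>y\<in>W - W0. r x y))"

lemma conn_fromD:
  assumes "conn_from r v W" "v \<in> W0" "W0 \<subseteq> W" "W0 \<noteq> W"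
  obtains x y where "x \<in> W0" "y \<in> W" "y \<notin> W0" "r x y"
  using assms unfolding conn_from_def by blast

text \<open>A new vertex \<open>u\<close> next to a visited \<open>x\<close> is spliced in as the
  detour \<open>x, u, x\<close>. Each vertex after the first costs two entries, whence the length
  \<open>2 * j - 1\<close>.\<close>

lemma conn_from_walk:
  assumes sym: "\<And>x y. r x y \<Longrightarrow> r y x" and conn: "conn_from r v W" and fin: "finite W"
    and j: "1 \<le> j" "j \<le> card W"
  shows "\<exists>xs. length xs = 2 * j - 1 \<and> xs \<noteq> [] \<and> hd xs = v \<and> successively r xs \<and>
    set xs \<subseteq> W \<and> card (set xs) = j"
  using j
proof (induction j rule: dec_induct)
  case base
  have "v \<in> W" using conn by (simp add: conn_from_def)
  then show ?case by (intro exI[of _ "[v]"]) auto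
next
  case (step j)
  then obtain xs where xs: "length xs = 2 * j - 1" "xs \<noteq> []" "hd xs = v" "successively r xs"
    "set xs \<subseteq> W" "card (set xs) = j" by auto
  have "v \<in> set xs" using xs hd_in_set by metis
  moreover have "set xs \<noteq> W" using xs step by auto
  ultimately obtain x u where xu: "x \<in> set xs" "u \<in> W" "u \<notin> set xs" "r x u"
    using conn_fromD[OF conn _ xs(5)] by metis
  obtain as bs where ab: "xs = as @ x # bs" using xu(1) by (meson split_list)
  let ?ys = "as @ x # u # x # bs"
  have "successively r ?ys"
    using xs(4) xu(4) sym[OF xu(4)] unfolding ab by (auto simp: successively_append_iff)
  moreover have "hd ?ys = v" using xs(3) unfolding ab by (cases as) auto
  moreover have "set ?ys = insert u (set xs)" unfolding ab by auto
  moreover have "length ?ys = 2 * Suc j - 1" using xs(1) step.hyps unfolding ab by auto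
  ultimately show ?case using xs xu by (intro exI[of _ ?ys]) auto
qed

lemma card_walks:
  assumes "\<And>x. finite {y. r x y}" "\<And>x. card {y. r x y} \<le> d"
  shows "finite {xs. length xs = Suc l \<and> hd xs = v \<and> successively r xs} \<and>
     card {xs. length xs = Suc l \<and> hd xs = v \<and> successively r xs} \<le> d ^ l"
proof (induction l arbitrary: v)
  case 0
  have "{xs. length xs = Suc 0 \<and> hd xs = v \<and> successively r xs} = {[v]}"
    by (auto simp: length_Suc_conv)
  then show ?case by simp
next
  case (Suc l)
  let ?W = "\<lambda>l v. {xs. length xs = Suc l \<and> hd xs = v \<and> successively r xs}"
  have sub: "?W (Suc l) v \<subseteq> (\<Union>y\<in>{y. r v y}. (#) v ` ?W l y)"
  proof
    fix xs assume "xs \<in> ?W (Suc l) v"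
    then obtain y ys where "xs = v # y # ys" "length ys = l" "r v y" "successively r (y # ys)"
      by (auto simp: length_Suc_conv)
    then show "xs \<in> (\<Union>y\<in>{y. r v y}. (#) v ` ?W l y)"
      by (intro UN_I[of y] imageI CollectI) auto
  qed
  have fin: "finite (\<Union>y\<in>{y. r v y}. (#) v ` ?W l y)"
    using assms(1) Suc by auto
  have "card (\<Union>y\<in>{y. r v y}. (#) v ` ?W l y) \<le> (\<Sum>y\<in>{y. r v y}. card ((#) v ` ?W l y))"
    by (rule card_UN_le) (rule assms)
  also have "\<dots> \<le> (\<Sum>y\<in>{y. r v y}. d ^ l)"
    by (intro sum_mono order_trans[OF card_image_le]) (use Suc in auto)
  also have "\<dots> \<le> d * d ^ l" using assms(2)[of v] by simp
  finally have "card (\<Union>y\<in>{y. r v y}. (#) v ` ?W l y) \<le> d ^ Suc l" by simp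
  then show ?case using sub fin card_mono[OF fin sub] finite_subset[OF sub fin] by linarith
qed

text \<open>Each such set is the range of a walk from \<open>v\<close>. Reflexivity of
  \<open>r\<close> allows padding to a common number of \<open>2 * m\<close> steps, so it is enough
  to count walks.\<close>

lemma card_conn_from:
  assumes "\<And>x. finite {y. r x y}" "\<And>x. card {y. r x y} \<le> d"
    and sym: "\<And>x y. r x y \<Longrightarrow> r y x" and refl: "\<And>x. r x x"
  shows "finite {W. finite W \<and> card W \<le> m \<and> conn_from r v W}"
    and "card {W. finite W \<and> card W \<le> m \<and> conn_from r v W} \<le> d ^ (2 * m)"
proof -
  let ?C = "{W. finite W \<and> card W \<le> m \<and> conn_from r v W}"
  let ?L = "{xs. length xs = Suc (2 * m) \<and> hd xs = v \<and> successively r xs}"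
  have sub: "?C \<subseteq> set ` ?L"
  proof
    fix W assume W: "W \<in> ?C"
    then have ge: "1 \<le> card W" by (auto simp: conn_from_def card_gt_0_iff Suc_le_eq)
    obtain xs where xs: "length xs = 2 * card W - 1" "xs \<noteq> []" "hd xs = v" "successively r xs"
      "set xs \<subseteq> W" "card (set xs) = card W"
      using conn_from_walk[where r = r and v = v and W = W and j = "card W"] sym W ge by blast
    have "set xs = W" using xs W by (simp add: card_subset_eq)
    let ?ys = "replicate (Suc (2 * m) - length xs) v @ xs"
    have "successively r (replicate j v @ xs)" for j
    proof (induction j)
      case (Suc j)
      then show ?case using refl xs by (cases j) (auto simp: successively_Cons)
    qed (use xs in auto)
    moreover have "hd ?ys = v" using xs by (auto simp: hd_append)
    moreover have "length ?ys = Suc (2 * m)" using xs W by auto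
    moreover have "set ?ys = W"
      using xs \<open>set xs = W\<close> hd_in_set[of xs] by auto
    ultimately show "W \<in> set ` ?L" by (intro image_eqI[of _ _ ?ys]) auto
  qed
  have fin: "finite ?L" and card: "card ?L \<le> d ^ (2 * m)"
    using card_walks[of r d "2 * m" v] assms by auto
  show "finite ?C" using sub fin by (meson finite_imageI finite_subset)
  have "card ?C \<le> card (set ` ?L)" using sub fin by (intro card_mono) auto
  also have "\<dots> \<le> card ?L" using fin by (rule card_image_le)
  finally show "card ?C \<le> d ^ (2 * m)" using card by linarith
qed

section \<open>Bipartite graphs without 4-cycles\<close>

text \<open>The intended instance takes consecutive layers of sizes \<open>D\<close> and
  \<open>D - 1\<close> for \<open>X\<close> and \<open>Y\<close>, with \<open>N x\<close> the shadow
  of \<open>x\<close>. Strictness in \<open>deg_Y\<close> gives every lower vertex a defect of at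
  least 1.\<close>

locale c4_free =
  fixes X Y :: "'a set" and N :: "'a \<Rightarrow> 'a set" and D :: nat
  assumes finX: "finite X" and finY: "finite Y"
    and N_sub: "x \<in> X \<Longrightarrow> N x \<subseteq> Y"
    and card_N: "x \<in> X \<Longrightarrow> card (N x) = D"
    and deg_Y: "y \<in> Y \<Longrightarrow> card {x\<in>X. y \<in> N x} < D"
    and c4: "x \<in> X \<Longrightarrow> x' \<in> X \<Longrightarrow> x \<noteq> x' \<Longrightarrow> y \<in> N x \<Longrightarrow> y \<in> N x' \<Longrightarrow>
      y' \<in> N x \<Longrightarrow> y' \<in> N x' \<Longrightarrow> y = y'"
    and D_ge: "10 \<le> D"
begin

abbreviation link :: "'a \<Rightarrow> 'a \<Rightarrow> bool" where "link x y \<equiv> N x \<inter> N y \<noteq> {}"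

definition M :: "'a \<Rightarrow> 'a set" where "M y = {x\<in>X. y \<in> N x}"
definition NS :: "'a set \<Rightarrow> 'a set" where "NS A = (\<Union>x\<in>A. N x)"
definition MS :: "'a set \<Rightarrow> 'a set" where "MS T = (\<Union>y\<in>T. M y)"
text \<open>For \<open>A \<subseteq> X\<close> this closure keeps the neighbourhood and is
  determined by it, so knowing \<open>NS A\<close> means knowing the closed set.\<close>

definition ncl :: "'a set \<Rightarrow> 'a set" where "ncl A = {x\<in>X. N x \<subseteq> NS A}"

lemma M_sub: "M y \<subseteq> X" and finM [simp]: "finite (M y)"
  using finX by (auto simp: M_def)

lemma finN: "x \<in> X \<Longrightarrow> finite (N x)"
  using N_sub finY finite_subset by blast

lemma NS_sub: "A \<subseteq> X \<Longrightarrow> NS A \<subseteq> Y"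
  using N_sub by (auto simp: NS_def)

lemma NS_Un: "NS (A \<union> B) = NS A \<union> NS B" by (auto simp: NS_def)

lemma NS_mono: "A \<subseteq> B \<Longrightarrow> NS A \<subseteq> NS B" by (auto simp: NS_def)

lemma card_M_less: "y \<in> Y \<Longrightarrow> card (M y) < D"
  unfolding M_def by (rule deg_Y)

lemma count_edges:
  assumes "P \<subseteq> X" "finite Q"
  shows "(\<Sum>x\<in>P. card (N x \<inter> Q)) = (\<Sum>y\<in>Q. card (M y \<inter> P))"
proof -
  have "finite P" using assms finX finite_subset by blast
  have "(\<Sum>x\<in>P. card {y\<in>Q. y \<in> N x}) = (\<Sum>y\<in>Q. card {x\<in>P. y \<in> N x})"
    by (rule double_count) fact+
  also have "(\<Sum>x\<in>P. card {y\<in>Q. y \<in> N x}) = (\<Sum>x\<in>P. card (N x \<inter> Q))"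
    by (intro sum.cong refl arg_cong[of _ _ card]) auto
  also have "(\<Sum>y\<in>Q. card {x\<in>P. y \<in> N x}) = (\<Sum>y\<in>Q. card (M y \<inter> P))"
    using assms by (intro sum.cong refl arg_cong[of _ _ card]) (auto simp: M_def)
  finally show ?thesis .
qed

lemma card_NS_le:
  assumes "A \<subseteq> X" shows "card (NS A) \<le> D * card A"
proof -
  have fin: "finite A" using assms finX finite_subset by blast
  have "card (NS A) \<le> (\<Sum>x\<in>A. card (N x))"
    unfolding NS_def by (rule card_UN_le) fact
  also have "\<dots> = (\<Sum>x\<in>A. D)"
    using assms by (intro sum.cong) (auto simp: card_N)
  finally show ?thesis by (simp add: mult.commute)
qed

definition L :: real where "L = ln (real D)"

lemma L_ge: "1 \<le> L"
proof -
  have "exp 1 \<le> real D" using exp_le D_ge by linarith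
  then show ?thesis unfolding L_def using ln_ge_iff[of "real D" 1] D_ge by simp
qed

end

section \<open>Closed linked sets: the defect budget and good covers\<close>

locale c4_free_closed = c4_free +
  fixes A :: "'a set" and v :: 'a
  assumes A_sub: "A \<subseteq> X" and vA: "v \<in> A"
    and closed: "x \<in> X \<Longrightarrow> N x \<subseteq> NS A \<Longrightarrow> x \<in> A"
    and conn: "conn_from link v A"
begin

definition G :: "'a set" where "G = NS A"
definition t :: nat where "t = card G - card A"

lemma finA: "finite A" using A_sub finX finite_subset by blast

lemma G_sub: "G \<subseteq> Y" unfolding G_def by (rule NS_sub[OF A_sub])

lemma finG: "finite G" using G_sub finY finite_subset by blast

lemma N_G: "x \<in> A \<Longrightarrow> N x \<subseteq> G" by (auto simp: G_def NS_def)

lemma deg_sum: "(\<Sum>y\<in>G. card (M y \<inter> A)) = D * card A"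
proof -
  have "(\<Sum>y\<in>G. card (M y \<inter> A)) = (\<Sum>x\<in>A. card (N x \<inter> G))"
    by (rule count_edges[symmetric]) (use A_sub finG in auto)
  also have "\<dots> = (\<Sum>x\<in>A. D)"
  proof (intro sum.cong refl)
    fix x assume "x \<in> A"
    then have "N x \<inter> G = N x" using N_G by auto
    then show "card (N x \<inter> G) = D" using card_N \<open>x \<in> A\<close> A_sub by auto
  qed
  finally show ?thesis by (simp add: mult.commute)
qed

lemma deg_le: "card (M y \<inter> A) \<le> card (M y)"
  by (intro card_mono) auto

lemma deg_less: "y \<in> G \<Longrightarrow> card (M y \<inter> A) < D"
  using deg_le[of y] card_M_less[of y] G_sub by fastforce

lemma G_ne: "G \<noteq> {}"
proof -
  have "N v \<noteq> {}" using card_N[of v] A_sub vA D_ge by auto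
  then show ?thesis using N_G[OF vA] by auto
qed

lemma card_A_less: "card A < card G"
proof -
  have "(\<Sum>y\<in>G. card (M y \<inter> A)) < (\<Sum>y\<in>G. D)"
    by (intro sum_strict_mono) (use finG G_ne deg_less in auto)
  then show ?thesis using deg_sum by (simp add: mult.commute)
qed

lemma card_G: "card G = card A + t" and t_pos: "0 < t"
  using card_A_less by (auto simp: t_def)

text \<open>Counting the edges at \<open>A\<close> from both sides gives \<open>D * card A\<close>,
  so the missing degrees in \<open>G\<close> add up to \<open>D * (card G - card A)\<close>. The
  later estimates in terms of \<open>t\<close> draw on this budget.\<close>

lemma defect_sum: "(\<Sum>y\<in>G. real D - real (card (M y \<inter> A))) = real t * real D"
proof -
  have "(\<Sum>y\<in>G. real D - real (card (M y \<inter> A))) = real (card G) * real D - real (\<Sum>y\<in>G. card (M y \<inter> A))"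
    by (simp add: sum_subtractf)
  also have "\<dots> = real t * real D"
    unfolding deg_sum by (simp add: card_G algebra_simps)
  finally show ?thesis .
qed

text \<open>Every vertex of \<open>G\<close> uses at least 1 of the defect budget, its degree being
  below \<open>D\<close>.\<close>

lemma card_G_le: "card G \<le> t * D"
proof -
  have "real (card G) = (\<Sum>y\<in>G. 1)" by simp
  also have "\<dots> \<le> (\<Sum>y\<in>G. real D - real (card (M y \<inter> A)))"
    by (intro sum_mono) (use deg_less in fastforce)
  finally have "real (card G) \<le> real (t * D)" by (simp add: defect_sum)
  then show ?thesis using of_nat_le_iff by blast
qed

text \<open>Since \<open>card (M y) < D\<close>, the edges at \<open>y\<close> that end outside
  \<open>A\<close> are fewer than the defect of \<open>y\<close>.\<close>

lemma out_sum: "(\<Sum>y\<in>G. real (card (M y - A))) \<le> real t * real D"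
proof -
  have "(\<Sum>y\<in>G. real (card (M y - A))) \<le> (\<Sum>y\<in>G. real D - real (card (M y \<inter> A)))"
  proof (intro sum_mono)
    fix y assume "y \<in> G"
    then have "card (M y) < D" using card_M_less G_sub by auto
    moreover have "card (M y) = card (M y \<inter> A) + card (M y - A)"
      by (metis card_Int_Diff[OF finM])
    ultimately show "real (card (M y - A)) \<le> real D - real (card (M y \<inter> A))" by simp
  qed
  then show ?thesis by (simp add: defect_sum)
qed

lemma many_low_defect:
  assumes "P \<subseteq> G" "\<And>y. y \<in> P \<Longrightarrow> 2 * card (M y \<inter> A) < D"
  shows "card P \<le> 2 * t"
proof -
  have "real (card P) * (real D / 2) = (\<Sum>y\<in>P. real D / 2)" by simp
  also have "\<dots> \<le> (\<Sum>y\<in>P. real D - real (card (M y \<inter> A)))"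
    by (intro sum_mono) (use assms(2) in fastforce)
  also have "\<dots> \<le> (\<Sum>y\<in>G. real D - real (card (M y \<inter> A)))"
  proof (intro sum_mono2)
    fix y assume "y \<in> G - P"
    then show "0 \<le> real D - real (card (M y \<inter> A))" using deg_less[of y] by simp
  qed (use finG assms in auto)
  finally have "real (card P) * (real D / 2) \<le> real t * real D" by (simp add: defect_sum)
  then have "real (card P) \<le> 2 * real t" using D_ge by (simp add: field_simps)
  then show ?thesis by linarith
qed

text \<open>Either half of \<open>P\<close> has degree below \<open>D / 2\<close> into \<open>A\<close>, and the defects add up, or the
  neighbourhoods of the other half make \<open>A\<close> large.\<close>

lemma t_ge_of_spread:
  assumes P: "P \<subseteq> G" and disj: "disjoint_family_on (\<lambda>y. M y \<inter> A - Z) P"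
    and Z: "\<And>y. y \<in> P \<Longrightarrow> card (M y \<inter> Z) \<le> c"
  shows "real (card P) \<le> 4 * real t \<or> real (card P) * (real D / 2 - real c) \<le> 2 * real t * real D"
proof (rule ccontr)
  assume neg: "\<not> ?thesis"
  define H where "H = {y\<in>P. D \<le> 2 * card (M y \<inter> A)}"
  have finP: "finite P" using P finG finite_subset by blast
  have "card (P - H) \<le> 2 * t" using P by (intro many_low_defect) (auto simp: H_def)
  moreover have "card P = card H + card (P - H)"
    using card_Int_Diff[OF finP, of H] by (simp add: H_def Int_def conj_commute)
  ultimately have H: "real (card P) / 2 \<le> real (card H)" using neg by auto
  have HP: "H \<subseteq> P" by (auto simp: H_def)
  then have finH: "finite H" using finP finite_subset by blast
  have "real (card H) * (real D / 2 - real c) = (\<Sum>y\<in>H. real D / 2 - real c)" by simp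
  also have "\<dots> \<le> (\<Sum>y\<in>H. real (card (M y \<inter> A - Z)))"
  proof (intro sum_mono)
    fix y assume y: "y \<in> H"
    have "card (M y \<inter> A) = card (M y \<inter> A \<inter> Z) + card (M y \<inter> A - Z)"
      by (rule card_Int_Diff) simp
    moreover have "card (M y \<inter> A \<inter> Z) \<le> card (M y \<inter> Z)"
      by (intro card_mono) (auto intro: finite_subset[OF _ finM])
    ultimately show "real D / 2 - real c \<le> real (card (M y \<inter> A - Z))"
      using y Z[of y] HP by (auto simp: H_def)
  qed
  also have "\<dots> = real (card (\<Union>y\<in>H. M y \<inter> A - Z))"
  proof -
    have "card (\<Union>y\<in>H. M y \<inter> A - Z) = (\<Sum>y\<in>H. card (M y \<inter> A - Z))"
      using disj HP finH by (intro card_UN_disjoint) (auto simp: disjoint_family_on_def)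
    then show ?thesis by simp
  qed
  also have "\<dots> \<le> real (card A)"
    using finA by (intro of_nat_mono card_mono) auto
  also have "\<dots> \<le> real t * real D"
    using card_A_less card_G_le by (metis less_imp_le_nat of_nat_le_iff of_nat_mult order_trans)
  finally have *: "real (card H) * (real D / 2 - real c) \<le> real t * real D" .
  show False
  proof (cases "real D / 2 - real c \<ge> 0")
    case True
    then have "real (card P) / 2 * (real D / 2 - real c) \<le> real (card H) * (real D / 2 - real c)"
      using H by (intro mult_right_mono)
    then show False using * neg by auto
  next
    case False
    then have "real (card P) * (real D / 2 - real c) \<le> 0" by (simp add: mult_nonneg_nonpos)
    also have "\<dots> \<le> 2 * real t * real D" by simp
    finally show False using neg by auto
  qed
qed

text \<open>Without 4-cycles \<open>v\<close> is the only common neighbour of two members of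
  \<open>N v\<close>. Their further neighbourhoods are therefore disjoint and
  \<open>t_ge_of_spread\<close> applies with \<open>Z = {v}\<close>. Rounding
  \<open>D <= 4 * t + 2\<close> uses \<open>D >= 10\<close>.\<close>

lemma D_le_t: "D \<le> 5 * t"
proof -
  have "disjoint_family_on (\<lambda>y. M y \<inter> A - {v}) (N v)"
    unfolding disjoint_family_on_def
  proof (intro ballI impI)
    fix y y' assume y: "y \<in> N v" "y' \<in> N v" "y \<noteq> y'"
    have "x = v" if "x \<in> M y" "x \<in> M y'" for x
      using that y c4[of x v y y'] A_sub vA by (auto simp: M_def)
    then show "(M y \<inter> A - {v}) \<inter> (M y' \<inter> A - {v}) = {}" by auto
  qed
  moreover have "card (M y \<inter> {v}) \<le> 1" for y
    by (rule order_trans[OF card_mono[of "{v}"]]) auto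
  ultimately have "real (card (N v)) \<le> 4 * real t \<or>
      real (card (N v)) * (real D / 2 - real 1) \<le> 2 * real t * real D"
    using N_G[OF vA] by (intro t_ge_of_spread) auto
  then have "real D \<le> 4 * real t \<or> real D * (real D / 2 - 1) \<le> real D * (2 * real t)"
    using card_N[of v] A_sub vA by (auto simp: mult_ac)
  then have "real D \<le> 4 * real t \<or> real D / 2 - 1 \<le> 2 * real t"
    using D_ge by (subst (asm) mult_le_cancel_left_pos) auto
  then show ?thesis using D_ge by linarith
qed

lemma closed_iff: "x \<in> A \<longleftrightarrow> x \<in> X \<and> N x \<subseteq> G"
  using closed A_sub N_G by (auto simp: G_def)

lemma M_outside:
  assumes "y \<notin> G" shows "M y \<inter> A = {}"
  using assms N_G by (auto simp: M_def)

definition high :: "'a set" where "high = {y\<in>G. D \<le> 2 * card (M y \<inter> A)}"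

lemma card_low: "card (G - high) \<le> 2 * t"
  by (intro many_low_defect) (auto simp: high_def)

text \<open>Two neighbours of \<open>y\<close> share nothing but \<open>y\<close>, so their
  remaining neighbourhoods of size \<open>D - 1\<close> add up; membership in \<open>high\<close>
  provides at least \<open>D / 2\<close> of them.\<close>

lemma card_two_step:
  assumes y: "y \<in> high"
  shows "real D ^ 2 / 4 \<le> real (card (NS (M y \<inter> A)))"
proof -
  have "(\<Sum>x\<in>M y \<inter> A. card (N x - {y})) = card (\<Union>x\<in>M y \<inter> A. N x - {y})"
  proof (intro card_UN_disjoint[symmetric] ballI impI)
    fix x x' assume "x \<in> M y \<inter> A" "x' \<in> M y \<inter> A" "x \<noteq> x'"
    then show "(N x - {y}) \<inter> (N x' - {y}) = {}"
      using c4[of x x' y] by (auto simp: M_def)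
  qed (use finN finX in \<open>auto simp: M_def\<close>)
  also have "\<dots> \<le> card (NS (M y \<inter> A))"
  proof (intro card_mono)
    show "finite (NS (M y \<inter> A))"
      using finN finX by (auto simp: NS_def M_def)
  qed (auto simp: NS_def)
  also have "(\<Sum>x\<in>M y \<inter> A. card (N x - {y})) = (\<Sum>x\<in>M y \<inter> A. D - 1)"
    by (intro sum.cong refl) (auto simp: M_def card_N)
  finally have "real (card (M y \<inter> A) * (D - 1)) \<le> real (card (NS (M y \<inter> A)))"
    by (simp only: sum_constant of_nat_le_iff of_nat_id)
  moreover have "real D / 2 * (real D / 2) \<le> real (card (M y \<inter> A)) * real (D - 1)"
    using y D_ge by (intro mult_mono) (auto simp: high_def)
  ultimately show ?thesis by (simp add: power2_eq_square)
qed

text \<open>Minimising the logarithm of the number of uncovered vertices, rather than the number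
  itself, is what yields the factor \<open>ln D\<close> instead of \<open>|G| / t\<close> in the bounds.\<close>

lemma exists_cover:
  obtains T where "T \<subseteq> G" "real (card T) \<le> 64 * real t * L / real D"
    "real (card (MS T - A)) \<le> 64 * real t * L / real D"
    "card (G - NS (MS T \<inter> A)) \<le> 3 * t"
proof -
  define U where "U = (\<lambda>T. high - NS (MS T \<inter> A))"
  define out where "out = (\<lambda>T. \<Sum>y\<in>T. real (card (M y - A)))"
  define g where "g = real (card G)"
  define d where "d = real D"
  define \<tau> where "\<tau> = real t"
  have pos: "0 < g" "0 < d" "0 < \<tau>" "\<tau> \<le> g" and g_le: "g \<le> \<tau> * d"
    using card_G t_pos D_ge card_G_le by (auto simp: g_def d_def \<tau>_def simp flip: of_nat_mult)
  \<comment> \<open>The prices make \<open>\<alpha> * g\<close> and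
    \<open>\<beta> * \<tau> * d\<close> both equal to \<open>d ^ 2 / 32\<close>. Their sum is a
    quarter of the \<open>d ^ 2 / 4\<close> supplied by \<open>card_two_step\<close>, which gives
    \<open>4 * u <= u + \<tau>\<close> below.\<close>
  define \<alpha> where "\<alpha> = d ^ 2 / (32 * g)"
  define \<beta> where "\<beta> = d / (32 * \<tau>)"
  have ab: "0 < \<alpha>" "0 < \<beta>" using pos by (auto simp: \<alpha>_def \<beta>_def)
  \<comment> \<open>The summand \<open>\<tau>\<close> keeps the logarithm from falling below
    \<open>ln \<tau>\<close>, so the total price is at most \<open>ln (g / \<tau> + 1)\<close>;
    leaving up to \<open>\<tau>\<close> vertices uncovered is affordable.\<close>
  define \<Psi> where "\<Psi> = (\<lambda>T. ln (real (card (U T)) + \<tau>) + \<alpha> * real (card T) + \<beta> * out T)"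
  have finhigh: "finite high" using finG by (auto simp: high_def)
  have "finite (Pow G)" "Pow G \<noteq> {}" using finG by auto
  then obtain T where T: "T \<in> Pow G" and min: "\<And>T'. T' \<in> Pow G \<Longrightarrow> \<Psi> T \<le> \<Psi> T'"
    using finite_minimizer[of "Pow G" \<Psi>] by blast
  have finT: "finite T" using T finG finite_subset by blast
  have out0: "0 \<le> out T" by (auto simp: out_def intro: sum_nonneg)
  define u where "u = real (card (U T))"
  have u0: "0 \<le> u" by (simp add: u_def)
  \<comment> \<open>Minimality: no \<open>y\<close> covers more new vertices than its price permits,
    where \<open>u + \<tau>\<close> is the inverse slope of the logarithm.\<close>
  have gain: "real (card (U T \<inter> NS (M y \<inter> A))) \<le> (u + \<tau>) * (\<alpha> + \<beta> * real (card (M y - A)))"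
    if y: "y \<in> G" for y
  proof (cases "y \<in> T")
    case True
    then have "U T \<inter> NS (M y \<inter> A) = {}" by (auto simp: U_def NS_def MS_def)
    then show ?thesis using ab pos u0 by simp
  next
    case False
    define c where "c = real (card (U T \<inter> NS (M y \<inter> A)))"
    have "U (insert y T) = U T - NS (M y \<inter> A)"
      by (auto simp: U_def NS_def MS_def)
    moreover have finU: "finite (U T)" using finhigh by (auto simp: U_def)
    ultimately have c: "real (card (U (insert y T))) = u - c"
      using card_Int_Diff[OF finU, of "NS (M y \<inter> A)"] by (simp add: u_def c_def)
    then have cu: "c \<le> u" by linarith
    have "\<Psi> T \<le> \<Psi> (insert y T)" using y T by (intro min) auto
    then have "ln (u + \<tau>) \<le> ln (u - c + \<tau>) + \<alpha> + \<beta> * real (card (M y - A))"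
      using False finT by (simp add: \<Psi>_def c out_def algebra_simps flip: u_def)
    moreover have "ln (u - c + \<tau>) - ln (u + \<tau>) \<le> - c / (u + \<tau>)"
    proof -
      have "ln (u - c + \<tau>) - ln (u + \<tau>) = ln ((u - c + \<tau>) / (u + \<tau>))"
        using u0 pos cu by (simp add: ln_div)
      also have "\<dots> \<le> (u - c + \<tau>) / (u + \<tau>) - 1"
        using u0 pos cu by (intro ln_le_minus_one) auto
      also have "\<dots> = - c / (u + \<tau>)" using u0 pos by (simp add: field_simps)
      finally show ?thesis .
    qed
    ultimately have "c / (u + \<tau>) \<le> \<alpha> + \<beta> * real (card (M y - A))" by simp
    then show ?thesis using u0 pos by (simp add: field_simps c_def)
  qed
  \<comment> \<open>Pairs of an uncovered \<open>w\<close> and a \<open>y\<close> two steps away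
    through \<open>A\<close> are counted from both sides: each \<open>w\<close> lies in at least
    \<open>d ^ 2 / 4\<close> pairs, and \<open>gain\<close> bounds the number at each
    \<open>y\<close>.\<close>
  have "u * (d ^ 2 / 4) = (\<Sum>w\<in>U T. d ^ 2 / 4)" by (simp add: u_def)
  also have "\<dots> \<le> (\<Sum>w\<in>U T. real (card {y\<in>G. w \<in> NS (M y \<inter> A)}))"
  proof (intro sum_mono)
    fix w assume "w \<in> U T"
    then have w: "w \<in> high" by (simp add: U_def)
    have "NS (M w \<inter> A) \<subseteq> {y\<in>G. w \<in> NS (M y \<inter> A)}"
      using N_G by (auto simp: NS_def M_def)
    then have "card (NS (M w \<inter> A)) \<le> card {y\<in>G. w \<in> NS (M y \<inter> A)}"
      using finG by (intro card_mono) auto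
    then show "d ^ 2 / 4 \<le> real (card {y\<in>G. w \<in> NS (M y \<inter> A)})"
      using card_two_step[OF w] by (simp add: d_def)
  qed
  also have "\<dots> = (\<Sum>y\<in>G. real (card {w\<in>U T. w \<in> NS (M y \<inter> A)}))"
  proof -
    have "finite (U T)" using finhigh by (auto simp: U_def)
    from double_count[OF this finG, of "\<lambda>w y. w \<in> NS (M y \<inter> A)"] show ?thesis
      by (simp only: of_nat_sum[symmetric])
  qed
  also have "\<dots> \<le> (\<Sum>y\<in>G. (u + \<tau>) * (\<alpha> + \<beta> * real (card (M y - A))))"
  proof (intro sum_mono)
    fix y assume "y \<in> G"
    moreover have "{w\<in>U T. w \<in> NS (M y \<inter> A)} = U T \<inter> NS (M y \<inter> A)" by auto
    ultimately show "real (card {w\<in>U T. w \<in> NS (M y \<inter> A)}) \<le> (u + \<tau>) * (\<alpha> + \<beta> * real (card (M y - A)))"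
      using gain by simp
  qed
  also have "\<dots> = (u + \<tau>) * (\<alpha> * g + \<beta> * (\<Sum>y\<in>G. real (card (M y - A))))"
    by (simp add: sum.distrib sum_distrib_left[symmetric] g_def)
  also have "\<dots> \<le> (u + \<tau>) * (\<alpha> * g + \<beta> * (\<tau> * d))"
    using out_sum ab u0 pos by (intro mult_left_mono add_left_mono) (auto simp: \<tau>_def d_def)
  also have "\<dots> = (u + \<tau>) * (d ^ 2 / 16)"
    using pos by (simp add: \<alpha>_def \<beta>_def field_simps power2_eq_square)
  finally have "d ^ 2 * (4 * u) \<le> d ^ 2 * (u + \<tau>)" by (simp add: field_simps)
  then have "4 * u \<le> u + \<tau>" using pos by simp
  then have u_le: "u \<le> \<tau>" using pos by simp
  have "U {} \<subseteq> G" by (auto simp: U_def high_def)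
  then have "card (U {}) \<le> card G" using finG by (intro card_mono)
  then have "\<Psi> {} \<le> ln (g + \<tau>)" using pos by (simp add: \<Psi>_def out_def g_def)
  moreover have "\<Psi> T \<le> \<Psi> {}" by (rule min) simp
  moreover have "ln \<tau> \<le> ln (u + \<tau>)" using pos u0 by simp
  ultimately have tot: "\<alpha> * real (card T) + \<beta> * out T \<le> ln (g + \<tau>) - ln \<tau>"
    by (simp add: \<Psi>_def u_def)
  also have "\<dots> = ln (g / \<tau> + 1)"
  proof -
    have "g / \<tau> + 1 = (g + \<tau>) / \<tau>" using pos by (simp add: field_simps)
    then show ?thesis using pos by (simp add: ln_div)
  qed
  also have "\<dots> \<le> ln (d ^ 2)"
  proof -
    have "g / \<tau> \<le> d" using pos g_le by (simp add: field_simps)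
    moreover have "d + 1 \<le> d ^ 2"
    proof -
      have "d + 1 \<le> 2 * d" using D_ge by (simp add: d_def)
      also have "\<dots> \<le> d ^ 2" using D_ge by (simp add: d_def power2_eq_square)
      finally show ?thesis .
    qed
    ultimately show ?thesis using pos by (subst ln_le_cancel_iff) (auto intro: add_pos_pos)
  qed
  also have "\<dots> = 2 * L" using pos by (simp add: L_def d_def ln_realpow)
  finally have tot: "\<alpha> * real (card T) + \<beta> * out T \<le> 2 * L" .
  show thesis
  proof (rule that[of T])
    show "T \<subseteq> G" using T by simp
    have "\<alpha> * real (card T) \<le> 2 * L"
      using tot mult_nonneg_nonneg[of \<beta> "out T"] ab out0 by linarith
    then have "real (card T) \<le> 2 * L / \<alpha>" using ab by (simp add: field_simps)
    also have "\<dots> = 64 * L * g / d ^ 2" by (simp add: \<alpha>_def)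
    also have "\<dots> \<le> 64 * L * (\<tau> * d) / d ^ 2"
      using g_le L_ge by (intro divide_right_mono mult_left_mono) auto
    also have "\<dots> = 64 * real t * L / real D"
      using pos by (simp add: \<tau>_def d_def power2_eq_square)
    finally show "real (card T) \<le> 64 * real t * L / real D" .
    have "real (card (MS T - A)) \<le> out T"
    proof -
      have "MS T - A = (\<Union>y\<in>T. M y - A)" by (auto simp: MS_def)
      then have "card (MS T - A) \<le> (\<Sum>y\<in>T. card (M y - A))"
        using card_UN_le[OF finT, of "\<lambda>y. M y - A"] by simp
      then show ?thesis unfolding out_def by (simp flip: of_nat_sum)
    qed
    also have "\<dots> \<le> 2 * L / \<beta>"
    proof -
      have "\<beta> * out T \<le> 2 * L"
        using tot mult_nonneg_nonneg[of \<alpha> "real (card T)"] ab by linarith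
      then show ?thesis using ab by (simp add: field_simps)
    qed
    also have "\<dots> = 64 * real t * L / real D" by (simp add: \<beta>_def \<tau>_def d_def)
    finally show "real (card (MS T - A)) \<le> 64 * real t * L / real D" .
    have "card (G - NS (MS T \<inter> A)) \<le> card ((G - high) \<union> U T)"
      using finG finhigh by (intro card_mono) (auto simp: U_def)
    also have "\<dots> \<le> card (G - high) + card (U T)" by (rule card_Un_le)
    also have "\<dots> \<le> 2 * t + t" using card_low u_le by (intro add_mono) (auto simp: u_def \<tau>_def)
    finally show "card (G - NS (MS T \<inter> A)) \<le> 3 * t" by simp
  qed
qed

text \<open>Minimise the number of uncovered vertices plus \<open>D / 2\<close> per chosen vertex:
  an \<open>x\<close> with more than \<open>D / 2\<close> uncovered neighbours would be worth
  adding. Afterwards all of \<open>A\<close> passes the test of being half covered, so a superset of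
  \<open>A\<close> can be computed from the cover alone.\<close>

lemma exists_half_cover:
  assumes F: "F \<subseteq> G" "card (G - F) \<le> 3 * t"
  obtains X1 where "X1 \<subseteq> A" "real (card X1) \<le> 6 * real t / real D"
    "\<And>x. x \<in> A \<Longrightarrow> 2 * card (N x - (F \<union> NS X1)) \<le> D"
proof -
  define f where "f = (\<lambda>Q. real (card (G - (F \<union> NS Q))) + real D / 2 * real (card Q))"
  have "finite (Pow A)" "Pow A \<noteq> {}" using finA by auto
  then obtain Q where Q: "Q \<in> Pow A" and min: "\<And>Q'. Q' \<in> Pow A \<Longrightarrow> f Q \<le> f Q'"
    using finite_minimizer[of "Pow A" f] by blast
  have finQ: "finite Q" using Q finA finite_subset by blast
  show thesis
  proof (rule that[of Q])
    show "Q \<subseteq> A" using Q by simp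
    have "f Q \<le> f {}" by (rule min) simp
    then have "real D / 2 * real (card Q) \<le> real (card (G - F))" by (simp add: f_def NS_def)
    also have "\<dots> \<le> 3 * real t" using F(2) by linarith
    finally show "real (card Q) \<le> 6 * real t / real D" using D_ge by (simp add: field_simps)
    fix x assume x: "x \<in> A"
    show "2 * card (N x - (F \<union> NS Q)) \<le> D"
    proof (cases "x \<in> Q")
      case True
      then have "N x - (F \<union> NS Q) = {}" by (auto simp: NS_def)
      then have "card (N x - (F \<union> NS Q)) = 0" by (simp only: card.empty)
      then show ?thesis by linarith
    next
      case False
      have "f Q \<le> f (insert x Q)" using x Q by (intro min) auto
      moreover have "card (G - (F \<union> NS Q)) = card (N x - (F \<union> NS Q)) + card (G - (F \<union> NS (insert x Q)))"
      proof -
        have "(G - (F \<union> NS Q)) \<inter> N x = N x - (F \<union> NS Q)" using N_G[OF x] by auto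
        moreover have "(G - (F \<union> NS Q)) - N x = G - (F \<union> NS (insert x Q))" by (auto simp: NS_def)
        ultimately show ?thesis
          using card_Int_Diff[of "G - (F \<union> NS Q)" "N x"] finG by simp
      qed
      ultimately show ?thesis using False finQ by (simp add: f_def algebra_simps)
    qed
  qed
qed

end

section \<open>Bounded distance in the graph, and the enumeration of approximating states\<close>

lemma card_relpowp:
  fixes r :: "'a \<Rightarrow> 'a \<Rightarrow> bool"
  assumes "\<And>x. finite {y. r x y}" "\<And>x. card {y. r x y} \<le> d"
  shows "finite {y. (r ^^ n) x y} \<and> card {y. (r ^^ n) x y} \<le> d ^ n"
proof (induction n)
  case 0
  have "{y. (r ^^ 0) x y} = {x}" by auto
  then show ?case by (simp del: relpowp.simps)
next
  case (Suc n)
  have eq: "{y. (r ^^ Suc n) x y} = (\<Union>z\<in>{y. (r ^^ n) x y}. {y. r z y})" by auto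
  have "card (\<Union>z\<in>{y. (r ^^ n) x y}. {y. r z y}) \<le> (\<Sum>z\<in>{y. (r ^^ n) x y}. card {y. r z y})"
    using Suc by (intro card_UN_le) auto
  also have "\<dots> \<le> (\<Sum>z\<in>{y. (r ^^ n) x y}. d)" by (intro sum_mono assms)
  also have "\<dots> \<le> d ^ n * d" using Suc by simp
  finally have "card {y. (r ^^ Suc n) x y} \<le> d ^ Suc n" unfolding eq by (simp add: mult.commute)
  moreover have "finite {y. (r ^^ Suc n) x y}" unfolding eq using Suc assms by auto
  ultimately show ?case by blast
qed

lemma relpowp_mono_refl:
  assumes "\<And>x. r x x" "(r ^^ i) x y" "i \<le> j"
  shows "(r ^^ j) x y"
  using assms(3) by (induction j rule: dec_induct) (use assms in auto)

lemma relpowp_comp: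
  assumes "(r ^^ i) x y" "(r ^^ j) y z"
  shows "(r ^^ (i + j)) x z"
  using assms by (auto simp: relpowp_add)

lemma relpowp_sym:
  assumes "\<And>x y. r x y \<Longrightarrow> r y x" "(r ^^ i) x y"
  shows "(r ^^ i) y x"
  using assms(2)
proof (induction i arbitrary: y)
  case (Suc i)
  then obtain z where "(r ^^ i) x z" "r z y" by auto
  then have "(r ^^ i) z x" "r y z" using Suc.IH assms(1) by auto
  then show ?case by (meson relpowp_Suc_I2)
qed auto

context c4_free
begin

text \<open>Both sides of the graph live in one type. Loops are included so that distance at most
  \<open>i\<close> is a relational power and walks can be padded.\<close>

definition adj :: "'a \<Rightarrow> 'a \<Rightarrow> bool" where
  "adj x y \<longleftrightarrow> x = y \<or> x \<in> X \<and> y \<in> N x \<or> y \<in> X \<and> x \<in> N y"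

definition reach :: "nat \<Rightarrow> 'a \<Rightarrow> 'a \<Rightarrow> bool" where "reach i = adj ^^ i"

text \<open>The radius comes from \<open>conn_code\<close>: 3 steps from the code to a vertex of
  \<open>A\<close>, 2 to a linked vertex, 3 back to the code.\<close>

abbreviation near :: "'a \<Rightarrow> 'a \<Rightarrow> bool" where "near \<equiv> reach 8"

lemma adj_sym: "adj x y \<Longrightarrow> adj y x" and adj_refl: "adj x x"
  by (auto simp: adj_def)

lemma card_adj: "finite {y. adj x y} \<and> card {y. adj x y} \<le> D ^ 2"
proof -
  let ?A = "if x \<in> X then N x else {}"
  have sub: "{y. adj x y} = insert x (?A \<union> M x)"
    by (auto simp: adj_def M_def)
  have fin: "finite (insert x (?A \<union> M x))" using finN by auto
  have "card (M x) \<le> D"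
  proof (cases "x \<in> Y")
    case True then show ?thesis using card_M_less[of x] by simp
  next
    case False
    then have "M x = {}" using N_sub by (auto simp: M_def)
    then show ?thesis by simp
  qed
  moreover have "card ?A \<le> D" using card_N by auto
  ultimately have "card (?A \<union> M x) \<le> 2 * D"
    using card_Un_le[of ?A "M x"] by linarith
  then have "card (insert x (?A \<union> M x)) \<le> Suc (2 * D)"
    using card_insert_le_m1[of "Suc (2 * D)" "?A \<union> M x" x] by simp
  also have "\<dots> \<le> 10 * D" using D_ge by simp
  also have "\<dots> \<le> D ^ 2" using D_ge by (simp add: power2_eq_square)
  finally show ?thesis using fin unfolding sub by blast
qed

lemma reach_sym: "reach i x y \<Longrightarrow> reach i y x"
  unfolding reach_def by (rule relpowp_sym[OF adj_sym])

lemma reach_mono: "reach i x y \<Longrightarrow> i \<le> j \<Longrightarrow> reach j x y"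
  unfolding reach_def by (rule relpowp_mono_refl[OF adj_refl])

lemma reach_add: "reach i x y \<Longrightarrow> reach j y z \<Longrightarrow> i + j \<le> k \<Longrightarrow> reach k x z"
  using relpowp_comp[of i adj x y j z] reach_mono[of "i + j" x z k] by (simp add: reach_def)

lemma reach_refl: "reach i x x"
  using reach_mono[of 0 x x i] by (simp add: reach_def)

lemma reach_adj: "adj x y \<Longrightarrow> reach 1 x y"
  by (auto simp: reach_def)

lemma reach_2: "x \<in> X \<Longrightarrow> x' \<in> X \<Longrightarrow> N x \<inter> N x' \<noteq> {} \<Longrightarrow> reach 2 x x'"
  using reach_add[OF reach_adj reach_adj, of x _ x' 2] by (fastforce simp: adj_def)

lemma card_near: "finite {y. near x y}" "card {y. near x y} \<le> D ^ 16"
  using card_relpowp[of adj "D ^ 2" 8 x] card_adj by (auto simp: reach_def power_mult[symmetric])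

text \<open>A state \<open>(F, S)\<close> approximates a closed set \<open>A\<close> with \<open>NS A = G\<close> by \<open>F \<subseteq> G\<close> and \<open>A \<subseteq> S\<close>.\<close>

definition init_states :: "'a \<Rightarrow> nat \<Rightarrow> ('a set \<times> 'a set) set" where
  "init_states v m = (\<lambda>(W, T, Om, X1). let F = NS ((MS T - Om) \<union> X1) in
      (F, {x\<in>X. 2 * card (N x - F) \<le> D})) `
    Sigma {W. finite W \<and> card W \<le> m \<and> conn_from near v W} (\<lambda>W. Pow W \<times> Pow W \<times> Pow W)"

text \<open>\<open>Om\<close> is meant to record the neighbours of \<open>T\<close> outside
  \<open>A\<close>, so that \<open>MS T - Om\<close> is \<open>MS T \<inter> A\<close> without
  knowledge of \<open>A\<close>. There are at most \<open>D ^ (32 * m)\<close> connected sets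
  \<open>W\<close>, and the three subsets of \<open>W\<close> cost
  \<open>8 ^ m <= D ^ m\<close>.\<close>

lemma card_init_states:
  "finite (init_states v m)" "card (init_states v m) \<le> D ^ (33 * m)"
proof -
  let ?C = "{W. finite W \<and> card W \<le> m \<and> conn_from near v W}"
  let ?S = "Sigma ?C (\<lambda>W. Pow W \<times> Pow W \<times> Pow W)"
  have C: "finite ?C" "card ?C \<le> (D ^ 16) ^ (2 * m)"
    by (rule card_conn_from[OF card_near reach_sym reach_refl], assumption)+
  have fin: "finite ?S" using C by (intro finite_SigmaI) auto
  then show "finite (init_states v m)" unfolding init_states_def by (rule finite_imageI)
  have "card (init_states v m) \<le> card ?S" unfolding init_states_def using fin by (rule card_image_le)
  also have "\<dots> = (\<Sum>W\<in>?C. card (Pow W \<times> Pow W \<times> Pow W))"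
    using C by (intro card_SigmaI) auto
  also have "\<dots> \<le> (\<Sum>W\<in>?C. D ^ m)"
  proof (intro sum_mono)
    fix W assume W: "W \<in> ?C"
    then have "card (Pow W \<times> Pow W \<times> Pow W) = 2 ^ card W * (2 ^ card W * 2 ^ card W)"
      by (simp add: card_cartesian_product card_Pow)
    also have "\<dots> = (2 * (2 * 2)) ^ card W" by (simp only: power_mult_distrib)
    also have "\<dots> = 8 ^ card W" by simp
    also have "\<dots> \<le> D ^ card W" using D_ge by (intro power_mono) auto
    also have "\<dots> \<le> D ^ m" using D_ge W by (intro power_increasing) auto
    finally show "card (Pow W \<times> Pow W \<times> Pow W) \<le> D ^ m" .
  qed
  also have "\<dots> = card ?C * D ^ m" by simp
  also have "\<dots> \<le> (D ^ 16) ^ (2 * m) * D ^ m" using C by (intro mult_right_mono) auto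
  also have "\<dots> = D ^ (16 * (2 * m) + m)" by (simp only: power_add power_mult)
  also have "16 * (2 * m) + m = 33 * m" by simp
  finally show "card (init_states v m) \<le> D ^ (33 * m)" .
qed

definition small_subsets :: "real \<Rightarrow> 'a set \<Rightarrow> 'a set set" where
  "small_subsets q S = {P. P \<subseteq> S \<and> real (card P) \<le> q}"

fun refine :: "'a set \<times> 'a set \<Rightarrow> 'a set \<times> 'a set \<Rightarrow> 'a set \<times> 'a set" where
  "refine (F, S) (P, Q) = (F \<union> NS P, S - MS Q)"

text \<open>For the minimising choice in \<open>step_state\<close>, members of \<open>A\<close> have
  at most \<open>\<psi>\<close> neighbours outside \<open>F\<close>, and a vertex with more than
  \<open>\<psi>\<close> neighbours in the remaining set must lie in \<open>G\<close>. Trimming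
  involves no further choice, so offering it as an alternative at most doubles the count.\<close>

fun trim :: "real \<Rightarrow> 'a set \<Rightarrow> 'a set \<times> 'a set \<Rightarrow> 'a set \<times> 'a set" where
  "trim \<psi> S0 (F, S) = (F \<union> {y\<in>NS S0. \<psi> < real (card (M y \<inter> {x\<in>S. real (card (N x - F)) \<le> \<psi>}))},
     {x\<in>S. real (card (N x - F)) \<le> \<psi>})"

definition step_states :: "real \<Rightarrow> real \<Rightarrow> 'a set \<times> 'a set \<Rightarrow> ('a set \<times> 'a set) set" where
  "step_states \<psi> q p =
     refine p ` (small_subsets q (snd p) \<times> small_subsets q (NS (snd p))) \<union>
     (trim \<psi> (snd p) \<circ> refine p) ` (small_subsets q (snd p) \<times> small_subsets q (NS (snd p)))"

text \<open>States are generated without reference to \<open>A\<close>, so some approximate nothing.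
  This guard keeps the second component small enough for counting, and good states satisfy it for
  \<open>\<tau> = t\<close>.\<close>

definition admissible :: "nat \<Rightarrow> 'a set \<times> 'a set \<Rightarrow> bool" where
  "admissible \<tau> p \<longleftrightarrow> snd p \<subseteq> X \<and> card (snd p) \<le> 2 * \<tau> * D"

lemma D_powr: "real D powr x = exp (x * L)"
  using D_ge by (simp add: powr_def L_def)

text \<open>With \<open>q = 10 * \<tau> / D\<close> the two ground sets have at most
  \<open>D ^ 2 / 5 * q\<close> and \<open>D ^ 3 / 5 * q\<close> elements. As
  \<open>exp 1 <= 5\<close>, they have at most \<open>D powr (2 * q)\<close> and
  \<open>D powr (3 * q)\<close> small subsets; the choice whether to trim fits into one more
  \<open>D powr q\<close>.\<close>

lemma card_step_states:
  assumes p: "admissible \<tau> p" and \<tau>: "D \<le> 5 * \<tau>"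
  shows "finite (step_states \<psi> (10 * real \<tau> / real D) p)"
    and "real (card (step_states \<psi> (10 * real \<tau> / real D) p)) \<le> exp (60 * real \<tau> * L / real D)"
proof -
  obtain F S where FS: "p = (F, S)" by force
  define q where "q = 10 * real \<tau> / real D"
  have S: "S \<subseteq> X" "card S \<le> 2 * \<tau> * D" using p by (auto simp: FS admissible_def)
  have finS: "finite S" using S finX finite_subset by blast
  have finNS: "finite (NS S)" using NS_sub[OF S(1)] finY finite_subset by blast
  have q: "2 \<le> q" using \<tau> D_ge by (simp add: q_def field_simps)
  define d where "d = real D"
  have d: "10 \<le> d" using D_ge by (simp add: d_def)
  let ?P = "{P. P \<subseteq> S \<and> real (card P) \<le> q}" and ?Q = "{Q. Q \<subseteq> NS S \<and> real (card Q) \<le> q}"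
  have finP: "finite ?P" by (rule finite_subset[of _ "Pow S"]) (use finS in auto)
  have finQ: "finite ?Q" by (rule finite_subset[of _ "Pow (NS S)"]) (use finNS in auto)
  have e: "exp 1 * (x / 5) \<le> x" if "0 \<le> x" for x :: real
  proof -
    have "exp 1 \<le> (5::real)" using exp_le by linarith
    then have "exp 1 * (x / 5) \<le> 5 * (x / 5)" by (rule mult_right_mono) (use that in simp)
    then show ?thesis by linarith
  qed
  have d5: "5 \<le> d ^ 2" "5 \<le> d ^ 3"
    using order_trans[OF d self_le_power[of d 2]] order_trans[OF d self_le_power[of d 3]] d
    by linarith+
  have "real (card ?P) \<le> (exp 1 * (d ^ 2 / 5)) powr q"
  proof (rule card_small_subsets[OF finS])
    have "real (card S) \<le> real (2 * \<tau> * D)" using S(2) of_nat_mono by blast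
    also have "\<dots> = d ^ 2 / 5 * q" using d by (simp add: q_def d_def power2_eq_square)
    finally show "real (card S) \<le> d ^ 2 / 5 * q" .
  qed (use d5 q in auto)
  also have "\<dots> \<le> (d ^ 2) powr q" using q d by (intro powr_mono2 e) auto
  also have "\<dots> = d powr (2 * q)" using d by (simp add: powr_def ln_realpow)
  finally have P: "real (card ?P) \<le> d powr (2 * q)" .
  have "real (card ?Q) \<le> (exp 1 * (d ^ 3 / 5)) powr q"
  proof (rule card_small_subsets[OF finNS])
    have "card (NS S) \<le> D * (2 * \<tau> * D)"
      using card_NS_le[OF S(1)] S(2) by (meson le_trans mult_le_mono2)
    then have "real (card (NS S)) \<le> real (D * (2 * \<tau> * D))" using of_nat_mono by blast
    also have "\<dots> = d ^ 3 / 5 * q" using d by (simp add: q_def d_def power3_eq_cube)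
    finally show "real (card (NS S)) \<le> d ^ 3 / 5 * q" .
  qed (use d5 q in auto)
  also have "\<dots> \<le> (d ^ 3) powr q" using q d by (intro powr_mono2 e) auto
  also have "\<dots> = d powr (3 * q)" using d by (simp add: powr_def ln_realpow)
  finally have Q: "real (card ?Q) \<le> d powr (3 * q)" .
  have fin: "finite (?P \<times> ?Q)" using finP finQ by auto
  have st: "step_states \<psi> q p = refine p ` (?P \<times> ?Q) \<union> (trim \<psi> S \<circ> refine p) ` (?P \<times> ?Q)"
    by (simp add: step_states_def FS small_subsets_def)
  show "finite (step_states \<psi> (10 * real \<tau> / real D) p)"
    unfolding q_def[symmetric] st using fin by blast
  have "card (step_states \<psi> q p) \<le> card (refine p ` (?P \<times> ?Q)) + card ((trim \<psi> S \<circ> refine p) ` (?P \<times> ?Q))"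
    unfolding st by (rule card_Un_le)
  also have "\<dots> \<le> card (?P \<times> ?Q) + card (?P \<times> ?Q)"
    using card_image_le[OF fin, of "refine p"] card_image_le[OF fin, of "trim \<psi> S \<circ> refine p"]
    by (rule add_mono)
  also have "\<dots> = 2 * (card ?P * card ?Q)" by (simp add: card_cartesian_product)
  finally have "real (card (step_states \<psi> q p)) \<le> real (2 * (card ?P * card ?Q))"
    by (rule of_nat_mono)
  then have "real (card (step_states \<psi> q p)) \<le> 2 * (real (card ?P) * real (card ?Q))"
    by (simp only: of_nat_mult of_nat_numeral)
  also have "\<dots> \<le> d powr q * (d powr (2 * q) * d powr (3 * q))"
  proof (intro mult_mono P Q)
    have "2 \<le> d powr 1" using d by simp
    also have "\<dots> \<le> d powr q" using d q by (intro powr_mono) auto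
    finally show "2 \<le> d powr q" .
  qed auto
  also have "\<dots> = d powr (6 * q)" by (simp add: powr_add[symmetric])
  also have "\<dots> = exp (60 * real \<tau> * L / real D)"
    unfolding d_def D_powr by (simp add: q_def)
  finally show "real (card (step_states \<psi> (10 * real \<tau> / real D) p)) \<le> exp (60 * real \<tau> * L / real D)"
    by (simp add: q_def)
qed

text \<open>The \<open>139\<close> is \<open>5 + 64 + 64 + 6\<close> from \<open>init_state\<close>.
  Round \<open>i\<close> starts from the bound \<open>4 * \<tau> / 2 ^ i\<close> on
  \<open>card S - card F\<close>, and \<open>2 / 5 * D / 2 ^ i\<close> is the threshold that
  \<open>step_state\<close> attaches to this bound.\<close>

primrec states :: "'a \<Rightarrow> nat \<Rightarrow> nat \<Rightarrow> ('a set \<times> 'a set) set" where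
  "states v \<tau> 0 = init_states v (nat \<lfloor>139 * real \<tau> * L / real D\<rfloor>)"
| "states v \<tau> (Suc i) = (\<Union>p\<in>{p\<in>states v \<tau> i. admissible \<tau> p}.
     step_states (2 / 5 * real D / 2 ^ i) (10 * real \<tau> / real D) p)"

lemma card_states:
  assumes \<tau>: "D \<le> 5 * \<tau>"
  shows "finite (states v \<tau> i) \<and>
    real (card (states v \<tau> i)) \<le> exp (4600 * real \<tau> * L ^ 2 / real D + real i * (60 * real \<tau> * L / real D))"
proof (induction i)
  case 0
  let ?m = "nat \<lfloor>139 * real \<tau> * L / real D\<rfloor>"
  have "real (card (init_states v ?m)) \<le> real (D ^ (33 * ?m))"
    using card_init_states(2) of_nat_le_iff by blast
  also have "\<dots> = real D powr real (33 * ?m)"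
  proof -
    have "0 < real D" using D_ge by simp
    from powr_realpow[OF this, of "33 * ?m"] show ?thesis by (simp only: of_nat_power)
  qed
  also have "\<dots> = exp (33 * real ?m * L)" unfolding D_powr by simp
  also have "\<dots> \<le> exp (33 * (139 * real \<tau> * L / real D) * L)"
  proof -
    have "real ?m \<le> 139 * real \<tau> * L / real D" using L_ge by simp
    then have "33 * real ?m * L \<le> 33 * (139 * real \<tau> * L / real D) * L"
      using L_ge by (intro mult_right_mono mult_left_mono) auto
    then show ?thesis by simp
  qed
  also have "\<dots> \<le> exp (4600 * real \<tau> * L ^ 2 / real D)"
  proof -
    have "33 * (139 * real \<tau> * L / real D) * L = 4587 * (real \<tau> * L ^ 2 / real D)"
      by (simp add: power2_eq_square)
    also have "\<dots> \<le> 4600 * (real \<tau> * L ^ 2 / real D)"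
      using L_ge by (intro mult_right_mono) auto
    finally show ?thesis by simp
  qed
  finally show ?case using card_init_states(1) by simp
next
  case (Suc i)
  let ?a = "4600 * real \<tau> * L ^ 2 / real D" and ?b = "60 * real \<tau> * L / real D"
  let ?B = "{p\<in>states v \<tau> i. admissible \<tau> p}"
  let ?st = "step_states (2 / 5 * real D / 2 ^ i) (10 * real \<tau> / real D)"
  have fin: "finite ?B" using Suc by auto
  have "card (states v \<tau> (Suc i)) \<le> (\<Sum>p\<in>?B. card (?st p))"
    unfolding states.simps by (rule card_UN_le[OF fin])
  then have "real (card (states v \<tau> (Suc i))) \<le> real (\<Sum>p\<in>?B. card (?st p))"
    by (rule of_nat_mono)
  also have "\<dots> = (\<Sum>p\<in>?B. real (card (?st p)))" by (rule of_nat_sum)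
  also have "\<dots> \<le> (\<Sum>p\<in>?B. exp ?b)"
    using card_step_states(2)[OF _ \<tau>] by (intro sum_mono) auto
  also have "\<dots> = real (card ?B) * exp ?b" by simp
  also have "\<dots> \<le> exp (?a + real i * ?b) * exp ?b"
  proof (intro mult_right_mono)
    have "card ?B \<le> card (states v \<tau> i)" using Suc by (intro card_mono) auto
    then show "real (card ?B) \<le> exp (?a + real i * ?b)" using Suc by linarith
  qed auto
  also have "\<dots> = exp (?a + real (Suc i) * ?b)"
  proof -
    have "exp (a + real i * b) * exp b = exp (a + real (Suc i) * b)" for a b :: real
      by (simp add: exp_add[symmetric] algebra_simps)
    then show ?thesis .
  qed
  finally have "real (card (states v \<tau> (Suc i))) \<le> exp (?a + real (Suc i) * ?b)" .
  moreover have "finite (states v \<tau> (Suc i))"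
    unfolding states.simps using fin card_step_states(1)[OF _ \<tau>] by (intro finite_UN_I) blast+
  ultimately show ?case by blast
qed

end

section \<open>The initial approximation of a closed linked set\<close>

context c4_free_closed
begin

definition good :: "'a set \<Rightarrow> 'a set \<Rightarrow> bool" where
  "good F S \<longleftrightarrow> F \<subseteq> G \<and> A \<subseteq> S \<and> S \<subseteq> X \<and> card (G - F) \<le> 3 * t \<and> card (S - A) \<le> 2 * t"

lemma good_card:
  assumes "good F S"
  shows "card G = card F + card (G - F)" "card S = card A + card (S - A)"
proof -
  have "F \<subseteq> G" "finite S" "A \<subseteq> S" using assms finX finite_subset unfolding good_def by blast+
  then show "card G = card F + card (G - F)" "card S = card A + card (S - A)"
    using card_Int_Diff[OF finG, of F] card_Int_Diff[of S A] by (simp_all add: Int_absorb1)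
qed

lemma good_admissible:
  assumes "good F S" shows "admissible t (F, S)"
proof -
  have "card S \<le> card A + 2 * t" using good_card[OF assms] assms by (simp add: good_def)
  also have "\<dots> \<le> t * D + t * D"
    using card_A_less card_G_le D_ge by (intro add_mono) auto
  finally show ?thesis using assms by (simp add: admissible_def good_def)
qed

text \<open>Every vertex of \<open>A\<close> is within distance 3 of the code and every code vertex
  within distance 2 of \<open>A\<close>. A cut of the code induces a cut of \<open>A\<close>, which
  a link crosses; this pulls back to code vertices at distance at most
  \<open>3 + 2 + 3\<close>.\<close>

lemma conn_code:
  assumes T: "T \<subseteq> G" and X1: "X1 \<subseteq> A"
    and cov: "\<And>x. x \<in> A \<Longrightarrow> N x \<inter> NS ((MS T \<inter> A) \<union> X1) \<noteq> {}"
  shows "conn_from near v (insert v (T \<union> (MS T - A) \<union> X1))" (is "conn_from near v ?W")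
proof -
  have near_A: "\<exists>w\<in>?W. reach 3 x w" if x: "x \<in> A" for x
  proof -
    obtain x' where x': "N x \<inter> N x' \<noteq> {}" "x' \<in> (MS T \<inter> A) \<union> X1"
      using cov[OF x] by (auto simp: NS_def)
    have "x' \<in> X" "x \<in> X" using x' X1 A_sub x by auto
    then have 2: "reach 2 x x'" using x' by (intro reach_2)
    show ?thesis
    proof (cases "x' \<in> X1")
      case True
      have "reach 3 x x'" by (rule reach_mono[OF 2]) simp
      then show ?thesis using True by blast
    next
      case False
      then obtain z where z: "z \<in> T" "x' \<in> M z" using x' by (auto simp: MS_def)
      then have "adj x' z" by (auto simp: M_def adj_def)
      then have "reach 3 x z" by (intro reach_add[OF 2 reach_adj]) auto
      then show ?thesis using z by blast
    qed
  qed
  have T_A: "\<exists>a\<in>A. adj w a" if "w \<in> T" for w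
  proof -
    from that T obtain a where "a \<in> A" "w \<in> N a" by (auto simp: G_def NS_def)
    then show ?thesis using A_sub by (auto simp: adj_def)
  qed
  have near_W: "\<exists>a\<in>A. reach 2 w a" if w: "w \<in> ?W" for w
  proof -
    consider "w \<in> A" | "w \<in> T" | "w \<in> MS T - A" using w X1 vA by blast
    then show ?thesis
    proof cases
      case 1
      then show ?thesis using reach_refl by blast
    next
      case 2
      then obtain a where a: "a \<in> A" "adj w a" using T_A by blast
      have "reach 2 w a" by (rule reach_mono[OF reach_adj[OF a(2)]]) simp
      then show ?thesis using a by blast
    next
      case 3
      then obtain z where z: "z \<in> T" "w \<in> M z" by (auto simp: MS_def)
      then obtain a where a: "a \<in> A" "adj z a" using T_A by blast
      have "adj w z" using z by (auto simp: M_def adj_def)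
      then have "reach 2 w a" by (rule reach_add[OF reach_adj reach_adj[OF a(2)]]) simp
      then show ?thesis using a by blast
    qed
  qed
  show ?thesis unfolding conn_from_def
  proof (intro conjI allI impI)
    fix W0 assume W0: "v \<in> W0 \<and> W0 \<subset> ?W"
    \<comment> \<open>\<open>B0\<close> is the part of \<open>A\<close> seen from \<open>W0\<close>.
      If it is all of \<open>A\<close>, any code vertex outside \<open>W0\<close> is already within
      distance \<open>2 + 3\<close> of \<open>W0\<close>.\<close>
    define B0 where "B0 = {x\<in>A. \<exists>w\<in>W0. reach 3 x w}"
    have v0: "v \<in> B0" using vA W0 reach_refl unfolding B0_def by blast
    show "\<exists>x\<in>W0. \<exists>y\<in>?W - W0. near x y"
    proof (cases "B0 = A")
      case True
      obtain w where w: "w \<in> ?W" "w \<notin> W0" using W0 by blast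
      obtain a where a: "a \<in> A" "reach 2 w a" using near_W[OF w(1)] by blast
      then obtain w0 where w0: "w0 \<in> W0" "reach 3 a w0" using True unfolding B0_def by blast
      have "near w w0" by (rule reach_add[OF a(2) w0(2)]) simp
      then show ?thesis using w w0 reach_sym by blast
    next
      case False
      have "B0 \<subseteq> A" unfolding B0_def by blast
      then obtain x x' where x: "x \<in> B0" "x' \<in> A" "x' \<notin> B0" "N x \<inter> N x' \<noteq> {}"
        using conn_fromD[OF conn v0 _ False] by metis
      then obtain w0 where w0: "w0 \<in> W0" "reach 3 x w0" unfolding B0_def by blast
      obtain w where w: "w \<in> ?W" "reach 3 x' w" using near_A x(2) by blast
      have "w \<notin> W0" using w x unfolding B0_def by blast
      have "x \<in> X" "x' \<in> X" using x(1,2) A_sub unfolding B0_def by blast+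
      then have "reach 2 x x'" using x(4) by (intro reach_2)
      then have "reach 5 w0 x'" by (rule reach_add[OF reach_sym[OF w0(2)]]) simp
      then have "near w0 w" by (rule reach_add[OF _ w(2)]) simp
      then show ?thesis using w0 w \<open>w \<notin> W0\<close> by blast
    qed
  qed simp
qed

lemma init_state:
  "\<exists>(F, S)\<in>states v t 0. good F S"
proof -
  obtain T where T: "T \<subseteq> G" "real (card T) \<le> 64 * real t * L / real D"
    "real (card (MS T - A)) \<le> 64 * real t * L / real D"
    "card (G - NS (MS T \<inter> A)) \<le> 3 * t" by (rule exists_cover)
  have "NS (MS T \<inter> A) \<subseteq> G" unfolding G_def by (rule NS_mono) auto
  then obtain X1 where X1: "X1 \<subseteq> A" "real (card X1) \<le> 6 * real t / real D"
    "\<And>x. x \<in> A \<Longrightarrow> 2 * card (N x - (NS (MS T \<inter> A) \<union> NS X1)) \<le> D"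
    using exists_half_cover T(4) by blast
  define Om where "Om = MS T - A"
  define W where "W = insert v (T \<union> Om \<union> X1)"
  define F where "F = NS ((MS T - Om) \<union> X1)"
  define S where "S = {x\<in>X. 2 * card (N x - F) \<le> D}"
  have Om: "MS T - Om = MS T \<inter> A" by (auto simp: Om_def)
  have F: "F = NS (MS T \<inter> A) \<union> NS X1" by (simp add: F_def Om NS_Un)
  have FG: "F \<subseteq> G" using X1 by (auto simp: F G_def NS_def)
  have "conn_from near v W"
    unfolding W_def Om_def
  proof (rule conn_code[OF T(1) X1(1)])
    fix x assume x: "x \<in> A"
    have "2 * card (N x - F) \<le> D" using X1(3)[OF x] by (simp add: F)
    then have "N x - F \<noteq> N x" using card_N[of x] x A_sub D_ge by auto
    then show "N x \<inter> NS ((MS T \<inter> A) \<union> X1) \<noteq> {}" unfolding F NS_Un by blast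
  qed
  have finW: "finite W"
    using T X1 finG finA finX finite_subset M_sub unfolding W_def Om_def MS_def
    by (metis (no_types, lifting) UN_subset_iff finite.insertI finite_Diff finite_Un)
  have "card W \<le> Suc (card T + card Om + card X1)"
  proof -
    have "card W \<le> Suc (card (T \<union> Om \<union> X1))" unfolding W_def by (rule card_insert_le_m1) auto
    also have "card (T \<union> Om \<union> X1) \<le> card (T \<union> Om) + card X1" by (rule card_Un_le)
    also have "card (T \<union> Om) \<le> card T + card Om" by (rule card_Un_le)
    finally show ?thesis by simp
  qed
  then have "real (card W) \<le> 1 + real (card T) + real (card Om) + real (card X1)" by simp
  \<comment> \<open>The leading 1 stands for \<open>v\<close> and is absorbed by means of
    \<open>D_le_t\<close>.\<close>
  also have "\<dots> \<le> 5 * real t * L / real D + 64 * real t * L / real D + 64 * real t * L / real D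
      + 6 * real t * L / real D"
  proof (intro add_mono T)
    show "real (card Om) \<le> 64 * real t * L / real D" using T by (simp add: Om_def)
    have "real D * 1 \<le> 5 * real t * L" using D_le_t L_ge by (intro mult_mono) auto
    then show "1 \<le> 5 * real t * L / real D" using D_ge by (simp add: field_simps)
    have "6 * real t / real D * 1 \<le> 6 * real t / real D * L" using L_ge by (intro mult_left_mono) auto
    then show "real (card X1) \<le> 6 * real t * L / real D" using X1(2) by simp
  qed
  also have "\<dots> = 139 * real t * L / real D" by (simp add: field_simps)
  finally have "card W \<le> nat \<lfloor>139 * real t * L / real D\<rfloor>" by (simp add: le_nat_floor)
  then have "(F, S) \<in> states v t 0"
    unfolding states.simps init_states_def
    using finW \<open>conn_from near v W\<close>
    by (intro image_eqI[of _ _ "(W, T, Om, X1)"]) (auto simp: F_def S_def W_def Let_def)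
  moreover have "good F S"
    unfolding good_def
  proof (intro conjI FG)
    show AS: "A \<subseteq> S" using X1(3) A_sub by (auto simp: S_def F)
    show "S \<subseteq> X" by (auto simp: S_def)
    have "card (G - F) \<le> card (G - NS (MS T \<inter> A))" using finG by (intro card_mono) (auto simp: F)
    then show "card (G - F) \<le> 3 * t" using T(4) by simp
    \<comment> \<open>Each vertex of \<open>S - A\<close> sends at least \<open>D / 2\<close> edges
      into \<open>G\<close>, all of them ending outside \<open>A\<close> on the upper side, so
      \<open>out_sum\<close> limits their number to \<open>t * D\<close>.\<close>
    have "real (card (S - A)) * (real D / 2) = (\<Sum>x\<in>S - A. real D / 2)" by simp
    also have "\<dots> \<le> (\<Sum>x\<in>S - A. real (card (N x \<inter> G)))"
    proof (intro sum_mono)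
      fix x assume x: "x \<in> S - A"
      then have xX: "x \<in> X" by (auto simp: S_def)
      have "D = card (N x \<inter> F) + card (N x - F)"
        using card_Int_Diff[OF finN[OF xX], of F] card_N[OF xX] by simp
      moreover have "2 * card (N x - F) \<le> D" using x by (simp add: S_def)
      moreover have "card (N x \<inter> F) \<le> card (N x \<inter> G)" using FG finG by (intro card_mono) auto
      ultimately show "real D / 2 \<le> real (card (N x \<inter> G))" by linarith
    qed
    also have "\<dots> = (\<Sum>y\<in>G. real (card (M y \<inter> (S - A))))"
    proof -
      have "(\<Sum>x\<in>S - A. card (N x \<inter> G)) = (\<Sum>y\<in>G. card (M y \<inter> (S - A)))"
        by (rule count_edges) (use finG in \<open>auto simp: S_def\<close>)
      then show ?thesis by (metis of_nat_sum)
    qed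
    also have "\<dots> \<le> (\<Sum>y\<in>G. real (card (M y - A)))"
      by (intro sum_mono of_nat_mono card_mono) auto
    also have "\<dots> \<le> real t * real D" by (rule out_sum)
    finally have "real (card (S - A)) \<le> 2 * real t" using D_ge by (simp add: field_simps)
    then show "card (S - A) \<le> 2 * t" by linarith
  qed
  ultimately show ?thesis by blast
qed

end

section \<open>One refinement round and its iteration\<close>

context c4_free_closed
begin

text \<open>Truncating the potential at \<open>0\<close> bounds the number of chosen vertices by \<open>\<mu> / \<psi>\<close>; without it
  the difference \<open>|S| - |F|\<close> could drop by as much as \<open>t\<close>.\<close>

lemma step_state:
  assumes good: "good F S" and \<mu>: "real (card S) - real (card F) \<le> \<mu>" "0 < \<mu>"
    and \<psi>: "\<psi> = \<mu> * real D / (10 * real t)"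
  shows "\<exists>(F', S')\<in>step_states \<psi> (10 * real t / real D) (F, S).
    good F' S' \<and> real (card S') - real (card F') \<le> \<mu> / 2"
proof -
  have FG: "F \<subseteq> G" and AS: "A \<subseteq> S" and SX: "S \<subseteq> X" and f: "card (G - F) \<le> 3 * t"
    and h: "card (S - A) \<le> 2 * t"
    using good by (auto simp: good_def)
  have finS: "finite S" using SX finX finite_subset by blast
  have finNS: "finite (NS S)" using NS_sub[OF SX] finY finite_subset by blast
  have finF: "finite F" using FG finG finite_subset by blast
  have \<psi>0: "0 < \<psi>" using \<mu> t_pos D_ge by (simp add: \<psi>)
  \<comment> \<open>\<open>P\<close> enlarges \<open>F\<close> from within \<open>A\<close>, while
    \<open>Q\<close> removes from \<open>S\<close> vertices with a neighbour outside
    \<open>G\<close>. At the price \<open>\<psi>\<close>, a vertex of either kind is worth choosing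
    only if it lowers the difference by at least \<open>\<psi>\<close>.\<close>
  define \<Phi> where "\<Phi> = (\<lambda>P Q. real (card (S - MS Q)) - real (card (F \<union> NS P)))"
  define obj where "obj = (\<lambda>(P, Q). max (\<Phi> P Q) 0 + \<psi> * (real (card P) + real (card Q)))"
  let ?D = "Pow A \<times> Pow (NS S - G)"
  have "finite ?D" "?D \<noteq> {}" using finA finNS by auto
  then obtain z where z: "z \<in> ?D" and minz: "\<And>z'. z' \<in> ?D \<Longrightarrow> obj z \<le> obj z'"
    using finite_minimizer[of ?D obj] by blast
  obtain P Q where zPQ: "z = (P, Q)" by force
  have P: "P \<subseteq> A" and Q: "Q \<subseteq> NS S - G" using z by (auto simp: zPQ)
  have min: "obj (P, Q) \<le> obj (P', Q')" if "P' \<subseteq> A" "Q' \<subseteq> NS S - G" for P' Q'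
    using minz[of "(P', Q')"] that by (simp add: zPQ)
  have finP: "finite P" using P finA finite_subset by blast
  have finQ: "finite Q" using Q finNS finite_subset by blast
  define F1 where "F1 = F \<union> NS P"
  define S1 where "S1 = S - MS Q"
  have F1: "F1 \<subseteq> G" "F \<subseteq> F1" using FG P by (auto simp: F1_def G_def NS_def)
  have finF1: "finite F1" using F1 finG finite_subset by blast
  have "MS Q \<inter> A = {}" using Q M_outside by (auto simp: MS_def)
  then have S1: "A \<subseteq> S1" "S1 \<subseteq> S" using AS by (auto simp: S1_def)
  have finS1: "finite S1" using S1 finS finite_subset by blast
  have "obj ({}, {}) \<le> \<mu>" using \<mu> by (simp add: obj_def \<Phi>_def NS_def MS_def)
  moreover have "obj (P, Q) \<le> obj ({}, {})" by (rule min) auto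
  ultimately have objle: "obj (P, Q) \<le> \<mu>" by linarith
  have "\<psi> * (real (card P) + real (card Q)) \<le> obj (P, Q)" by (simp add: obj_def)
  then have "\<psi> * (real (card P) + real (card Q)) \<le> \<mu>" using objle by linarith
  then have PQ: "real (card P) + real (card Q) \<le> 10 * real t / real D"
  proof -
    define c where "c = real (card P) + real (card Q)"
    have "\<mu> * (real D * c) \<le> \<mu> * (10 * real t)"
      using \<open>\<psi> * (real (card P) + real (card Q)) \<le> \<mu>\<close> t_pos
      unfolding c_def[symmetric] by (simp add: \<psi> field_simps)
    then have "real D * c \<le> 10 * real t" using \<mu>(2) by (subst (asm) mult_le_cancel_left_pos) auto
    then show ?thesis using D_ge by (simp add: c_def[symmetric] field_simps)
  qed
  have Pm: "P \<in> small_subsets (10 * real t / real D) S"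
    using P AS PQ by (auto simp: small_subsets_def)
  have Qm: "Q \<in> small_subsets (10 * real t / real D) (NS S)"
    using Q PQ by (auto simp: small_subsets_def)
  have \<psi>\<mu>: "\<psi> \<le> \<mu> / 2"
  proof -
    have "\<mu> * real D \<le> \<mu> * (5 * real t)" using D_le_t \<mu> by (intro mult_left_mono) auto
    then show ?thesis using t_pos by (simp add: \<psi> field_simps)
  qed
  have good_sub: "good F' S'" if "F \<subseteq> F'" "F' \<subseteq> G" "A \<subseteq> S'" "S' \<subseteq> S" for F' S'
  proof -
    have "card (G - F') \<le> card (G - F)" using that finG by (intro card_mono) auto
    moreover have "card (S' - A) \<le> card (S - A)" using that finS by (intro card_mono) auto
    ultimately show ?thesis using that f h SX by (auto simp: good_def)
  qed
  show ?thesis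
  proof (cases "\<Phi> P Q \<le> \<psi>")
    \<comment> \<open>Truncation may be active here, but the difference is already at most
      \<open>\<psi> <= \<mu> / 2\<close>, so refinement without trimming suffices.\<close>
    case True
    have "(F1, S1) = refine (F, S) (P, Q)" by (simp add: F1_def S1_def)
    then have "(F1, S1) \<in> step_states \<psi> (10 * real t / real D) (F, S)"
      unfolding step_states_def using Pm Qm by (intro UnI1 image_eqI) auto
    moreover have "good F1 S1" by (rule good_sub) (use F1 S1 in auto)
    moreover have "real (card S1) - real (card F1) \<le> \<mu> / 2"
      using True \<psi>\<mu> by (simp add: \<Phi>_def F1_def S1_def)
    ultimately show ?thesis by blast
  next
    case False
    \<comment> \<open>Above the threshold truncation cannot hide a gain: if one more vertex brought
      the difference down to 0 or below, its price \<open>\<psi>\<close> would be less than the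
      value saved. So minimality bounds its true gain by \<open>\<psi>\<close>.\<close>
    have x_small: "real (card (N x - F1)) \<le> \<psi>" if x: "x \<in> A" for x
    proof (cases "x \<in> P")
      case True
      then have "N x - F1 = {}" by (auto simp: F1_def NS_def)
      then have "card (N x - F1) = 0" by (simp only: card.empty)
      then show ?thesis using \<psi>0 by linarith
    next
      case xP: False
      have fN: "finite (N x)" using finN x A_sub by blast
      have "F \<union> NS (insert x P) = F1 \<union> (N x - F1)" by (auto simp: F1_def NS_def)
      then have "card (F \<union> NS (insert x P)) = card F1 + card (N x - F1)"
        using finF1 fN by (simp add: card_Un_disjoint del: Un_Diff_cancel)
      then have "\<Phi> (insert x P) Q = \<Phi> P Q - real (card (N x - F1))"
        by (simp add: \<Phi>_def F1_def)
      moreover have "obj (P, Q) \<le> obj (insert x P, Q)" by (rule min) (use x P Q in auto)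
      then have "max (\<Phi> P Q) 0 \<le> max (\<Phi> (insert x P) Q) 0 + \<psi>"
        using xP finP by (simp add: obj_def algebra_simps)
      ultimately show ?thesis using False \<psi>0 by linarith
    qed
    have y_small: "real (card (M y \<inter> S1)) \<le> \<psi>" if y: "y \<in> NS S - G" for y
    proof (cases "y \<in> Q")
      case True
      then have "M y \<inter> S1 = {}" by (auto simp: S1_def MS_def)
      then have "card (M y \<inter> S1) = 0" by (simp only: card.empty)
      then show ?thesis using \<psi>0 by linarith
    next
      case yQ: False
      have "S - MS (insert y Q) = S1 - M y" by (auto simp: S1_def MS_def)
      moreover have "card S1 = card (S1 \<inter> M y) + card (S1 - M y)" by (rule card_Int_Diff[OF finS1])
      ultimately have "\<Phi> P (insert y Q) = \<Phi> P Q - real (card (M y \<inter> S1))"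
        by (simp add: \<Phi>_def S1_def Int_commute)
      moreover have "obj (P, Q) \<le> obj (P, insert y Q)" by (rule min) (use y P Q in auto)
      then have "max (\<Phi> P Q) 0 \<le> max (\<Phi> P (insert y Q)) 0 + \<psi>"
        using yQ finQ by (simp add: obj_def algebra_simps)
      ultimately show ?thesis using False \<psi>0 by linarith
    qed
    define S2 where "S2 = {x\<in>S1. real (card (N x - F1)) \<le> \<psi>}"
    define F2 where "F2 = F1 \<union> {y\<in>NS S. \<psi> < real (card (M y \<inter> S2))}"
    have S2: "A \<subseteq> S2" "S2 \<subseteq> S1" using S1 x_small by (auto simp: S2_def)
    have S2X: "S2 \<subseteq> X" using S2 S1 SX by blast
    have finS2: "finite S2" using S2X finX finite_subset by blast
    have F2G: "F2 \<subseteq> G"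
    proof
      fix y assume "y \<in> F2"
      then consider "y \<in> F1" | "y \<in> NS S" "\<psi> < real (card (M y \<inter> S2))" by (auto simp: F2_def)
      then show "y \<in> G"
      proof cases
        case 1 then show ?thesis using F1 by blast
      next
        case 2
        have "card (M y \<inter> S2) \<le> card (M y \<inter> S1)" using S2 by (intro card_mono) auto
        then show ?thesis using 2 y_small[of y] by fastforce
      qed
    qed
    have finF2: "finite F2" using F2G finG finite_subset by blast
    have "(F2, S2) = (trim \<psi> (snd (F, S)) \<circ> refine (F, S)) (P, Q)"
      by (simp add: F2_def S2_def F1_def S1_def)
    then have mem: "(F2, S2) \<in> step_states \<psi> (10 * real t / real D) (F, S)"
      unfolding step_states_def using Pm Qm by (intro UnI2 image_eqI) auto
    have good2: "good F2 S2" by (rule good_sub) (use F1 F2G S2 S1 in \<open>auto simp: F2_def\<close>)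
    define Z where "Z = NS S2 - G"
    have finZ: "finite Z" using NS_sub[OF S2X] finY finite_subset unfolding Z_def by blast
    \<comment> \<open>The edges at \<open>S2\<close> are split by their lower end: in
      \<open>F2\<close> degrees are below \<open>D\<close>; in \<open>G - F2\<close> they are at
      most \<open>\<psi>\<close>; outside \<open>G\<close> only vertices of \<open>S2 - A\<close>
      contribute, at most \<open>\<psi>\<close> each. The sizes \<open>3 * t\<close> and
      \<open>2 * t\<close> make the error \<open>5 * t * \<psi> = D * \<mu> / 2\<close>.\<close>
    have "(\<Sum>x\<in>S2. card (N x)) = (\<Sum>x\<in>S2. card (N x \<inter> F2) + card (N x \<inter> (G - F2)) + card (N x \<inter> Z))"
    proof (intro sum.cong refl)
      fix x assume x: "x \<in> S2"
      have fN: "finite (N x)" using finN x S2X by blast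
      have eq: "N x = (N x \<inter> F2) \<union> (N x \<inter> (G - F2)) \<union> (N x \<inter> Z)"
        using x by (auto simp: Z_def NS_def)
      have "card (N x) = card ((N x \<inter> F2) \<union> (N x \<inter> (G - F2)) \<union> (N x \<inter> Z))"
        using eq by simp
      also have "\<dots> = card ((N x \<inter> F2) \<union> (N x \<inter> (G - F2))) + card (N x \<inter> Z)"
        by (rule card_Un_disjoint) (use fN F2G in \<open>auto simp: Z_def\<close>)
      also have "card ((N x \<inter> F2) \<union> (N x \<inter> (G - F2))) = card (N x \<inter> F2) + card (N x \<inter> (G - F2))"
        by (rule card_Un_disjoint) (use fN in auto)
      finally show "card (N x) = card (N x \<inter> F2) + card (N x \<inter> (G - F2)) + card (N x \<inter> Z)" .
    qed
    moreover have "(\<Sum>x\<in>S2. card (N x)) = D * card S2"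
    proof -
      have "(\<Sum>x\<in>S2. card (N x)) = (\<Sum>x\<in>S2. D)"
        using S2X card_N by (intro sum.cong) auto
      then show ?thesis by simp
    qed
    ultimately have tot: "real D * real (card S2) = real (\<Sum>x\<in>S2. card (N x \<inter> F2)) +
        real (\<Sum>x\<in>S2. card (N x \<inter> (G - F2))) + real (\<Sum>x\<in>S2. card (N x \<inter> Z))"
      by (simp only: sum.distrib of_nat_add[symmetric] of_nat_mult[symmetric])
    have e1: "real (\<Sum>x\<in>S2. card (N x \<inter> F2)) \<le> real D * real (card F2)"
    proof -
      have "(\<Sum>x\<in>S2. card (N x \<inter> F2)) = (\<Sum>y\<in>F2. card (M y \<inter> S2))"
        by (rule count_edges[OF S2X finF2])
      also have "\<dots> \<le> (\<Sum>y\<in>F2. D)"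
      proof (intro sum_mono)
        fix y assume y: "y \<in> F2"
        have "card (M y \<inter> S2) \<le> card (M y)" by (intro card_mono) auto
        also have "\<dots> \<le> D" using card_M_less[of y] y F2G G_sub by force
        finally show "card (M y \<inter> S2) \<le> D" .
      qed
      also have "\<dots> = D * card F2" by simp
      finally show ?thesis by (metis of_nat_le_iff of_nat_mult)
    qed
    have e2: "real (\<Sum>x\<in>S2. card (N x \<inter> (G - F2))) \<le> \<psi> * (3 * real t)"
    proof -
      have "(\<Sum>x\<in>S2. card (N x \<inter> (G - F2))) = (\<Sum>y\<in>G - F2. card (M y \<inter> S2))"
        by (rule count_edges[OF S2X]) (use finG in auto)
      then have "real (\<Sum>x\<in>S2. card (N x \<inter> (G - F2))) = (\<Sum>y\<in>G - F2. real (card (M y \<inter> S2)))"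
        by (simp only: of_nat_sum)
      also have "\<dots> \<le> (\<Sum>y\<in>G - F2. \<psi>)"
      proof (intro sum_mono)
        fix y assume y: "y \<in> G - F2"
        have "G \<subseteq> NS S" unfolding G_def by (rule NS_mono[OF AS])
        then show "real (card (M y \<inter> S2)) \<le> \<psi>" using y by (auto simp: F2_def not_less)
      qed
      also have "\<dots> = \<psi> * real (card (G - F2))" by simp
      also have "\<dots> \<le> \<psi> * (3 * real t)"
      proof (rule mult_left_mono)
        have "card (G - F2) \<le> 3 * t" using good2 by (simp add: good_def)
        then show "real (card (G - F2)) \<le> 3 * real t" by linarith
      qed (use \<psi>0 in simp)
      finally show ?thesis .
    qed
    have e3: "real (\<Sum>x\<in>S2. card (N x \<inter> Z)) \<le> \<psi> * (2 * real t)"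
    proof -
      have "real (\<Sum>x\<in>S2. card (N x \<inter> Z)) = (\<Sum>x\<in>S2. real (card (N x \<inter> Z)))" by (rule of_nat_sum)
      also have "\<dots> = (\<Sum>x\<in>S2 - A. real (card (N x \<inter> Z)))"
      proof (rule sum.mono_neutral_right[OF finS2])
        show "\<forall>x\<in>S2 - (S2 - A). real (card (N x \<inter> Z)) = 0"
        proof
          fix x assume "x \<in> S2 - (S2 - A)"
          then have "N x \<inter> Z = {}" using N_G[of x] by (auto simp: Z_def)
          then show "real (card (N x \<inter> Z)) = 0" by simp
        qed
      qed auto
      also have "\<dots> \<le> (\<Sum>x\<in>S2 - A. \<psi>)"
      proof (intro sum_mono)
        fix x assume x: "x \<in> S2 - A"
        have "finite (N x - F1)" using finN x S2X by blast
        then have "card (N x \<inter> Z) \<le> card (N x - F1)"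
          using F1 by (intro card_mono) (auto simp: Z_def)
        then show "real (card (N x \<inter> Z)) \<le> \<psi>" using x by (simp add: S2_def)
      qed
      also have "\<dots> = \<psi> * real (card (S2 - A))" by simp
      also have "\<dots> \<le> \<psi> * (2 * real t)"
      proof (rule mult_left_mono)
        have "card (S2 - A) \<le> 2 * t" using good2 by (simp add: good_def)
        then show "real (card (S2 - A)) \<le> 2 * real t" by linarith
      qed (use \<psi>0 in simp)
      finally show ?thesis .
    qed
    have "real D * (real (card S2) - real (card F2)) \<le> \<psi> * (5 * real t)"
      using tot e1 e2 e3 by (simp add: algebra_simps)
    also have "\<dots> = real D * (\<mu> / 2)" using t_pos by (simp add: \<psi>)
    finally have "real (card S2) - real (card F2) \<le> \<mu> / 2"
      using D_ge by (subst (asm) mult_le_cancel_left_pos) auto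
    then show ?thesis using mem good2 by blast
  qed
qed

text \<open>The errors \<open>2 * t\<close> and \<open>3 * t\<close> of a good state, less
  \<open>t = card G - card A\<close>, give the initial value \<open>4 * t\<close>; each round halves
  the bound.\<close>

lemma states_exist:
  "\<exists>(F, S)\<in>states v t i. good F S \<and> real (card S) - real (card F) \<le> 4 * real t / 2 ^ i"
proof (induction i)
  case 0
  obtain F S where FS: "(F, S) \<in> states v t 0" "good F S" using init_state by auto
  have "real (card S) - real (card F) = real (card (S - A)) + real (card (G - F)) - real t"
    using good_card[OF FS(2)] card_G by simp
  then have "real (card S) - real (card F) \<le> 4 * real t"
    using FS(2) by (simp add: good_def)
  then show ?case using FS by auto
next
  case (Suc i)
  then obtain F S where FS: "(F, S) \<in> states v t i" "good F S"
    "real (card S) - real (card F) \<le> 4 * real t / 2 ^ i" by auto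
  have "\<exists>(F', S')\<in>step_states (2 / 5 * real D / 2 ^ i) (10 * real t / real D) (F, S).
      good F' S' \<and> real (card S') - real (card F') \<le> 4 * real t / 2 ^ i / 2"
    by (rule step_state[OF FS(2,3)]) (use t_pos in \<open>auto simp: field_simps\<close>)
  then obtain F' S' where F': "(F', S') \<in> step_states (2 / 5 * real D / 2 ^ i) (10 * real t / real D) (F, S)"
    "good F' S'" "real (card S') - real (card F') \<le> 4 * real t / 2 ^ i / 2" by blast
  have "(F', S') \<in> states v t (Suc i)"
    unfolding states.simps using FS F'(1) good_admissible[OF FS(2)] by blast
  then show ?case using F' by (auto simp: field_simps)
qed

end

section \<open>Containers, their total weight, and the closure of a linked set\<close>

context c4_free
begin

text \<open>With the lower bound \<open>l = 1000 L\<^sup>2 / sqrt D\<close> for \<open>ln (1 + lam)\<close>, this is \<open>\<Gamma> = l / (32 L)\<close>: listing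
  \<open>2 \<Gamma> t\<close> vertices costs at most \<open>l t / 4\<close>.\<close>

definition \<Gamma> :: real where "\<Gamma> = 125 / 4 * L / sqrt (real D)"
text \<open>Enough rounds to bring \<open>4 / 2 ^ J\<close> below \<open>1 / D\<close> and hence
  below \<open>\<Gamma>\<close>. As \<open>J\<close> is of order \<open>L\<close>, all rounds
  together cost only a multiple of \<open>\<tau> * L ^ 2 / D\<close> in the exponent.\<close>

definition J :: nat where "J = nat \<lceil>log 2 (4 * real D)\<rceil>"

definition trimmed_containers :: "'a \<Rightarrow> nat \<Rightarrow> nat \<Rightarrow> 'a set set" where
  "trimmed_containers v \<tau> g =
     snd ` {p\<in>states v \<tau> J. admissible \<tau> p \<and> real (card (snd p)) \<le> real g - \<Gamma> * real \<tau>}"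

text \<open>\<open>H\<close> is a guess for the part of \<open>G\<close> that \<open>F\<close>
  misses. A closed set consists of the vertices whose neighbourhoods lie in \<open>G\<close>, so the
  right guess returns exactly this set.\<close>

definition completions :: "nat \<Rightarrow> 'a set \<times> 'a set \<Rightarrow> 'a set set" where
  "completions \<tau> p = (\<lambda>H. {x\<in>X. N x \<subseteq> fst p \<union> H}) ` small_subsets (2 * \<Gamma> * real \<tau>) (NS (snd p))"

text \<open>The closed set itself satisfies \<open>card C + \<tau> <= g\<close> with equality; the
  condition discards wrong guesses that would weigh too much.\<close>

definition listed_containers :: "'a \<Rightarrow> nat \<Rightarrow> nat \<Rightarrow> 'a set set" where
  "listed_containers v \<tau> g =
     {C\<in>(\<Union>p\<in>{p\<in>states v \<tau> J. admissible \<tau> p}. completions \<tau> p). card C + \<tau> \<le> g}"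

definition containers :: "'a \<Rightarrow> nat \<Rightarrow> nat \<Rightarrow> 'a set set" where
  "containers v \<tau> g = trimmed_containers v \<tau> g \<union> listed_containers v \<tau> g"

lemmas containers_defs = containers_def trimmed_containers_def listed_containers_def

lemma sqrt_D: "1 \<le> sqrt (real D)" "sqrt (real D) \<le> real D" "sqrt (real D) * sqrt (real D) = real D"
proof -
  show 1: "1 \<le> sqrt (real D)" using D_ge by simp
  show eq: "sqrt (real D) * sqrt (real D) = real D" by simp
  have "sqrt (real D) * 1 \<le> sqrt (real D) * sqrt (real D)" using 1 by (intro mult_left_mono) auto
  then show "sqrt (real D) \<le> real D" using eq by simp
qed

lemma \<Gamma>_pos: "0 < \<Gamma>" using L_ge sqrt_D(1) by (auto simp: \<Gamma>_def)

lemma \<Gamma>_ge: "1 / real D \<le> \<Gamma>"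
proof -
  have "1 / real D \<le> 1 / sqrt (real D)"
    using sqrt_D by (intro divide_left_mono) auto
  also have "\<dots> \<le> \<Gamma>" unfolding \<Gamma>_def using L_ge sqrt_D(1) by (intro divide_right_mono) auto
  finally show ?thesis .
qed

lemma J_bounds: "4 / 2 ^ J \<le> \<Gamma>" "real J \<le> 5 * L"
proof -
  have log0: "0 \<le> log 2 (4 * real D)" using D_ge by simp
  have "4 * real D = 2 powr (log 2 (4 * real D))" using D_ge by simp
  also have "\<dots> \<le> 2 powr real J" unfolding J_def using log0 by (intro powr_mono) auto
  also have "\<dots> = 2 ^ J" by (simp add: powr_realpow)
  finally have "4 / 2 ^ J \<le> 1 / real D" using D_ge by (simp add: field_simps)
  then show "4 / 2 ^ J \<le> \<Gamma>" using \<Gamma>_ge by linarith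
  have ln2: "2 / 3 \<le> ln (2::real)" using ln2_ge_two_thirds .
  have "real J \<le> log 2 (4 * real D) + 1" unfolding J_def using log0 by linarith
  also have "log 2 (4 * real D) = 2 + L / ln 2"
  proof -
    have "log 2 (4 * real D) = log 2 4 + log 2 (real D)" using D_ge by (simp add: log_mult)
    also have "log 2 4 = log 2 (2 powr 2)" by simp
    also have "\<dots> = (2::real)" by (subst log_powr_cancel) auto
    finally show ?thesis by (simp add: log_def L_def)
  qed
  also have "L / ln 2 \<le> L / (2 / 3)" using ln2 L_ge by (intro divide_left_mono) auto
  finally have "real J \<le> 3 + 3 / 2 * L" by simp
  then show "real J \<le> 5 * L" using L_ge by linarith
qed

lemma card_states_J:
  assumes "D \<le> 5 * \<tau>"
  shows "finite (states v \<tau> J)" "real (card (states v \<tau> J)) \<le> exp (4900 * real \<tau> * L ^ 2 / real D)"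
proof -
  show "finite (states v \<tau> J)" using card_states[OF assms] by blast
  have "real (card (states v \<tau> J)) \<le> exp (4600 * real \<tau> * L ^ 2 / real D + real J * (60 * real \<tau> * L / real D))"
    using card_states[OF assms] by blast
  also have "\<dots> \<le> exp (4900 * real \<tau> * L ^ 2 / real D)"
  proof -
    have "real J * (60 * real \<tau> * L / real D) \<le> 5 * L * (60 * real \<tau> * L / real D)"
      using J_bounds(2) L_ge by (intro mult_right_mono) auto
    also have "\<dots> = 300 * real \<tau> * L ^ 2 / real D" by (simp add: power2_eq_square)
    also have "4600 * real \<tau> * L ^ 2 / real D + 300 * real \<tau> * L ^ 2 / real D = 4900 * real \<tau> * L ^ 2 / real D"
      by (simp add: add_divide_distrib[symmetric])
    finally show ?thesis by simp
  qed
  finally show "real (card (states v \<tau> J)) \<le> exp (4900 * real \<tau> * L ^ 2 / real D)" .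
qed

lemma finite_completions:
  assumes "admissible \<tau> p" shows "finite (small_subsets q (NS (snd p)))" "finite (completions \<tau> p)"
proof -
  have "finite (NS (snd p))"
    using assms NS_sub finY finite_subset unfolding admissible_def by blast
  then show "finite (small_subsets q (NS (snd p)))" for q
    unfolding small_subsets_def by (intro finite_subset[OF _ finite_Pow_iff[THEN iffD2]]) auto
  then show "finite (completions \<tau> p)" unfolding completions_def by blast
qed

lemma finite_containers:
  assumes "D \<le> 5 * \<tau>"
  shows "finite (trimmed_containers v \<tau> g)" "finite (listed_containers v \<tau> g)" "finite (containers v \<tau> g)"
proof -
  show 1: "finite (trimmed_containers v \<tau> g)"
    unfolding trimmed_containers_def using card_states_J(1)[OF assms, of v] by simp
  have "finite (\<Union>p\<in>{p\<in>states v \<tau> J. admissible \<tau> p}. completions \<tau> p)"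
    using card_states_J(1)[OF assms, of v] finite_completions(2) by (intro finite_UN_I) auto
  then show 2: "finite (listed_containers v \<tau> g)"
    unfolding listed_containers_def by (rule rev_finite_subset) blast
  show "finite (containers v \<tau> g)" unfolding containers_def using 1 2 by blast
qed

lemma containers_sub: "C \<in> containers v \<tau> g \<Longrightarrow> C \<subseteq> X" "C \<in> containers v \<tau> g \<Longrightarrow> card C \<le> g"
proof -
  assume C: "C \<in> containers v \<tau> g"
  have "C \<subseteq> X \<and> card C \<le> g"
    using C unfolding containers_def
  proof
    assume "C \<in> trimmed_containers v \<tau> g"
    then have "C \<subseteq> X" "real (card C) \<le> real g - \<Gamma> * real \<tau>"
      by (auto simp: trimmed_containers_def admissible_def)
    moreover have "0 \<le> \<Gamma> * real \<tau>" using \<Gamma>_pos by simp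
    ultimately show ?thesis by linarith
  qed (auto simp: listed_containers_def completions_def)
  then show "C \<subseteq> X" "card C \<le> g" by auto
qed

text \<open>Let \<open>l = 1000 * L ^ 2 / sqrt D\<close>. In the exponent, trimmed containers save
  \<open>l * \<Gamma> * \<tau> = 31250 * \<tau> * L ^ 3 / D\<close> against an enumeration cost of
  \<open>4900 * \<tau> * L ^ 2 / D\<close>. Listed ones save \<open>l * \<tau>\<close> and spend a
  quarter of it on the list; by \<open>large\<close>, the other three quarters cover the
  rest.\<close>

lemma container_weight:
  assumes \<tau>: "D \<le> 5 * \<tau>" and q: "exp (1000 * L ^ 2 / sqrt (real D)) \<le> q"
    and large: "4900 + 10000 * L \<le> 750 * sqrt (real D)"
  shows "(\<Sum>C\<in>containers v \<tau> g. q ^ card C) \<le> 2 * q ^ g * exp (- (10000 * real \<tau> * L ^ 3 / real D))"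
proof -
  define s where "s = sqrt (real D)"
  define l where "l = 1000 * L ^ 2 / s"
  have s: "1 \<le> s" "s * s = real D" using sqrt_D by (auto simp: s_def)
  have \<Gamma>s: "\<Gamma> = 125 / 4 * L / s" by (simp add: \<Gamma>_def s_def)
  have l: "0 < l" using L_ge s by (simp add: l_def)
  have q1: "1 \<le> q" using q l unfolding s_def[symmetric] l_def[symmetric] by (meson one_le_exp_iff less_imp_le order_trans)
  have lnq: "l \<le> ln q"
    using q q1 unfolding s_def[symmetric] l_def[symmetric] by (simp add: ln_ge_iff)
  have pw: "q ^ c \<le> q ^ g * exp (- l * d)" if "real c \<le> real g - d" "0 \<le> d" for c d
  proof -
    have "q ^ c = q powr real c" using q1 by (simp add: powr_realpow)
    also have "\<dots> \<le> q powr (real g - d)" using that q1 by (intro powr_mono) auto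
    also have "\<dots> = q ^ g * exp (- ln q * d)"
    proof -
      have "q powr (real g - d) = q powr real g * q powr (- d)" by (simp add: powr_add[symmetric])
      also have "q powr real g = q ^ g" using q1 by (simp add: powr_realpow)
      also have "q powr (- d) = exp (- ln q * d)" using q1 by (simp add: powr_def mult.commute)
      finally show ?thesis .
    qed
    also have "\<dots> \<le> q ^ g * exp (- l * d)"
      using lnq that q1 by (intro mult_left_mono) (auto intro: mult_right_mono)
    finally show ?thesis .
  qed
  let ?K = "states v \<tau> J"
  let ?E = "exp (4900 * real \<tau> * L ^ 2 / real D)"
  let ?R = "exp (- (10000 * real \<tau> * L ^ 3 / real D))"
  note K = card_states_J[OF \<tau>, of v]
  have L3: "L ^ 2 \<le> L ^ 3" using L_ge by (intro power_increasing) auto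
  let ?P1 = "trimmed_containers v \<tau> g" and ?P2 = "listed_containers v \<tau> g"
  note fin = finite_containers(1,2)[OF \<tau>, of v g]
  have "(\<Sum>C\<in>?P1. q ^ card C) \<le> (\<Sum>C\<in>?P1. q ^ g * exp (- l * (\<Gamma> * real \<tau>)))"
    using \<Gamma>_pos by (intro sum_mono pw) (auto simp: trimmed_containers_def)
  also have "\<dots> = real (card ?P1) * (q ^ g * exp (- l * (\<Gamma> * real \<tau>)))" by simp
  also have "\<dots> \<le> ?E * (q ^ g * exp (- l * (\<Gamma> * real \<tau>)))"
  proof (rule mult_right_mono)
    have "card ?P1 \<le> card {p\<in>?K. admissible \<tau> p \<and> real (card (snd p)) \<le> real g - \<Gamma> * real \<tau>}"
      unfolding trimmed_containers_def using K(1) by (intro card_image_le) auto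
    also have "\<dots> \<le> card ?K" using K(1) by (intro card_mono) auto
    finally show "real (card ?P1) \<le> ?E" using K(2) by linarith
  qed (use q1 in auto)
  also have "\<dots> = q ^ g * exp (4900 * real \<tau> * L ^ 2 / real D - l * (\<Gamma> * real \<tau>))"
    by (simp add: exp_diff exp_minus field_simps)
  also have "\<dots> \<le> q ^ g * ?R"
  proof -
    have "l * (\<Gamma> * real \<tau>) = 31250 * (real \<tau> * L ^ 3 / real D)"
      unfolding l_def \<Gamma>s s(2)[symmetric]
      by (simp add: power2_eq_square power3_eq_cube)
    moreover have "4900 * real \<tau> * L ^ 2 / real D \<le> 4900 * (real \<tau> * L ^ 3 / real D)"
      using L3 by (simp add: divide_right_mono mult_left_mono)
    moreover have "0 \<le> real \<tau> * L ^ 3 / real D" using L_ge by simp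
    ultimately have "4900 * real \<tau> * L ^ 2 / real D - l * (\<Gamma> * real \<tau>) \<le> - (10000 * (real \<tau> * L ^ 3 / real D))"
      by linarith
    then show ?thesis using q1 by (intro mult_left_mono) (auto simp: mult.assoc)
  qed
  finally have S1: "(\<Sum>C\<in>?P1. q ^ card C) \<le> q ^ g * ?R" .
  define Q where "Q = exp (l * real \<tau> / 4)"
  have small: "real (card (completions \<tau> p)) \<le> Q" if p: "admissible \<tau> p" for p
  proof -
    have S: "snd p \<subseteq> X" "card (snd p) \<le> 2 * \<tau> * D" using p by (auto simp: admissible_def)
    have finNS: "finite (NS (snd p))" using NS_sub[OF S(1)] finY finite_subset by blast
    have \<tau>0: "0 < real \<tau>" using \<tau> D_ge by simp
    have r: "real D ^ 2 / \<Gamma> \<le> real D ^ 3"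
    proof -
      have "1 \<le> \<Gamma> * real D" using \<Gamma>_ge D_ge by (simp add: field_simps)
      then have "real D ^ 2 * 1 \<le> real D ^ 2 * (\<Gamma> * real D)" by (intro mult_left_mono) auto
      then show ?thesis using \<Gamma>_pos by (simp add: field_simps power2_eq_square power3_eq_cube)
    qed
    have "real (card (small_subsets (2 * \<Gamma> * real \<tau>) (NS (snd p)))) \<le> (exp 1 * real D ^ 3) powr (2 * \<Gamma> * real \<tau>)"
      unfolding small_subsets_def
    proof (rule card_small_subsets[OF finNS])
      have "card (NS (snd p)) \<le> D * (2 * \<tau> * D)"
        using card_NS_le[OF S(1)] S(2) by (meson le_trans mult_le_mono2)
      then have "real (card (NS (snd p))) \<le> real (D * (2 * \<tau> * D))" by (rule of_nat_mono)
      also have "\<dots> = real D ^ 2 / \<Gamma> * (2 * \<Gamma> * real \<tau>)"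
        using \<Gamma>_pos by (simp add: power2_eq_square)
      also have "\<dots> \<le> real D ^ 3 * (2 * \<Gamma> * real \<tau>)"
        using r \<Gamma>_pos \<tau>0 by (intro mult_right_mono) auto
      finally show "real (card (NS (snd p))) \<le> real D ^ 3 * (2 * \<Gamma> * real \<tau>)" .
    qed (use \<Gamma>_pos \<tau>0 D_ge in auto)
    also have "\<dots> = exp (2 * \<Gamma> * real \<tau> * (1 + 3 * L))"
    proof -
      have "ln (exp 1 * real D ^ 3) = 1 + 3 * L"
        using D_ge by (simp add: ln_mult ln_realpow L_def)
      moreover have "exp 1 * real D ^ 3 \<noteq> 0" using D_ge by simp
      ultimately show ?thesis unfolding powr_def by simp
    qed
    also have "\<dots> \<le> exp (2 * \<Gamma> * real \<tau> * (4 * L))"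
    proof -
      have "2 * \<Gamma> * real \<tau> * (1 + 3 * L) \<le> 2 * \<Gamma> * real \<tau> * (4 * L)"
        using L_ge \<Gamma>_pos by (intro mult_left_mono) auto
      then show ?thesis by simp
    qed
    also have "2 * \<Gamma> * real \<tau> * (4 * L) = l * real \<tau> / 4"
      unfolding l_def \<Gamma>s by (simp add: power2_eq_square)
    finally have "real (card (small_subsets (2 * \<Gamma> * real \<tau>) (NS (snd p)))) \<le> Q" unfolding Q_def .
    moreover have "card (completions \<tau> p) \<le> card (small_subsets (2 * \<Gamma> * real \<tau>) (NS (snd p)))"
      unfolding completions_def by (rule card_image_le[OF finite_completions(1)[OF p]])
    ultimately show ?thesis by linarith
  qed
  have "(\<Sum>C\<in>?P2. q ^ card C) \<le> (\<Sum>C\<in>?P2. q ^ g * exp (- l * real \<tau>))"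
    by (intro sum_mono pw) (auto simp: listed_containers_def)
  also have "\<dots> = real (card ?P2) * (q ^ g * exp (- l * real \<tau>))" by simp
  also have "\<dots> \<le> (?E * Q) * (q ^ g * exp (- l * real \<tau>))"
  proof (rule mult_right_mono)
    let ?B = "{p\<in>?K. admissible \<tau> p}"
    have finB: "finite ?B" using K by simp
    have "card ?P2 \<le> card (\<Union>p\<in>?B. completions \<tau> p)"
      unfolding listed_containers_def using finB finite_completions(2) by (intro card_mono) auto
    also have "\<dots> \<le> (\<Sum>p\<in>?B. card (completions \<tau> p))" by (rule card_UN_le[OF finB])
    finally have "real (card ?P2) \<le> real (\<Sum>p\<in>?B. card (completions \<tau> p))" by (rule of_nat_mono)
    also have "\<dots> = (\<Sum>p\<in>?B. real (card (completions \<tau> p)))" by (rule of_nat_sum)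
    also have "\<dots> \<le> (\<Sum>p\<in>?B. Q)"
      by (rule sum_mono) (use small in simp)
    also have "\<dots> = real (card ?B) * Q" by simp
    also have "\<dots> \<le> ?E * Q"
    proof (rule mult_right_mono)
      have "card ?B \<le> card ?K" using K(1) by (intro card_mono) auto
      then show "real (card ?B) \<le> ?E" using K(2) by linarith
    qed (simp add: Q_def)
    finally show "real (card ?P2) \<le> ?E * Q" .
  qed (use q1 in auto)
  also have "\<dots> = q ^ g * exp (4900 * real \<tau> * L ^ 2 / real D + l * real \<tau> / 4 - l * real \<tau>)"
  proof -
    have "exp a * exp b * (z * exp (- c)) = z * exp (a + b - c)" for a b c z :: real
      by (simp add: exp_diff exp_add exp_minus field_simps)
    from this[of "4900 * real \<tau> * L ^ 2 / real D" "l * real \<tau> / 4" "q ^ g" "l * real \<tau>"]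
    show ?thesis unfolding Q_def mult_minus_left .
  qed
  also have "\<dots> \<le> q ^ g * ?R"
  proof -
    have "real \<tau> * L ^ 2 / real D * (4900 + 10000 * L) \<le> real \<tau> * L ^ 2 / real D * (750 * s)"
      using large by (intro mult_left_mono) (auto simp: s_def)
    also have "\<dots> = 3 / 4 * (l * real \<tau>)"
      unfolding l_def s(2)[symmetric] using s(1) by simp
    finally have "real \<tau> * L ^ 2 / real D * (4900 + 10000 * L) \<le> 3 / 4 * (l * real \<tau>)" .
    moreover have "real \<tau> * L ^ 2 / real D * (4900 + 10000 * L)
        = 4900 * real \<tau> * L ^ 2 / real D + 10000 * real \<tau> * L ^ 3 / real D"
      by (simp only: distrib_left) (simp add: power2_eq_square power3_eq_cube mult_ac)
    ultimately have "4900 * real \<tau> * L ^ 2 / real D + l * real \<tau> / 4 - l * real \<tau> \<le> - (10000 * real \<tau> * L ^ 3 / real D)"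
      by linarith
    then show ?thesis using q1 by (intro mult_left_mono) auto
  qed
  finally have S2: "(\<Sum>C\<in>?P2. q ^ card C) \<le> q ^ g * ?R" .
  have "(\<Sum>C\<in>containers v \<tau> g. q ^ card C) = (\<Sum>C\<in>?P1 \<union> ?P2. q ^ card C)"
    by (simp only: containers_def)
  also have "\<dots> \<le> (\<Sum>C\<in>?P1. q ^ card C) + (\<Sum>C\<in>?P2. q ^ card C)"
  proof -
    have "(\<Sum>C\<in>?P1 \<union> ?P2. q ^ card C) + (\<Sum>C\<in>?P1 \<inter> ?P2. q ^ card C) = (\<Sum>C\<in>?P1. q ^ card C) + (\<Sum>C\<in>?P2. q ^ card C)"
      using fin by (rule sum.union_inter)
    moreover have "0 \<le> (\<Sum>C\<in>?P1 \<inter> ?P2. q ^ card C)" using q1 by (intro sum_nonneg) auto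
    ultimately show ?thesis by linarith
  qed
  also have "\<dots> \<le> 2 * q ^ g * ?R" using S1 S2 by simp
  finally show ?thesis .
qed

text \<open>A vertex of the closure shares each of its neighbours with some vertex of
  \<open>B\<close>. A cut containing all of \<open>B\<close> is therefore crossed, and any other cut
  is crossed inside \<open>B\<close>.\<close>

lemma closed_ncl:
  assumes B: "B \<subseteq> X" and conn: "conn_from link v B"
  shows "c4_free_closed X Y N D (ncl B) v" "NS (ncl B) = NS B" "B \<subseteq> ncl B"
proof -
  show sub: "B \<subseteq> ncl B" using B by (auto simp: ncl_def NS_def)
  show NS: "NS (ncl B) = NS B" using sub by (auto simp: ncl_def NS_def)
  show "c4_free_closed X Y N D (ncl B) v"
  proof unfold_locales
    show "ncl B \<subseteq> X" by (auto simp: ncl_def)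
    show "v \<in> ncl B" using conn sub by (auto simp: conn_from_def)
    show "x \<in> ncl B" if "x \<in> X" "N x \<subseteq> NS (ncl B)" for x
      using that unfolding NS by (simp add: ncl_def)
    show "conn_from link v (ncl B)"
      unfolding conn_from_def
    proof (intro conjI allI impI)
      show "v \<in> ncl B" by fact
      fix W0 assume W0: "v \<in> W0 \<and> W0 \<subset> ncl B"
      show "\<exists>x\<in>W0. \<exists>y\<in>ncl B - W0. N x \<inter> N y \<noteq> {}"
      proof (cases "B \<subseteq> W0")
        case True
        obtain x where x: "x \<in> ncl B" "x \<notin> W0" using W0 by blast
        then have "N x \<noteq> {}" using card_N[of x] D_ge by (auto simp: ncl_def)
        then obtain y where "y \<in> N x" by blast
        moreover then have "y \<in> NS B" using x by (auto simp: ncl_def)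
        ultimately obtain b where "b \<in> B" "y \<in> N b \<inter> N x" by (auto simp: NS_def)
        then show ?thesis using x True by blast
      next
        case False
        have "v \<in> W0 \<inter> B" using W0 conn by (auto simp: conn_from_def)
        then obtain x y where "x \<in> W0 \<inter> B" "y \<in> B" "y \<notin> W0 \<inter> B" "N x \<inter> N y \<noteq> {}"
          using conn_fromD[OF conn, of "W0 \<inter> B"] False by blast
        then show ?thesis using sub by blast
      qed
    qed
  qed
qed

end

text \<open>After the last round \<open>card S <= card F + \<Gamma> * t\<close>. If \<open>F\<close>
  misses at least \<open>2 * \<Gamma> * t\<close> vertices of \<open>G\<close>, then
  \<open>S\<close> is smaller than \<open>G\<close> by \<open>\<Gamma> * t\<close>; otherwise the
  missing part is small enough to be guessed and \<open>A\<close> is its own container.\<close>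

lemma (in c4_free_closed) container_exists:
  "\<exists>C\<in>containers v t (card G). A \<subseteq> C"
proof -
  obtain F S where FS: "(F, S) \<in> states v t J" "good F S"
    "real (card S) - real (card F) \<le> 4 * real t / 2 ^ J" using states_exist by blast
  have "4 * real t / 2 ^ J = 4 / 2 ^ J * real t" by simp
  also have "\<dots> \<le> \<Gamma> * real t" using J_bounds(1) by (intro mult_right_mono) auto
  finally have \<Phi>: "real (card S) - real (card F) \<le> \<Gamma> * real t" using FS(3) by linarith
  have adm: "admissible t (F, S)" by (rule good_admissible[OF FS(2)])
  have AS: "A \<subseteq> S" and FG: "F \<subseteq> G" using FS(2) by (auto simp: good_def)
  show ?thesis
  proof (cases "2 * \<Gamma> * real t \<le> real (card (G - F))")
    case True
    have "real (card S) \<le> real (card G) - \<Gamma> * real t"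
      using \<Phi> True good_card[OF FS(2)] by simp
    then have "S \<in> containers v t (card G)"
      unfolding containers_defs using FS(1) adm by (intro UnI1 image_eqI[of _ _ "(F, S)"]) auto
    then show ?thesis using AS by blast
  next
    case False
    have "G \<subseteq> NS S" unfolding G_def by (rule NS_mono[OF AS])
    then have H: "G - F \<in> small_subsets (2 * \<Gamma> * real t) (NS (snd (F, S)))"
      using False by (auto simp: small_subsets_def)
    define C where "C = {x\<in>X. N x \<subseteq> fst (F, S) \<union> (G - F)}"
    have "fst (F, S) \<union> (G - F) = G" using FG by auto
    then have CA: "C = A" using closed_iff unfolding C_def by blast
    then have "card C + t \<le> card G" using card_G by simp
    moreover have "C \<in> completions t (F, S)"
      unfolding completions_def by (rule image_eqI[OF _ H]) (simp add: C_def)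
    ultimately have "C \<in> containers v t (card G)"
      unfolding containers_def listed_containers_def using FS(1) adm by blast
    then show ?thesis using CA by blast
  qed
qed

section \<open>Polymer sums and peeling\<close>

context c4_free
begin

text \<open>One part of the exponent swallows the factor \<open>\<tau> * D\<close>, another makes
  the series geometric with ratio \<open>exp (- (1 / D))\<close> and sum at most
  \<open>2 * D\<close>; the rest is estimated by its value at the left end.\<close>

lemma sum_exp_tail:
  fixes \<tau>0 m :: nat
  shows "(\<Sum>\<tau>\<in>{\<tau>0..m}. 2 * (real \<tau> * real D) * exp (- (9000 * (real \<tau> * L ^ 3 / real D))))
    \<le> 4 * real D ^ 3 * exp (- (4000 * real \<tau>0 * L ^ 3 / real D))"
proof -
  define d where "d = real D"
  have d: "10 \<le> d" using D_ge by (simp add: d_def)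
  have L3: "1 \<le> L ^ 3" using L_ge by simp
  define x where "x = (\<lambda>\<tau>. real \<tau> * L ^ 3 / d)"
  have xge: "real \<tau> / d \<le> x \<tau>" for \<tau> :: nat
  proof -
    have "real \<tau> * 1 \<le> real \<tau> * L ^ 3" using L3 by (intro mult_left_mono) auto
    then show ?thesis using d by (simp add: x_def divide_right_mono)
  qed
  define r where "r = exp (- (1 / d))"
  have r: "0 < r" "r < 1" using d by (auto simp: r_def)
  have bnd: "2 * (real \<tau> * d) * exp (- (9000 * x \<tau>)) \<le> 2 * d ^ 2 * exp (- (4000 * x \<tau>0)) * r ^ \<tau>"
    if "\<tau>0 \<le> \<tau>" for \<tau> :: nat
  proof -
    have x0: "0 \<le> x \<tau>" using xge[of \<tau>] d by (meson divide_nonneg_pos less_le_trans of_nat_0_le_iff order_trans zero_less_numeral)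
    have mono: "x \<tau>0 \<le> x \<tau>" using that d L_ge by (auto simp: x_def intro!: divide_right_mono mult_right_mono)
    have "real \<tau> * d = d ^ 2 * (real \<tau> / d)" using d by (simp add: power2_eq_square)
    also have "\<dots> \<le> d ^ 2 * x \<tau>" using xge by (intro mult_left_mono) auto
    also have "\<dots> \<le> d ^ 2 * exp (x \<tau>)" 
    proof (rule mult_left_mono)
      show "x \<tau> \<le> exp (x \<tau>)" using exp_ge_add_one_self[of "x \<tau>"] by linarith
    qed simp
    finally have "2 * (real \<tau> * d) * exp (- (9000 * x \<tau>)) \<le> 2 * (d ^ 2 * exp (x \<tau>)) * exp (- (9000 * x \<tau>))"
      by (intro mult_right_mono mult_left_mono) auto
    also have "\<dots> = 2 * d ^ 2 * (exp (x \<tau>) * exp (- (9000 * x \<tau>)))" by simp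
    also have "exp (x \<tau>) * exp (- (9000 * x \<tau>)) = exp (- (8999 * x \<tau>))"
      by (simp add: exp_add[symmetric])
    also have "\<dots> \<le> exp (- (4000 * x \<tau>0) + - (real \<tau> / d))"
    proof -
      have "4000 * x \<tau>0 + real \<tau> / d \<le> 8999 * x \<tau>" using mono xge[of \<tau>] x0 by linarith
      then show ?thesis by simp
    qed
    also have "\<dots> = exp (- (4000 * x \<tau>0)) * r ^ \<tau>"
    proof -
      have "r ^ \<tau> = exp (real \<tau> * (- (1 / d)))" unfolding r_def by (rule exp_of_nat_mult[symmetric])
      also have "real \<tau> * (- (1 / d)) = - (real \<tau> / d)" by simp
      finally show ?thesis by (simp only: exp_add)
    qed
    finally show ?thesis by (simp add: mult_left_mono)
  qed
  have "(\<Sum>\<tau>\<in>{\<tau>0..m}. r ^ \<tau>) \<le> (\<Sum>\<tau><Suc m. r ^ \<tau>)"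
    using r by (intro sum_mono2) auto
  also have "\<dots> = (1 - r ^ Suc m) / (1 - r)"
    using r by (subst sum_gp_strict) simp
  also have "\<dots> \<le> 1 / (1 - r)"
    using r by (intro divide_right_mono) auto
  also have "\<dots> \<le> 2 * d"
  proof -
    have "1 + 1 / d \<le> exp (1 / d)" by (rule exp_ge_add_one_self)
    then have "r \<le> 1 / (1 + 1 / d)" unfolding r_def exp_minus inverse_eq_divide
      using d by (intro divide_left_mono) (auto intro!: mult_pos_pos add_pos_pos)
    also have "\<dots> \<le> 1 - 1 / (2 * d)" using d by (simp add: field_simps)
    finally have "1 / (2 * d) \<le> 1 - r" by simp
    then show ?thesis using r d by (simp add: field_simps)
  qed
  finally have geo: "(\<Sum>\<tau>\<in>{\<tau>0..m}. r ^ \<tau>) \<le> 2 * d" .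
  have "(\<Sum>\<tau>\<in>{\<tau>0..m}. 2 * (real \<tau> * d) * exp (- (9000 * x \<tau>)))
      \<le> (\<Sum>\<tau>\<in>{\<tau>0..m}. 2 * d ^ 2 * exp (- (4000 * x \<tau>0)) * r ^ \<tau>)"
    by (intro sum_mono bnd) auto
  also have "\<dots> = 2 * d ^ 2 * exp (- (4000 * x \<tau>0)) * (\<Sum>\<tau>\<in>{\<tau>0..m}. r ^ \<tau>)"
    by (rule sum_distrib_left[symmetric])
  also have "\<dots> \<le> 2 * d ^ 2 * exp (- (4000 * x \<tau>0)) * (2 * d)"
    using geo by (intro mult_left_mono) auto
  also have "\<dots> = 4 * d ^ 3 * exp (- (4000 * x \<tau>0))" by (simp add: power2_eq_square power3_eq_cube)
  finally show ?thesis by (simp add: x_def d_def mult.assoc)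
qed

text \<open>Abstract in \<open>I\<close>, \<open>B\<close> and \<open>w\<close> because it is
  applied twice: to linked subsets of one layer, and to antichains in two layers through their
  \<open>base\<close>. Polymers are grouped by defect, neighbourhood size and container;
  \<open>weight\<close> bounds each group, and \<open>container_weight\<close> sums over the
  containers.\<close>

lemma polymer_sum:
  fixes B :: "'i \<Rightarrow> 'a set" and w :: "'i \<Rightarrow> real"
  assumes I: "finite I"
    and B: "\<And>i. i \<in> I \<Longrightarrow> B i \<subseteq> X" "\<And>i. i \<in> I \<Longrightarrow> conn_from link v (B i)"
    and w: "\<And>i. i \<in> I \<Longrightarrow> 0 \<le> w i"
    and weight: "\<And>C. C \<subseteq> X \<Longrightarrow> (\<Sum>i\<in>{i\<in>I. B i \<subseteq> C}. w i) \<le> q ^ card C * exp (\<delta> * real (card C))"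
    and \<delta>: "0 \<le> \<delta>" "\<delta> * real D ^ 2 \<le> 1000"
    and \<tau>0: "\<And>i. i \<in> I \<Longrightarrow> card (ncl (B i)) + \<tau>0 \<le> card (NS (B i))" "D \<le> 5 * \<tau>0"
    and q: "exp (1000 * L ^ 2 / sqrt (real D)) \<le> q"
    and large: "4900 + 10000 * L \<le> 750 * sqrt (real D)"
  shows "(\<Sum>i\<in>I. w i / q ^ card (NS (B i))) \<le> 4 * real D ^ 3 * exp (- (4000 * real \<tau>0 * L ^ 3 / real D))"
proof -
  have q0: "0 < q" by (rule less_le_trans[OF exp_gt_zero q])
  define g where "g = (\<lambda>i. card (NS (B i)))"
  define \<tau> where "\<tau> = (\<lambda>i. g i - card (ncl (B i)))"
  have ex: "\<exists>C\<in>containers v (\<tau> i) (g i). B i \<subseteq> C" and bounds: "\<tau>0 \<le> \<tau> i" "\<tau> i \<le> card Y" "1 \<le> g i" "g i \<le> \<tau> i * D"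
    if i: "i \<in> I" for i
  proof -
    interpret c: c4_free_closed X Y N D "ncl (B i)" v
      by (rule closed_ncl(1)[OF B(1)[OF i] B(2)[OF i]])
    note cl = closed_ncl[OF B(1)[OF i] B(2)[OF i]]
    have g: "card c.G = g i" by (simp add: c.G_def cl(2) g_def)
    then have t: "c.t = \<tau> i" by (simp add: c.t_def \<tau>_def)
    show "\<exists>C\<in>containers v (\<tau> i) (g i). B i \<subseteq> C"
      using c.container_exists cl(3) unfolding g t by blast
    show "\<tau>0 \<le> \<tau> i" using \<tau>0(1)[OF i] by (simp add: \<tau>_def g_def)
    have "g i \<le> card Y" using card_mono[OF finY c.G_sub] g by simp
    then show "\<tau> i \<le> card Y" by (simp add: \<tau>_def)
    show "1 \<le> g i" using c.card_A_less g by simp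
    show "g i \<le> \<tau> i * D" using c.card_G_le unfolding g t .
  qed
  \<comment> \<open>One container is fixed per polymer, so every polymer falls into exactly one
    group.\<close>
  define Ct where "Ct = (\<lambda>i. SOME C. C \<in> containers v (\<tau> i) (g i) \<and> B i \<subseteq> C)"
  have Ct: "Ct i \<in> containers v (\<tau> i) (g i)" "B i \<subseteq> Ct i" if "i \<in> I" for i
  proof -
    have "\<exists>C. C \<in> containers v (\<tau> i) (g i) \<and> B i \<subseteq> C" using ex[OF that] by blast
    from someI_ex[OF this] show "Ct i \<in> containers v (\<tau> i) (g i)" "B i \<subseteq> Ct i"
      unfolding Ct_def by blast+
  qed
  let ?T = "{\<tau>0..card Y}"
  let ?K = "SIGMA \<tau>':?T. SIGMA g':{1..\<tau>' * D}. containers v \<tau>' g'"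
  define key where "key = (\<lambda>i. (\<tau> i, g i, Ct i))"
  have finC: "finite (containers v \<tau>' g')" if "\<tau>' \<in> ?T" for \<tau>' g'
    by (rule finite_containers) (use that \<tau>0(2) in auto)
  have finK: "finite ?K" using finC by (intro finite_SigmaI) auto
  have key: "key ` I \<subseteq> ?K"
    using Ct bounds by (auto simp: key_def)
  let ?u = "\<lambda>i. w i / q ^ g i"
  have "(\<Sum>i\<in>I. ?u i) = (\<Sum>k\<in>?K. \<Sum>i\<in>{i\<in>I. key i = k}. ?u i)"
    by (rule sum.group[symmetric, OF I finK key])
  also have "\<dots> \<le> (\<Sum>k\<in>?K. case k of (\<tau>', g', C) \<Rightarrow> q ^ card C * (exp (1000 * (real \<tau>' * L ^ 3 / real D)) / q ^ g'))"
  proof (rule sum_mono)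
    fix k assume k: "k \<in> ?K"
    obtain \<tau>' g' C where keq: "k = (\<tau>', g', C)" by (cases k) auto
    have k': "\<tau>' \<in> ?T" "g' \<le> \<tau>' * D" "C \<in> containers v \<tau>' g'" using k by (auto simp: keq)
    have CX: "C \<subseteq> X" "card C \<le> g'" using containers_sub[OF k'(3)] by auto
    have "(\<Sum>i\<in>{i\<in>I. key i = k}. ?u i) = (\<Sum>i\<in>{i\<in>I. key i = k}. w i) / q ^ g'"
      unfolding sum_divide_distrib by (intro sum.cong) (auto simp: key_def keq)
    also have "\<dots> \<le> (\<Sum>i\<in>{i\<in>I. B i \<subseteq> C}. w i) / q ^ g'"
    proof (intro divide_right_mono sum_mono2)
      show "{i\<in>I. key i = k} \<subseteq> {i\<in>I. B i \<subseteq> C}" using Ct by (auto simp: key_def keq)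
    qed (use I w q0 in auto)
    also have "\<dots> \<le> (q ^ card C * exp (\<delta> * real (card C))) / q ^ g'"
      using weight[OF CX(1)] q0 by (intro divide_right_mono) auto
    also have "\<dots> \<le> (q ^ card C * exp (1000 * (real \<tau>' * L ^ 3 / real D))) / q ^ g'"
    proof (intro divide_right_mono mult_left_mono)
      \<comment> \<open>A container has at most \<open>g' <= \<tau>' * D\<close> elements, so the
        factor \<open>exp (\<delta> * card C)\<close> uses up 1000 of the 10000 that
        \<open>container_weight\<close> provides in the exponent.\<close>
      have "card C \<le> \<tau>' * D" using CX k' by linarith
      then have "real (card C) \<le> real \<tau>' * real D" by (metis of_nat_le_iff of_nat_mult)
      then have "\<delta> * real (card C) \<le> \<delta> * (real \<tau>' * real D)" using \<delta> by (intro mult_left_mono)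
      also have "\<dots> = (\<delta> * real D ^ 2) * (real \<tau>' / real D)" using D_ge by (simp add: power2_eq_square)
      also have "\<dots> \<le> 1000 * (real \<tau>' / real D)" using \<delta> by (intro mult_right_mono) auto
      also have "\<dots> \<le> 1000 * (real \<tau>' * L ^ 3 / real D)"
      proof -
        have "1 \<le> L ^ 3" using L_ge by simp
        then have "real \<tau>' * 1 \<le> real \<tau>' * L ^ 3" by (intro mult_left_mono) auto
        then show ?thesis by (simp add: divide_right_mono)
      qed
      finally show "exp (\<delta> * real (card C)) \<le> exp (1000 * (real \<tau>' * L ^ 3 / real D))" by simp
    qed (use q0 in auto)
    finally show "(\<Sum>i\<in>{i\<in>I. key i = k}. ?u i) \<le>
        (case k of (\<tau>', g', C) \<Rightarrow> q ^ card C * (exp (1000 * (real \<tau>' * L ^ 3 / real D)) / q ^ g'))"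
      by (simp add: keq)
  qed
  also have "\<dots> = (\<Sum>\<tau>'\<in>?T. \<Sum>g'\<in>{1..\<tau>' * D}. \<Sum>C\<in>containers v \<tau>' g'.
      q ^ card C * (exp (1000 * (real \<tau>' * L ^ 3 / real D)) / q ^ g'))"
  proof -
    have "(\<Sum>\<tau>'\<in>?T. \<Sum>g'\<in>{1..\<tau>' * D}. \<Sum>C\<in>containers v \<tau>' g'. h \<tau>' g' C) =
        (\<Sum>(\<tau>', g', C)\<in>?K. h \<tau>' g' C)" for h :: "nat \<Rightarrow> nat \<Rightarrow> 'a set \<Rightarrow> real"
    proof -
      have "(\<Sum>\<tau>'\<in>?T. \<Sum>g'\<in>{1..\<tau>' * D}. \<Sum>C\<in>containers v \<tau>' g'. h \<tau>' g' C)
          = (\<Sum>\<tau>'\<in>?T. \<Sum>(g', C)\<in>(SIGMA g':{1..\<tau>' * D}. containers v \<tau>' g'). h \<tau>' g' C)"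
        using finC by (intro sum.cong refl sum.Sigma) auto
      also have "\<dots> = (\<Sum>(\<tau>', g', C)\<in>?K. h \<tau>' g' C)"
        using finC by (intro sum.Sigma) auto
      finally show ?thesis .
    qed
    then show ?thesis by simp
  qed
  also have "\<dots> \<le> (\<Sum>\<tau>'\<in>?T. 2 * (real \<tau>' * real D) * exp (- (9000 * (real \<tau>' * L ^ 3 / real D))))"
  proof (rule sum_mono)
    fix \<tau>' assume \<tau>': "\<tau>' \<in> ?T"
    define x where "x = real \<tau>' * L ^ 3 / real D"
    have x: "10000 * real \<tau>' * L ^ 3 / real D = 10000 * x" by (simp add: x_def)
    have "(\<Sum>g'\<in>{1..\<tau>' * D}. \<Sum>C\<in>containers v \<tau>' g'. q ^ card C * (exp (1000 * x) / q ^ g'))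
        \<le> (\<Sum>g'\<in>{1..\<tau>' * D}. 2 * exp (- (9000 * x)))"
    proof (rule sum_mono)
      fix g' assume "g' \<in> {1..\<tau>' * D}"
      have "(\<Sum>C\<in>containers v \<tau>' g'. q ^ card C * (exp (1000 * x) / q ^ g'))
          = (\<Sum>C\<in>containers v \<tau>' g'. q ^ card C) * (exp (1000 * x) / q ^ g')"
        by (rule sum_distrib_right[symmetric])
      also have "\<dots> \<le> (2 * q ^ g' * exp (- (10000 * x))) * (exp (1000 * x) / q ^ g')"
        using container_weight[of \<tau>' q v g', OF _ q large] \<tau>' \<tau>0(2) q0
        by (intro mult_right_mono) (auto simp: x)
      also have "\<dots> = 2 * (exp (- (10000 * x)) * exp (1000 * x))" using q0 by simp
      also have "exp (- (10000 * x)) * exp (1000 * x) = exp (- (9000 * x))" by (simp add: exp_add[symmetric])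
      finally show "(\<Sum>C\<in>containers v \<tau>' g'. q ^ card C * (exp (1000 * x) / q ^ g')) \<le> 2 * exp (- (9000 * x))" .
    qed
    also have "\<dots> = 2 * (real \<tau>' * real D) * exp (- (9000 * x))" by simp
    finally show "(\<Sum>g'\<in>{1..\<tau>' * D}. \<Sum>C\<in>containers v \<tau>' g'. q ^ card C * (exp (1000 * (real \<tau>' * L ^ 3 / real D)) / q ^ g'))
        \<le> 2 * (real \<tau>' * real D) * exp (- (9000 * (real \<tau>' * L ^ 3 / real D)))"
      unfolding x_def .
  qed
  also have "\<dots> \<le> 4 * real D ^ 3 * exp (- (4000 * real \<tau>0 * L ^ 3 / real D))" by (rule sum_exp_tail)
  finally show ?thesis by (simp add: g_def)
qed

lemma single_sum:
  assumes lam: "0 \<le> lam" and q: "exp (1000 * L ^ 2 / sqrt (real D)) \<le> 1 + lam"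
    and large: "4900 + 10000 * L \<le> 750 * sqrt (real D)"
  shows "(\<Sum>S\<in>{S. S \<subseteq> X \<and> conn_from link v S}. lam ^ card S / (1 + lam) ^ card (NS S))
    \<le> 4 * real D ^ 3 * exp (- (800 * L ^ 3))"
proof -
  \<comment> \<open>This is \<open>D / 5\<close> rounded up; by \<open>D_le_t\<close> no closed
    linked set has a smaller defect.\<close>
  define \<tau>0 where "\<tau>0 = (D + 4) div 5"
  have \<tau>0: "D \<le> 5 * \<tau>0" by (simp add: \<tau>0_def)
  let ?I = "{S. S \<subseteq> X \<and> conn_from link v S}"
  have "(\<Sum>S\<in>?I. lam ^ card S / (1 + lam) ^ card (NS S))
      \<le> 4 * real D ^ 3 * exp (- (4000 * real \<tau>0 * L ^ 3 / real D))"
  proof (rule polymer_sum[where \<delta> = 0 and B = "\<lambda>S. S" and w = "\<lambda>S. lam ^ card S" and v = v])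
    have "?I \<subseteq> Pow X" "finite (Pow X)" using finX by blast+
    then show "finite ?I" by (rule finite_subset)
    show "0 \<le> lam ^ card S" for S :: "'a set" using lam by simp
    show "S \<subseteq> X" "conn_from link v S" if "S \<in> ?I" for S using that by blast+
    show "(\<Sum>S\<in>{S\<in>?I. S \<subseteq> C}. lam ^ card S) \<le> (1 + lam) ^ card C * exp (0 * real (card C))"
      if C: "C \<subseteq> X" for C
    proof -
      have finC: "finite C" using C finX finite_subset by blast
      have "(\<Sum>S\<in>{S\<in>?I. S \<subseteq> C}. lam ^ card S) \<le> (\<Sum>S\<in>Pow C. lam ^ card S)"
      proof (rule sum_mono2)
        show "finite (Pow C)" using finC by simp
        show "{S\<in>?I. S \<subseteq> C} \<subseteq> Pow C" by blast
        show "0 \<le> lam ^ card S" for S :: "'a set" using lam by simp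
      qed
      then show ?thesis using sum_Pow_power[OF finC, of lam] by (simp only: mult_zero_left exp_zero mult_1_right)
    qed
    show "card (ncl S) + \<tau>0 \<le> card (NS S)" if "S \<in> ?I" for S
    proof -
      have S: "S \<subseteq> X" "conn_from link v S" using that by blast+
      interpret c: c4_free_closed X Y N D "ncl S" v by (rule closed_ncl(1)[OF S])
      have "card (NS S) = card (ncl S) + c.t"
        using c.card_G closed_ncl(2)[OF S] by (simp add: c.G_def)
      moreover have "\<tau>0 \<le> c.t" using c.D_le_t by (simp add: \<tau>0_def)
      ultimately show ?thesis by simp
    qed
    show "exp (1000 * L ^ 2 / sqrt (real D)) \<le> 1 + lam" "4900 + 10000 * L \<le> 750 * sqrt (real D)"
      by fact+
    show "D \<le> 5 * \<tau>0" by fact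
  qed simp_all
  also have "\<dots> \<le> 4 * real D ^ 3 * exp (- (800 * L ^ 3))"
  proof -
    have "real D * (800 * L ^ 3) \<le> 5 * real \<tau>0 * (800 * L ^ 3)"
      using \<tau>0 L_ge by (intro mult_right_mono) auto
    then have "800 * L ^ 3 \<le> 4000 * real \<tau>0 * L ^ 3 / real D" using D_ge by (simp add: field_simps)
    then show ?thesis by (intro mult_left_mono) auto
  qed
  finally show ?thesis .
qed

end

section \<open>The exchange argument for inserting one element\<close>

lemma component_exists:
  assumes sym: "\<And>x y. r x y \<Longrightarrow> r y x" and fin: "finite S" and s: "s \<in> S"
  obtains K where "K \<subseteq> S" "conn_from r s K" "\<And>x y. x \<in> K \<Longrightarrow> y \<in> S - K \<Longrightarrow> \<not> r x y"
proof -
  \<comment> \<open>A smallest part containing \<open>s\<close> that no link leaves inside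
    \<open>S\<close> is connected: a cut of it without crossing link would be a smaller such
    part.\<close>
  define cl where "cl = (\<lambda>K. s \<in> K \<and> K \<subseteq> S \<and> (\<forall>x\<in>K. \<forall>y\<in>S - K. \<not> r x y))"
  have "cl S" using s by (auto simp: cl_def)
  then obtain K where K: "cl K" and min: "\<And>K'. cl K' \<Longrightarrow> card K \<le> card K'"
    using arg_min_nat_lemma[of cl S card] by metis
  have finK: "finite K" using K fin finite_subset unfolding cl_def by blast
  have "conn_from r s K"
    unfolding conn_from_def
  proof (intro conjI allI impI)
    show "s \<in> K" using K by (simp add: cl_def)
    fix W0 assume W0: "s \<in> W0 \<and> W0 \<subset> K"
    then have "card W0 < card K" using finK by (intro psubset_card_mono) auto
    then have "\<not> cl W0" using min[of W0] by auto
    then obtain x y where xy: "x \<in> W0" "y \<in> S - W0" "r x y"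
      using W0 K unfolding cl_def by blast
    then have "y \<in> K" using K W0 unfolding cl_def by blast
    then show "\<exists>x\<in>W0. \<exists>y\<in>K - W0. r x y" using xy by blast
  qed
  then show thesis using that[of K] K unfolding cl_def by blast
qed

lemma finite_antichains: "finite U \<Longrightarrow> finite {\<A>. \<A> \<subseteq> U \<and> antichain \<A>}"
  by (rule finite_subset[of _ "Pow U"]) auto

text \<open>For fixed \<open>K\<close> the pair of \<open>\<A>\<close> and
  \<open>E \<subseteq> R K\<close> can be read off from \<open>(\<A> - K) \<union> E\<close>,
  because \<open>\<A>\<close> avoids \<open>R K\<close>. So the antichains assigned to
  \<open>K\<close>, each combined with a free choice of \<open>E\<close>, inject into those counted
  by \<open>antichain_Z U\<close>.\<close>

lemma antichain_Z_insert_le: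
  assumes fin: "finite U" and s: "s \<notin> U" and lam: "0 \<le> lam" and finK: "finite \<K>"
    and K: "\<And>\<A>. \<A> \<subseteq> insert s U \<Longrightarrow> antichain \<A> \<Longrightarrow> s \<in> \<A> \<Longrightarrow>
      \<exists>K\<in>\<K>. s \<in> K \<and> K \<subseteq> \<A> \<and> R K \<subseteq> U \<and> \<A> \<inter> R K = {} \<and> (\<forall>E\<subseteq>R K. antichain ((\<A> - K) \<union> E))"
  shows "antichain_Z (insert s U) lam \<le>
    (1 + (\<Sum>K\<in>\<K>. lam ^ card K / (1 + lam) ^ card (R K))) * antichain_Z U lam"
proof -
  define Z where "Z = antichain_Z U lam"
  let ?U = "{\<A>. \<A> \<subseteq> U \<and> antichain \<A>}"
  let ?S = "{\<A>. \<A> \<subseteq> insert s U \<and> antichain \<A> \<and> s \<in> \<A>}"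
  define ok where "ok = (\<lambda>\<A> K. K \<in> \<K> \<and> s \<in> K \<and> K \<subseteq> \<A> \<and> R K \<subseteq> U \<and> \<A> \<inter> R K = {} \<and>
    (\<forall>E\<subseteq>R K. antichain ((\<A> - K) \<union> E)))"
  define \<kappa> where "\<kappa> = (\<lambda>\<A>. SOME K. ok \<A> K)"
  have \<kappa>: "\<kappa> \<A> \<in> \<K>" "s \<in> \<kappa> \<A>" "\<kappa> \<A> \<subseteq> \<A>" "R (\<kappa> \<A>) \<subseteq> U" "\<A> \<inter> R (\<kappa> \<A>) = {}"
    "\<And>E. E \<subseteq> R (\<kappa> \<A>) \<Longrightarrow> antichain ((\<A> - \<kappa> \<A>) \<union> E)" if "\<A> \<in> ?S" for \<A>
  proof -
    have "\<A> \<subseteq> insert s U" "antichain \<A>" "s \<in> \<A>" using that by simp_all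
    from K[OF this] have "\<exists>K. ok \<A> K" by (simp only: ok_def Bex_def)
    then have ok: "ok \<A> (\<kappa> \<A>)" unfolding \<kappa>_def by (rule someI_ex)
    then show "\<kappa> \<A> \<in> \<K>" "s \<in> \<kappa> \<A>" "\<kappa> \<A> \<subseteq> \<A>" "R (\<kappa> \<A>) \<subseteq> U" "\<A> \<inter> R (\<kappa> \<A>) = {}"
      by (simp_all add: ok_def)
    show "antichain ((\<A> - \<kappa> \<A>) \<union> E)" if "E \<subseteq> R (\<kappa> \<A>)" for E
      using ok that by (simp add: ok_def)
  qed
  have finU: "finite ?U" by (rule finite_antichains[OF fin])
  have finS: "finite ?S"
    by (rule finite_subset[OF _ finite_antichains[of "insert s U"]]) (use fin in auto)
  have fiber: "(\<Sum>\<A>\<in>{\<A>\<in>?S. \<kappa> \<A> = K}. lam ^ card \<A>) \<le> lam ^ card K / (1 + lam) ^ card (R K) * Z"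
    if "K \<in> \<K>" for K
  proof (cases "{\<A>\<in>?S. \<kappa> \<A> = K} = {}")
    case True
    have "0 \<le> Z" unfolding Z_def antichain_Z_def using lam by (intro sum_nonneg) auto
    then show ?thesis unfolding True using lam by simp
  next
    case False
    let ?F = "{\<A>\<in>?S. \<kappa> \<A> = K}"
    obtain \<A>0 where "\<A>0 \<in> ?S" "\<kappa> \<A>0 = K" using False by auto
    then have RU: "R K \<subseteq> U" using \<kappa>(4)[of \<A>0] by simp
    then have finR: "finite (R K)" using fin finite_subset by blast
    have "?F \<subseteq> ?S" by blast
    then have finF: "finite ?F" using finS by (rule finite_subset)
    let ?\<phi> = "\<lambda>(\<A>, E). (\<A> - K) \<union> E"
    have inj: "inj_on ?\<phi> (?F \<times> Pow (R K))"
    proof (rule inj_onI)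
      fix p p' assume p: "p \<in> ?F \<times> Pow (R K)" "p' \<in> ?F \<times> Pow (R K)" "?\<phi> p = ?\<phi> p'"
      obtain \<A> E \<A>' E' where pp: "p = (\<A>, E)" "p' = (\<A>', E')" by (cases p, cases p')
      have a: "\<A> \<in> ?S" "\<kappa> \<A> = K" "E \<subseteq> R K" "\<A>' \<in> ?S" "\<kappa> \<A>' = K" "E' \<subseteq> R K"
        using p by (auto simp: pp)
      have b: "K \<subseteq> \<A>" "\<A> \<inter> R K = {}" "K \<subseteq> \<A>'" "\<A>' \<inter> R K = {}"
        using \<kappa>(3,5)[OF a(1)] \<kappa>(3,5)[OF a(4)] a by auto
      have eq: "(\<A> - K) \<union> E = (\<A>' - K) \<union> E'" using p(3) by (simp add: pp)
      have "E = ((\<A> - K) \<union> E) \<inter> R K" "E' = ((\<A>' - K) \<union> E') \<inter> R K"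
        "\<A> = (((\<A> - K) \<union> E) - R K) \<union> K" "\<A>' = (((\<A>' - K) \<union> E') - R K) \<union> K"
        using a(3,6) b by auto
      then show "p = p'" unfolding pp using eq by simp
    qed
    have cards: "card (?\<phi> (\<A>, E)) + card K = card \<A> + card E"
      if a: "\<A> \<in> ?F" and E: "E \<subseteq> R K" for \<A> E
    proof -
      have aS: "\<A> \<in> ?S" "\<kappa> \<A> = K" using a by auto
      have b: "K \<subseteq> \<A>" "\<A> \<inter> R K = {}" using \<kappa>(3,5)[OF aS(1)] aS by auto
      have finA: "finite \<A>" using aS fin finite_subset by blast
      have finE: "finite E" using E finR finite_subset by blast
      have "card ((\<A> - K) \<union> E) = card (\<A> - K) + card E"
        using finA finE b E by (intro card_Un_disjoint) auto
      moreover have "card (\<A> - K) + card K = card \<A>"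
        using finA b card_mono[OF finA b(1)] by (simp add: card_Diff_subset finite_subset)
      ultimately show ?thesis by simp
    qed
    have "(\<Sum>\<A>\<in>?F. lam ^ card \<A>) * (1 + lam) ^ card (R K)
        = (\<Sum>\<A>\<in>?F. \<Sum>E\<in>Pow (R K). lam ^ card \<A> * lam ^ card E)"
      by (simp only: sum_Pow_power[OF finR, symmetric] sum_product)
    also have "\<dots> = (\<Sum>(\<A>, E)\<in>?F \<times> Pow (R K). lam ^ card \<A> * lam ^ card E)"
      by (rule sum.cartesian_product)
    also have "\<dots> = (\<Sum>p\<in>?F \<times> Pow (R K). lam ^ card K * lam ^ card (?\<phi> p))"
    proof (intro sum.cong refl)
      fix p assume p: "p \<in> ?F \<times> Pow (R K)"
      obtain \<A> E where pp: "p = (\<A>, E)" by (cases p)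
      have "card (?\<phi> (\<A>, E)) + card K = card \<A> + card E" using p by (intro cards) (auto simp: pp)
      then show "(case p of (\<A>, E) \<Rightarrow> lam ^ card \<A> * lam ^ card E) = lam ^ card K * lam ^ card (?\<phi> p)"
        by (simp add: pp power_add[symmetric] add.commute)
    qed
    also have "\<dots> = lam ^ card K * (\<Sum>p\<in>?F \<times> Pow (R K). lam ^ card (?\<phi> p))"
      by (rule sum_distrib_left[symmetric])
    also have "(\<Sum>p\<in>?F \<times> Pow (R K). lam ^ card (?\<phi> p)) = (\<Sum>\<B>\<in>?\<phi> ` (?F \<times> Pow (R K)). lam ^ card \<B>)"
      by (subst sum.reindex[OF inj]) simp
    also have "\<dots> \<le> Z"
      unfolding Z_def antichain_Z_def
    proof (rule sum_mono2[OF finU])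
      show "?\<phi> ` (?F \<times> Pow (R K)) \<subseteq> ?U"
      proof
        fix \<B> assume "\<B> \<in> ?\<phi> ` (?F \<times> Pow (R K))"
        then obtain \<A> E where a: "\<A> \<in> ?S" "\<kappa> \<A> = K" "E \<subseteq> R K" "\<B> = (\<A> - K) \<union> E" by auto
        then show "\<B> \<in> ?U" using \<kappa>(2,6)[OF a(1)] RU by auto
      qed
    qed (use lam in auto)
    finally have "(\<Sum>\<A>\<in>?F. lam ^ card \<A>) * (1 + lam) ^ card (R K) \<le> lam ^ card K * Z"
      using lam by (simp add: mult_left_mono)
    then show ?thesis using lam by (simp add: field_simps)
  qed
  have "{\<A>. \<A> \<subseteq> insert s U \<and> antichain \<A>} = ?U \<union> ?S" by auto
  then have "antichain_Z (insert s U) lam = (\<Sum>\<A>\<in>?U \<union> ?S. lam ^ card \<A>)"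
    by (simp only: antichain_Z_def)
  also have "\<dots> = Z + (\<Sum>\<A>\<in>?S. lam ^ card \<A>)"
    unfolding Z_def antichain_Z_def using finU finS s by (intro sum.union_disjoint) auto
  also have "(\<Sum>\<A>\<in>?S. lam ^ card \<A>) = (\<Sum>K\<in>\<K>. \<Sum>\<A>\<in>{\<A>\<in>?S. \<kappa> \<A> = K}. lam ^ card \<A>)"
    using \<kappa>(1) by (intro sum.group[symmetric] finS finK) blast
  also have "\<dots> \<le> (\<Sum>K\<in>\<K>. lam ^ card K / (1 + lam) ^ card (R K) * Z)"
    by (intro sum_mono fiber)
  also have "\<dots> = (\<Sum>K\<in>\<K>. lam ^ card K / (1 + lam) ^ card (R K)) * Z"
    by (rule sum_distrib_right[symmetric])
  finally show ?thesis by (simp add: Z_def algebra_simps)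
qed

section \<open>Layers of the Boolean lattice\<close>

definition layer :: "nat \<Rightarrow> nat \<Rightarrow> nat set set" where
  "layer n k = {A. A \<subseteq> {1..n} \<and> card A = k}"

definition shad :: "'a set \<Rightarrow> 'a set set" where "shad x = (\<lambda>i. x - {i}) ` x"

lemma finite_layer: "finite (layer n k)"
  by (rule finite_subset[of _ "Pow {1..n}"]) (auto simp: layer_def)

lemma layerD: "x \<in> layer n k \<Longrightarrow> finite x" "x \<in> layer n k \<Longrightarrow> card x = k" "x \<in> layer n k \<Longrightarrow> x \<subseteq> {1..n}"
  by (auto simp: layer_def intro: finite_subset)

lemma layer_subI: "x \<in> layer n k \<Longrightarrow> y \<subseteq> x \<Longrightarrow> card y = j \<Longrightarrow> y \<in> layer n j"
  by (auto simp: layer_def)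

lemma layer_sub_eq: "x \<in> layer n k \<Longrightarrow> card x \<le> card y \<Longrightarrow> y \<subseteq> x \<Longrightarrow> y = x"
  using card_seteq[OF layerD(1)] by blast

lemma shad_iff:
  assumes "finite x"
  shows "y \<in> shad x \<longleftrightarrow> y \<subseteq> x \<and> card x = Suc (card y)"
proof
  assume "y \<in> shad x"
  then obtain i where "i \<in> x" "y = x - {i}" by (auto simp: shad_def)
  then show "y \<subseteq> x \<and> card x = Suc (card y)" using card_Suc_Diff1[OF assms] by auto
next
  assume y: "y \<subseteq> x \<and> card x = Suc (card y)"
  have "finite y" using y assms finite_subset by blast
  then have "card (x - y) = 1" using y by (simp add: card_Diff_subset)
  then obtain i where "x - y = {i}" by (auto simp: card_1_singleton_iff)
  then have "i \<in> x" "y = x - {i}" using y by auto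
  then show "y \<in> shad x" by (auto simp: shad_def)
qed

lemma shad_layer:
  assumes x: "x \<in> layer n (Suc j)"
  shows "y \<in> shad x \<longleftrightarrow> y \<in> layer n j \<and> y \<subseteq> x"
  using shad_iff[OF layerD(1)[OF x], of y] layerD(2)[OF x] layer_subI[OF x, of y j]
    layerD(2)[of y n j] by auto

lemma layer_disj: "x \<in> layer n k \<Longrightarrow> x \<in> layer n j \<Longrightarrow> k = j"
  by (simp add: layer_def)

lemma card_shad: "card (shad x) = card x"
  unfolding shad_def by (rule card_image) (auto simp: inj_on_def)

lemma card_supersets:
  assumes "y \<in> layer n j"
  shows "card {x\<in>layer n (Suc j). y \<in> shad x} \<le> n - j"
proof -
  have "{x\<in>layer n (Suc j). y \<in> shad x} \<subseteq> (\<lambda>i. insert i y) ` ({1..n} - y)"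
  proof
    fix x assume x: "x \<in> {x\<in>layer n (Suc j). y \<in> shad x}"
    then obtain i where "i \<in> x" "y = x - {i}" by (auto simp: shad_def)
    then have "x = insert i y" "i \<in> {1..n} - y" using x by (auto simp: layer_def)
    then show "x \<in> (\<lambda>i. insert i y) ` ({1..n} - y)" by blast
  qed
  then have "card {x\<in>layer n (Suc j). y \<in> shad x} \<le> card ((\<lambda>i. insert i y) ` ({1..n} - y))"
    by (intro card_mono) auto
  also have "\<dots> \<le> card ({1..n} - y)" by (intro card_image_le) auto
  also have "\<dots> = n - j" using assms layerD[OF assms] by (simp add: card_Diff_subset)
  finally show ?thesis .
qed

text \<open>Distinct \<open>(j + 1)\<close>-sets have at most one common \<open>j\<close>-subset,
  their intersection. A \<open>j\<close>-set has at most \<open>n - j\<close> supersets of size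
  \<open>j + 1\<close>, which \<open>n <= 2 * j\<close> makes smaller than
  \<open>j + 1\<close>.\<close>

lemma c4_free_layers:
  assumes "n \<le> 2 * j" "10 \<le> Suc j"
  shows "c4_free (layer n (Suc j)) (layer n j) shad (Suc j)"
proof
  show "finite (layer n (Suc j))" "finite (layer n j)" by (rule finite_layer)+
  show "shad x \<subseteq> layer n j" if "x \<in> layer n (Suc j)" for x
    using shad_layer[OF that] by auto
  show "card (shad x) = Suc j" if "x \<in> layer n (Suc j)" for x
    using that by (simp add: card_shad layerD)
  show "card {x\<in>layer n (Suc j). y \<in> shad x} < Suc j" if "y \<in> layer n j" for y
    using card_supersets[OF that] assms by linarith
  show "10 \<le> Suc j" by fact
  fix x x' y y' assume x: "x \<in> layer n (Suc j)" "x' \<in> layer n (Suc j)" "x \<noteq> x'"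
    and y: "y \<in> shad x" "y \<in> shad x'" "y' \<in> shad x" "y' \<in> shad x'"
  have ne: "x \<inter> x' \<noteq> x"
  proof
    assume "x \<inter> x' = x"
    then have "x \<subseteq> x'" by blast
    then show False using layer_sub_eq[OF x(2), of x] layerD(2)[OF x(1)] layerD(2)[OF x(2)] x(3) by simp
  qed
  then have "card (x \<inter> x') < card x" using layerD(1)[OF x(1)] by (intro psubset_card_mono) auto
  then have c: "card (x \<inter> x') \<le> j" using layerD(2)[OF x(1)] by simp
  have "z = x \<inter> x'" if "z \<in> shad x" "z \<in> shad x'" for z
  proof -
    have "z \<subseteq> x \<inter> x'" "card z = j"
      using that shad_layer[OF x(1)] shad_layer[OF x(2)] layerD(2)[of z n j] by auto
    then show ?thesis using c card_seteq[of "x \<inter> x'" z] layerD(1)[OF x(1)] by simp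
  qed
  then show "y = y'" using y by blast
qed

lemma antichain_iff: "antichain \<A> \<longleftrightarrow> (\<forall>a\<in>\<A>. \<forall>b\<in>\<A>. a \<subseteq> b \<longrightarrow> a = b)"
  unfolding antichain_def pairwise_def by blast

lemma antichain_Z_layer:
  assumes "C \<subseteq> layer n j"
  shows "antichain_Z C lam = (1 + lam) ^ card C"
proof -
  have fin: "finite C" using assms finite_layer finite_subset by blast
  have "antichain \<A>" if "\<A> \<subseteq> C" for \<A>
    unfolding antichain_iff
  proof (intro ballI impI)
    fix a b assume "a \<in> \<A>" "b \<in> \<A>" "a \<subseteq> b"
    then have "a \<in> layer n j" "b \<in> layer n j" using that assms by auto
    then show "a = b"
      using layer_sub_eq[of b n j a] \<open>a \<subseteq> b\<close> layerD(2)[of a n j] layerD(2)[of b n j] by simp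
  qed
  then have "{\<A>. \<A> \<subseteq> C \<and> antichain \<A>} = Pow C" by auto
  then show ?thesis unfolding antichain_Z_def using sum_Pow_power[OF fin] by simp
qed

text \<open>Serves to weigh polymers inside a container. The members of \<open>V\<close> are
  inserted one at a time; the component of the new set within the upper layer is exchanged for a
  subset of its shadow, which lies in \<open>C\<close> by assumption.\<close>

lemma antichain_Z_two_layers:
  assumes g: "c4_free (layer n (Suc j)) (layer n j) shad (Suc j)"
    and lam: "0 \<le> lam" and \<epsilon>0: "0 \<le> \<epsilon>"
    and \<epsilon>: "\<And>v. (\<Sum>S\<in>{S. S \<subseteq> layer n (Suc j) \<and> conn_from (\<lambda>x y. shad x \<inter> shad y \<noteq> {}) v S}.
        lam ^ card S / (1 + lam) ^ card (c4_free.NS shad S)) \<le> \<epsilon>"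
    and C: "C \<subseteq> layer n j" and V: "V \<subseteq> layer n (Suc j)" "\<And>x. x \<in> V \<Longrightarrow> shad x \<subseteq> C"
  shows "antichain_Z (C \<union> V) lam \<le> (1 + \<epsilon>) ^ card V * (1 + lam) ^ card C"
proof -
  interpret g: c4_free "layer n (Suc j)" "layer n j" shad "Suc j" by fact
  have "finite V" using V finite_layer finite_subset by blast
  then show ?thesis using V
  proof (induction V rule: finite_induct)
    case empty
    then show ?case using antichain_Z_layer[OF C] by simp
  next
    case (insert s V)
    have sX: "s \<in> layer n (Suc j)" using insert.prems by blast
    have VX: "V \<subseteq> layer n (Suc j)" using insert.prems by blast
    let ?r = "\<lambda>x y. shad x \<inter> shad y \<noteq> {}"
    let ?K = "{S. S \<subseteq> layer n (Suc j) \<and> conn_from ?r s S}"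
    have finU: "finite (C \<union> V)" using C VX finite_layer finite_subset by blast
    have sU: "s \<notin> C \<union> V" 
      using insert.hyps(2) C sX layer_disj[of s n j "Suc j"] by auto
    have "antichain_Z (insert s (C \<union> V)) lam \<le>
      (1 + (\<Sum>K\<in>?K. lam ^ card K / (1 + lam) ^ card (g.NS K))) * antichain_Z (C \<union> V) lam"
    proof (rule antichain_Z_insert_le[OF finU sU lam])
      show "finite ?K" by (rule finite_subset[of _ "Pow (layer n (Suc j))"]) (use finite_layer in auto)
      fix \<A> assume \<A>: "\<A> \<subseteq> insert s (C \<union> V)" "antichain \<A>" "s \<in> \<A>"
      have ac: "a = b" if "a \<in> \<A>" "b \<in> \<A>" "a \<subseteq> b" for a b
        using \<A>(2) that unfolding antichain_iff by blast
      have "finite (\<A> \<inter> layer n (Suc j))" using finite_layer by blast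
      moreover have "s \<in> \<A> \<inter> layer n (Suc j)" using \<A> sX by blast
      moreover have "shad x \<inter> shad y \<noteq> {} \<Longrightarrow> shad y \<inter> shad x \<noteq> {}" for x y :: "nat set" by blast
      ultimately obtain K where K: "K \<subseteq> \<A> \<inter> layer n (Suc j)" "conn_from ?r s K"
        "\<And>x y. x \<in> K \<Longrightarrow> y \<in> \<A> \<inter> layer n (Suc j) - K \<Longrightarrow> \<not> ?r x y"
        using component_exists[where r = ?r and S = "\<A> \<inter> layer n (Suc j)" and s = s] by metis
      have sK: "s \<in> K" using K(2) by (simp add: conn_from_def)
      have disj: "y \<notin> layer n (Suc j)" if "y \<in> C" for y
        using that C layer_disj[of y n j "Suc j"] by auto
      have KV: "K \<subseteq> insert s V" using K(1) \<A>(1) disj by blast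
      have NSC: "g.NS K \<subseteq> C" using KV insert.prems(2) unfolding g.NS_def by blast
      have NSK: "\<exists>z\<in>K. y \<in> shad z" if "y \<in> g.NS K" for y using that by (auto simp: g.NS_def)
      have empty: "\<A> \<inter> g.NS K = {}"
      proof (rule ccontr)
        assume "\<A> \<inter> g.NS K \<noteq> {}"
        then obtain y z where yz: "y \<in> \<A>" "z \<in> K" "y \<in> shad z" using NSK by blast
        then have zX: "z \<in> layer n (Suc j)" "z \<in> \<A>" using K(1) by auto
        have "y \<in> layer n j" "y \<subseteq> z" using yz(3) shad_layer[OF zX(1)] by auto
        then have "y = z" using ac yz zX by blast
        then show False using \<open>y \<in> layer n j\<close> zX layer_disj[of z n j "Suc j"] by simp
      qed
      have "antichain ((\<A> - K) \<union> E)" if E: "E \<subseteq> g.NS K" for E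
        unfolding antichain_iff
      proof (intro ballI impI)
        fix a b assume ab: "a \<in> (\<A> - K) \<union> E" "b \<in> (\<A> - K) \<union> E" "a \<subseteq> b"
        have layers: "x \<in> layer n j \<or> x \<in> layer n (Suc j)" if "x \<in> (\<A> - K) \<union> E" for x
          using that E NSC C \<A>(1) insert.prems(1) by blast
        show "a = b"
        proof (cases "b \<in> E")
          case True
          then have b: "b \<in> layer n j" using E NSC C by blast
          have "card b \<le> card a" 
            using layers[OF ab(1)] layerD(2)[OF b] layerD(2)[of a n j] layerD(2)[of a n "Suc j"] by auto
          then show ?thesis using layer_sub_eq[OF b _ ab(3)] by simp
        next
          case bE: False
          then have b: "b \<in> \<A>" "b \<notin> K" using ab(2) by auto
          show ?thesis
          proof (cases "a \<in> E")
            case True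
            then obtain z where z: "z \<in> K" "a \<in> shad z" using E NSK by blast
            have a: "a \<in> layer n j" using True E NSC C by blast
            show ?thesis
            proof (cases "b \<in> layer n j")
              case True
              then show ?thesis 
                using layer_sub_eq[OF True _ ab(3)] layerD(2)[OF a] layerD(2)[OF True] by simp
            next
              case False
              then have bX: "b \<in> layer n (Suc j)" using layers[OF ab(2)] by blast
              then have "a \<in> shad b" using shad_layer a ab(3) by blast
              then have "?r z b" using z by blast
              then show ?thesis using K(3)[OF z(1), of b] b bX by blast
            qed
          next
            case False
            then show ?thesis using ab ac b by blast
          qed
        qed
      qed
      then show "\<exists>K\<in>?K. s \<in> K \<and> K \<subseteq> \<A> \<and> g.NS K \<subseteq> C \<union> V \<and> \<A> \<inter> g.NS K = {} \<and>
          (\<forall>E\<subseteq>g.NS K. antichain ((\<A> - K) \<union> E))"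
        using K(1,2) sK NSC empty by (intro bexI[of _ K]) auto
    qed
    also have "\<dots> \<le> (1 + \<epsilon>) * antichain_Z (C \<union> V) lam"
    proof (rule mult_right_mono)
      show "0 \<le> antichain_Z (C \<union> V) lam" unfolding antichain_Z_def using lam by (intro sum_nonneg) auto
    qed (use \<epsilon>[of s] in simp)
    also have "\<dots> \<le> (1 + \<epsilon>) * ((1 + \<epsilon>) ^ card V * (1 + lam) ^ card C)"
      using insert.IH[OF VX] insert.prems(2) \<epsilon>0 by (intro mult_left_mono) auto
    finally show ?case using insert.hyps by simp
  qed
qed

section \<open>Inserting an element of size \<open>j + 2\<close> above layers \<open>j + 1\<close>
  and \<open>j\<close>\<close>

locale three_layers =
  fixes n j :: nat and lam :: real
  assumes nj: "n \<le> 2 * j" and j_ge: "100 \<le> j" and lam0: "0 \<le> lam"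
    and lam_g: "exp (1000 * ln (real (Suc j)) ^ 2 / sqrt (real (Suc j))) \<le> 1 + lam"
    and large_g: "4900 + 10000 * ln (real (Suc j)) \<le> 750 * sqrt (real (Suc j))"
    and lam_h: "exp (1000 * ln (real (Suc (Suc j))) ^ 2 / sqrt (real (Suc (Suc j)))) \<le> 1 + lam"
    and large_h: "4900 + 10000 * ln (real (Suc (Suc j))) \<le> 750 * sqrt (real (Suc (Suc j)))"
begin

sublocale g: c4_free "layer n (Suc j)" "layer n j" shad "Suc j"
  by (rule c4_free_layers) (use nj j_ge in auto)

sublocale h: c4_free "layer n (Suc (Suc j))" "layer n (Suc j)" shad "Suc (Suc j)"
  by (rule c4_free_layers) (use nj j_ge in auto)

text \<open>The adjacent-layer bound of \<open>single_sum\<close> for the graph \<open>h\<close>,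
  whose upper degree is \<open>j + 2\<close>.\<close>

definition \<delta> :: real where
  "\<delta> = 4 * real (Suc (Suc j)) ^ 3 * exp (- (800 * ln (real (Suc (Suc j))) ^ 3))"

lemma \<delta>_nonneg: "0 \<le> \<delta>" by (simp add: \<delta>_def)

lemma \<delta>_le: "\<delta> * real (Suc j) ^ 2 \<le> 1000"
proof -
  define d where "d = real (Suc (Suc j))"
  define L where "L = ln d"
  have d: "10 \<le> d" using j_ge by (simp add: d_def)
  have L: "1 \<le> L" using h.L_ge unfolding h.L_def L_def d_def .
  have dL: "exp L = d" using d by (simp add: L_def)
  have "1 \<le> L ^ 2" using L by simp
  then have "L * 1 \<le> L * L ^ 2" using L by (intro mult_left_mono) auto
  then have L3: "L \<le> L ^ 3" by (simp add: power3_eq_cube power2_eq_square)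
  have "exp (- (800 * L ^ 3)) \<le> exp (- (6 * L))" using L L3 by simp
  also have "\<dots> = 1 / d ^ 6"
  proof -
    have "exp (6 * L) = d ^ 6" using exp_of_nat_mult[of 6 L] dL by simp
    then show ?thesis by (simp add: exp_minus inverse_eq_divide)
  qed
  finally have e: "exp (- (800 * L ^ 3)) \<le> 1 / d ^ 6" .
  have "\<delta> * real (Suc j) ^ 2 \<le> (4 * d ^ 3 * (1 / d ^ 6)) * d ^ 2"
    unfolding \<delta>_def d_def[symmetric] L_def[symmetric] using e d
    by (intro mult_mono mult_left_mono power_mono) (auto simp: d_def)
  also have "\<dots> = 4 / d"
    using d by (simp add: field_simps power_def numeral_eq_Suc)
  also have "\<dots> \<le> 1000" using d by (simp add: field_simps)
  finally show ?thesis .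
qed

lemma card_upper_le:
  assumes C: "C \<subseteq> layer n (Suc j)" and V: "V \<subseteq> layer n (Suc (Suc j))" "\<And>x. x \<in> V \<Longrightarrow> shad x \<subseteq> C"
  shows "card V \<le> card C"
proof -
  have finC: "finite C" using C finite_layer finite_subset by blast
  have "(\<Sum>x\<in>V. card (shad x \<inter> C)) = (\<Sum>y\<in>C. card (h.M y \<inter> V))"
    by (rule h.count_edges[OF V(1) finC])
  moreover have "(\<Sum>x\<in>V. card (shad x \<inter> C)) = (\<Sum>x\<in>V. Suc (Suc j))"
  proof (intro sum.cong refl)
    fix x assume x: "x \<in> V"
    have "shad x \<inter> C = shad x" using V(2)[OF x] by blast
    moreover have "card (shad x) = Suc (Suc j)" using V(1) x by (intro h.card_N) blast
    ultimately show "card (shad x \<inter> C) = Suc (Suc j)" by simp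
  qed
  moreover have "(\<Sum>y\<in>C. card (h.M y \<inter> V)) \<le> (\<Sum>y\<in>C. Suc (Suc j))"
  proof (rule sum_mono)
    fix y assume "y \<in> C"
    then have "card (h.M y) < Suc (Suc j)" using C by (intro h.card_M_less) blast
    moreover have "card (h.M y \<inter> V) \<le> card (h.M y)" by (intro card_mono) auto
    ultimately show "card (h.M y \<inter> V) \<le> Suc (Suc j)" by linarith
  qed
  ultimately have "Suc (Suc j) * card V \<le> Suc (Suc j) * card C" by (simp add: mult.commute)
  then show ?thesis by (simp only: Suc_mult_le_cancel1)
qed

text \<open>Supplies the hypothesis \<open>weight\<close> of \<open>polymer_sum\<close>. By double
  counting, at most \<open>card C\<close> sets of size \<open>j + 2\<close> have their whole shadow
  in \<open>C\<close>, so a factor \<open>1 + \<delta>\<close> for each becomes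
  \<open>exp (\<delta> * card C)\<close>.\<close>

lemma pair_weight:
  assumes C: "C \<subseteq> layer n (Suc j)"
  shows "antichain_Z (C \<union> {z\<in>layer n (Suc (Suc j)). shad z \<subseteq> C}) lam \<le>
    (1 + lam) ^ card C * exp (\<delta> * real (card C))"
proof -
  let ?V = "{z\<in>layer n (Suc (Suc j)). shad z \<subseteq> C}"
  have "antichain_Z (C \<union> ?V) lam \<le> (1 + \<delta>) ^ card ?V * (1 + lam) ^ card C"
  proof (rule antichain_Z_two_layers[OF h.c4_free_axioms lam0 \<delta>_nonneg _ C])
    show "(\<Sum>S\<in>{S. S \<subseteq> layer n (Suc (Suc j)) \<and> conn_from (\<lambda>x y. shad x \<inter> shad y \<noteq> {}) v S}.
        lam ^ card S / (1 + lam) ^ card (h.NS S)) \<le> \<delta>" for v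
      by (rule h.single_sum[OF lam0 lam_h[folded h.L_def] large_h[folded h.L_def], of v,
            unfolded h.L_def \<delta>_def[symmetric]])
  qed auto
  also have "\<dots> \<le> exp (\<delta> * real (card C)) * (1 + lam) ^ card C"
  proof (rule mult_right_mono)
    have "(1 + \<delta>) ^ card ?V \<le> exp \<delta> ^ card ?V"
      using \<delta>_nonneg exp_ge_add_one_self[of \<delta>] by (intro power_mono) linarith+
    also have "\<dots> \<le> exp \<delta> ^ card C"
    proof (rule power_increasing)
      show "card ?V \<le> card C" by (rule card_upper_le[OF C]) auto
      show "1 \<le> exp \<delta>" using \<delta>_nonneg by simp
    qed
    also have "\<dots> = exp (\<delta> * real (card C))"
      unfolding mult.commute[of \<delta>] by (rule exp_of_nat_mult[symmetric])
    finally show "(1 + \<delta>) ^ card ?V \<le> exp (\<delta> * real (card C))" .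
  qed (use lam0 in simp)
  finally show ?thesis by (simp add: mult.commute)
qed

text \<open>The shadow of a set of size \<open>j + 1\<close> and the second shadow of one of size
  \<open>j + 2\<close>: one formula for both kinds of members of a polymer.\<close>

definition shad2 :: "nat set \<Rightarrow> nat set set" where "shad2 z = {y\<in>layer n j. y \<subseteq> z}"

lemma card_shad2:
  assumes "s \<in> layer n (Suc (Suc j))"
  shows "real (Suc j) ^ 2 / 2 \<le> real (card (shad2 s))"
proof -
  have "shad2 s = {y. y \<subseteq> s \<and> card y = j}"
    using assms by (auto simp: shad2_def layer_def)
  then have "card (shad2 s) = Suc (Suc j) choose j"
    using n_subsets[OF layerD(1)[OF assms], of j] layerD(2)[OF assms] by simp
  also have "\<dots> = Suc (Suc j) choose 2"
    using binomial_symmetric[of j "Suc (Suc j)"] by (simp add: numeral_2_eq_2)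
  finally have "2 * card (shad2 s) = Suc (Suc j) * Suc j"
    by (simp add: choose_two)
  then have "2 * real (card (shad2 s)) = real (Suc (Suc j)) * real (Suc j)"
    by (metis of_nat_mult of_nat_numeral)
  moreover have "real (Suc j) * real (Suc j) \<le> real (Suc (Suc j)) * real (Suc j)"
    by (intro mult_right_mono) auto
  ultimately have "real (Suc j) * real (Suc j) \<le> 2 * real (card (shad2 s))" by linarith
  then show ?thesis unfolding power2_eq_square by linarith
qed

text \<open>The second shadow of \<open>s\<close> puts about \<open>(j + 1) ^ 2 / 2\<close> vertices
  into the neighbourhood. A \<open>(j + 1)\<close>-set above two of them is their union and hence in
  \<open>shad s\<close>, and each has at most two upper neighbours there, so
  \<open>t_ge_of_spread\<close> applies with \<open>Z = shad s\<close> and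
  \<open>c = 2\<close>.\<close>

lemma t_large:
  assumes s: "s \<in> layer n (Suc (Suc j))" and v: "v \<in> shad s"
    and A: "c4_free_closed (layer n (Suc j)) (layer n j) shad (Suc j) A v" and sub: "shad s \<subseteq> A"
  shows "Suc j ^ 2 div 16 \<le> c4_free_closed.t shad A"
proof -
  interpret c: c4_free_closed "layer n (Suc j)" "layer n j" shad "Suc j" A v by fact
  define d where "d = real (Suc j)"
  have d: "100 \<le> d" using j_ge by (simp add: d_def)
  have shadX: "x \<in> layer n (Suc j) \<and> x \<subseteq> s" if "x \<in> shad s" for x
    using that shad_layer[OF s] by blast
  have P: "shad2 s \<subseteq> c.G"
  proof
    fix y assume "y \<in> shad2 s"
    then have y: "y \<in> layer n j" "y \<subseteq> s" by (auto simp: shad2_def)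
    then have "card (s - y) = 2" using layerD[OF s] layerD[OF y(1)] by (simp add: card_Diff_subset)
    then obtain i where i: "i \<in> s" "i \<notin> y" by (metis Diff_iff card.empty ex_in_conv zero_neq_numeral)
    define x where "x = insert i y"
    have "card x = Suc j" using i layerD[OF y(1)] by (simp add: x_def)
    then have "x \<in> layer n (Suc j)" "x \<subseteq> s" using i y layerD(3)[OF s] by (auto simp: x_def layer_def)
    then have "x \<in> shad s" using shad_layer[OF s] by blast
    then have "x \<in> A" using sub by blast
    moreover have "y \<in> shad x" using shad_layer[OF \<open>x \<in> layer n (Suc j)\<close>] y by (auto simp: x_def)
    ultimately show "y \<in> c.G" unfolding c.G_def g.NS_def by blast
  qed
  have disj: "disjoint_family_on (\<lambda>y. g.M y \<inter> A - shad s) (shad2 s)"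
    unfolding disjoint_family_on_def
  proof (intro ballI impI)
    fix y y' assume y: "y \<in> shad2 s" "y' \<in> shad2 s" "y \<noteq> y'"
    have yl: "y \<in> layer n j" "y \<subseteq> s" "y' \<in> layer n j" "y' \<subseteq> s" using y by (auto simp: shad2_def)
    have "x \<in> shad s" if x: "x \<in> g.M y" "x \<in> g.M y'" for x
    proof -
      have xl: "x \<in> layer n (Suc j)" using x by (simp add: g.M_def)
      have sub: "y \<subseteq> x" "y' \<subseteq> x" using x shad_layer[OF xl] by (auto simp: g.M_def)
      have "y \<union> y' \<noteq> y"
      proof
        assume "y \<union> y' = y"
        then have "y' \<subseteq> y" by blast
        then show False using layer_sub_eq[OF yl(1), of y'] layerD(2)[OF yl(1)] layerD(2)[OF yl(3)] y(3) by simp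
      qed
      then have "card y < card (y \<union> y')"
        using layerD(1)[OF yl(1)] layerD(1)[OF yl(3)] by (intro psubset_card_mono) auto
      then have "card x \<le> card (y \<union> y')" using layerD(2)[OF yl(1)] layerD(2)[OF xl] by simp
      then have "y \<union> y' = x" using layer_sub_eq[OF xl, of "y \<union> y'"] sub by simp
      then have "x \<subseteq> s" using yl by blast
      then show ?thesis using xl shad_layer[OF s] by blast
    qed
    then show "(g.M y \<inter> A - shad s) \<inter> (g.M y' \<inter> A - shad s) = {}" by blast
  qed
  have two: "card (g.M y \<inter> shad s) \<le> 2" if "y \<in> shad2 s" for y
  proof -
    have y: "y \<in> layer n j" "y \<subseteq> s" using that by (auto simp: shad2_def)
    have "g.M y \<inter> shad s \<subseteq> (\<lambda>i. insert i y) ` (s - y)"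
    proof
      fix x assume x: "x \<in> g.M y \<inter> shad s"
      then obtain i where "i \<in> x" "y = x - {i}" by (auto simp: g.M_def shad_def)
      moreover have "x \<subseteq> s" using x shadX by blast
      ultimately have "x = insert i y" "i \<in> s - y" by auto
      then show "x \<in> (\<lambda>i. insert i y) ` (s - y)" by blast
    qed
    moreover have fin: "finite (s - y)" using layerD(1)[OF s] by simp
    ultimately have "card (g.M y \<inter> shad s) \<le> card ((\<lambda>i. insert i y) ` (s - y))"
      by (intro card_mono) auto
    also have "\<dots> \<le> card (s - y)" using fin by (rule card_image_le)
    also have "\<dots> = 2" using y layerD[OF s] layerD[OF y(1)] by (simp add: card_Diff_subset)
    finally show ?thesis .
  qed
  have "real (card (shad2 s)) \<le> 4 * real c.t \<or>
      real (card (shad2 s)) * (real (Suc j) / 2 - real 2) \<le> 2 * real c.t * real (Suc j)"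
    by (rule c.t_ge_of_spread[OF P disj two])
  then have "d ^ 2 / 16 \<le> real c.t"
  proof
    assume "real (card (shad2 s)) \<le> 4 * real c.t"
    then have "d ^ 2 / 2 \<le> 4 * real c.t" using card_shad2[OF s] by (simp add: d_def)
    then show ?thesis by simp
  next
    assume a: "real (card (shad2 s)) * (real (Suc j) / 2 - real 2) \<le> 2 * real c.t * real (Suc j)"
    have "d ^ 2 / 2 * (d / 2 - 2) \<le> real (card (shad2 s)) * (d / 2 - 2)"
      using card_shad2[OF s] d by (intro mult_right_mono) (auto simp: d_def)
    also have "\<dots> \<le> 2 * real c.t * d" using a by (simp add: d_def)
    finally have "d * (d / 4 * (d / 2 - 2)) \<le> d * real c.t"
      by (simp add: power2_eq_square algebra_simps)
    then have "d / 4 * (d / 2 - 2) \<le> real c.t" using d by (subst (asm) mult_le_cancel_left_pos) auto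
    moreover have "d / 4 * (d / 4) \<le> d / 4 * (d / 2 - 2)" using d by (intro mult_left_mono) auto
    ultimately show ?thesis by (simp add: power2_eq_square)
  qed
  moreover have "real (Suc j ^ 2 div 16) \<le> d ^ 2 / 16"
  proof -
    have "16 * (Suc j ^ 2 div 16) \<le> Suc j ^ 2" by simp
    then have "real (16 * (Suc j ^ 2 div 16)) \<le> real (Suc j ^ 2)" by (rule of_nat_mono)
    then have "16 * real (Suc j ^ 2 div 16) \<le> d ^ 2"
      by (simp only: of_nat_mult of_nat_power of_nat_numeral d_def)
    then show ?thesis by linarith
  qed
  ultimately have "real (Suc j ^ 2 div 16) \<le> real c.t" by linarith
  then show ?thesis by simp
qed

definition link2 :: "nat set \<Rightarrow> nat set \<Rightarrow> bool" where "link2 z z' \<longleftrightarrow> shad2 z \<inter> shad2 z' \<noteq> {}"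

text \<open>Turns a two-layer polymer into upper vertices of the graph \<open>g\<close> with the
  same \<open>j\<close>-shadow (\<open>NS_base\<close>), to which containers apply.\<close>

definition base :: "nat set set \<Rightarrow> nat set set" where
  "base K = {x\<in>layer n (Suc j). \<exists>z\<in>K. x \<subseteq> z}"

definition top :: "nat set set" where "top = layer n (Suc j) \<union> layer n (Suc (Suc j))"

lemma exists_between:
  assumes "z \<in> top" "y \<in> shad2 z"
  obtains x where "x \<in> layer n (Suc j)" "x \<subseteq> z" "y \<in> shad x"
proof -
  have y: "y \<in> layer n j" "y \<subseteq> z" using assms by (auto simp: shad2_def)
  consider "z \<in> layer n (Suc j)" | "z \<in> layer n (Suc (Suc j))" using assms by (auto simp: top_def)
  then show thesis
  proof cases
    case 1
    then show ?thesis using that[of z] y shad_layer by blast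
  next
    case 2
    then have "card (z - y) = 2" using layerD[OF 2] layerD[OF y(1)] y by (simp add: card_Diff_subset)
    then obtain i where i: "i \<in> z" "i \<notin> y" by (metis Diff_iff card.empty ex_in_conv zero_neq_numeral)
    have "card (insert i y) = Suc j" using i layerD[OF y(1)] by simp
    then have x: "insert i y \<in> layer n (Suc j)" "insert i y \<subseteq> z"
      using i y layerD(3)[OF 2] by (auto simp: layer_def)
    moreover have "y \<in> shad (insert i y)" using shad_layer[OF x(1)] y by auto
    ultimately show ?thesis using that by blast
  qed
qed

lemma NS_base:
  assumes "K \<subseteq> top" shows "g.NS (base K) = (\<Union>z\<in>K. shad2 z)"
proof
  show "g.NS (base K) \<subseteq> (\<Union>z\<in>K. shad2 z)"
  proof
    fix y assume "y \<in> g.NS (base K)"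
    then obtain x z where x: "x \<in> layer n (Suc j)" "z \<in> K" "x \<subseteq> z" "y \<in> shad x"
      by (auto simp: g.NS_def base_def)
    then have "y \<in> layer n j" "y \<subseteq> z" using shad_layer[OF x(1)] by auto
    then show "y \<in> (\<Union>z\<in>K. shad2 z)" using x(2) by (auto simp: shad2_def)
  qed
  show "(\<Union>z\<in>K. shad2 z) \<subseteq> g.NS (base K)"
  proof
    fix y assume "y \<in> (\<Union>z\<in>K. shad2 z)"
    then obtain z where z: "z \<in> K" "y \<in> shad2 z" by blast
    then obtain x where "x \<in> layer n (Suc j)" "x \<subseteq> z" "y \<in> shad x"
      using exists_between[of z y] assms by blast
    then show "y \<in> g.NS (base K)" using z(1) by (auto simp: g.NS_def base_def)
  qed
qed

text \<open>The \<open>(j + 1)\<close>-subsets of one \<open>(j + 2)\<close>-set are pairwise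
  linked. So a cut of the base either splits the subsets of a single \<open>z\<close> and is crossed
  there, or comes from a cut of \<open>K\<close> and is crossed at a shared
  \<open>j\<close>-subset.\<close>

lemma conn_base:
  assumes K: "K \<subseteq> top" and conn: "conn_from link2 s K" and s: "s \<in> layer n (Suc (Suc j))"
    and v: "v \<in> shad s"
  shows "conn_from g.link v (base K)"
  unfolding conn_from_def
proof (intro conjI allI impI)
  have sK: "s \<in> K" using conn by (simp add: conn_from_def)
  have "v \<in> layer n (Suc j)" "v \<subseteq> s" using v shad_layer[OF s] by auto
  then show vB: "v \<in> base K" using sK by (auto simp: base_def)
  fix W0 assume W0: "v \<in> W0 \<and> W0 \<subset> base K"
  define f where "f = (\<lambda>z. {x\<in>layer n (Suc j). x \<subseteq> z})"
  have fB: "f z \<subseteq> base K" if "z \<in> K" for z using that by (auto simp: f_def base_def)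
  show "\<exists>x\<in>W0. \<exists>y\<in>base K - W0. g.link x y"
  proof (cases "\<exists>z\<in>K. \<exists>x\<in>f z \<inter> W0. \<exists>y\<in>f z. y \<notin> W0")
    case True
    then obtain z x y where zxy: "z \<in> K" "x \<in> f z" "x \<in> W0" "y \<in> f z" "y \<notin> W0" by blast
    then have l: "x \<in> layer n (Suc j)" "y \<in> layer n (Suc j)" "x \<subseteq> z" "y \<subseteq> z" by (auto simp: f_def)
    have "g.link x y"
    proof (cases "z \<in> layer n (Suc j)")
      case True
      then have "x = z" "y = z"
        using layer_sub_eq[OF True, of x] layer_sub_eq[OF True, of y] l layerD(2) by auto
      then show ?thesis using zxy by simp
    next
      case False
      then have z: "z \<in> layer n (Suc (Suc j))" using zxy(1) K by (auto simp: top_def)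
      have "x \<in> shad z" "y \<in> shad z" using shad_layer[OF z] l by auto
      then obtain i i' where i: "x = z - {i}" "y = z - {i'}" "i \<in> z" "i' \<in> z" by (auto simp: shad_def)
      have "i \<noteq> i'" using i zxy by auto
      have "z - {i} - {i'} \<in> shad x" using i \<open>i \<noteq> i'\<close> by (auto simp: shad_def)
      moreover have "z - {i} - {i'} = y - {i}" using i by auto
      moreover have "y - {i} \<in> shad y" using i \<open>i \<noteq> i'\<close> by (auto simp: shad_def)
      ultimately show ?thesis by auto
    qed
    then show ?thesis using zxy fB by blast
  next
    case False
    define K0 where "K0 = {z\<in>K. f z \<subseteq> W0}"
    have whole: "f z \<subseteq> W0 \<or> f z \<inter> W0 = {}" if "z \<in> K" for z using False that by blast
    have "v \<in> f s" using v shad_layer[OF s] by (auto simp: f_def)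
    then have s0: "s \<in> K0" using whole[OF sK] W0 sK unfolding K0_def by blast
    obtain b where b: "b \<in> base K" "b \<notin> W0" using W0 by blast
    then obtain z where "z \<in> K" "b \<in> f z" by (auto simp: base_def f_def)
    then have "K0 \<noteq> K" using b by (auto simp: K0_def)
    moreover have "K0 \<subseteq> K" by (auto simp: K0_def)
    ultimately obtain z z' where z: "z \<in> K0" "z' \<in> K" "z' \<notin> K0" "link2 z z'"
      using conn_fromD[OF conn s0] by metis
    then obtain y where y: "y \<in> shad2 z" "y \<in> shad2 z'" by (auto simp: link2_def)
    have zt: "z \<in> top" "z' \<in> top" using z K by (auto simp: K0_def)
    obtain x where x: "x \<in> layer n (Suc j)" "x \<subseteq> z" "y \<in> shad x" using exists_between[OF zt(1) y(1)] by blast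
    obtain x' where x': "x' \<in> layer n (Suc j)" "x' \<subseteq> z'" "y \<in> shad x'" using exists_between[OF zt(2) y(2)] by blast
    have "x \<in> W0" using x z(1) by (auto simp: K0_def f_def)
    moreover have "x' \<in> base K" using x' z(2) by (auto simp: base_def)
    moreover have "x' \<notin> W0"
    proof
      assume "x' \<in> W0"
      moreover have "x' \<in> f z'" using x' by (auto simp: f_def)
      ultimately have "f z' \<subseteq> W0" using whole[OF z(2)] by blast
      then show False using z(2,3) by (auto simp: K0_def)
    qed
    moreover have "g.link x x'" using x x' by blast
    ultimately show ?thesis by blast
  qed
qed

definition polymers :: "nat set \<Rightarrow> nat set set set" where
  "polymers s = {K. K \<subseteq> top \<and> antichain K \<and> conn_from link2 s K}"

definition \<epsilon> :: real where
  "\<epsilon> = 4 * real (Suc j) ^ 3 * exp (- (4000 * real (Suc j ^ 2 div 16) * ln (real (Suc j)) ^ 3 / real (Suc j)))"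

lemma finite_top: "finite top" unfolding top_def using finite_layer by blast

lemma finite_polymers: "finite (polymers s)"
  by (rule finite_subset[of _ "Pow top"]) (use finite_top in \<open>auto simp: polymers_def\<close>)

text \<open>A polymer with base inside \<open>C\<close> is an antichain of members of
  \<open>C\<close> and sets whose shadow lies in \<open>C\<close>, so \<open>pair_weight\<close>
  bounds the weight per container. The quadratic \<open>\<tau>0\<close> comes from
  \<open>t_large\<close>.\<close>

lemma polymer_weight:
  assumes s: "s \<in> layer n (Suc (Suc j))"
  shows "(\<Sum>K\<in>polymers s. lam ^ card K / (1 + lam) ^ card (\<Union>z\<in>K. shad2 z)) \<le> \<epsilon>"
proof -
  have "shad s \<noteq> {}" using card_shad[of s] layerD(2)[OF s] by auto
  then obtain v where v: "v \<in> shad s" by blast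
  have Ktop: "K \<subseteq> top" and Kconn: "conn_from link2 s K" if "K \<in> polymers s" for K
    using that by (auto simp: polymers_def)
  have baseX: "base K \<subseteq> layer n (Suc j)" for K by (auto simp: base_def)
  have "(\<Sum>K\<in>polymers s. lam ^ card K / (1 + lam) ^ card (g.NS (base K))) \<le>
    4 * real (Suc j) ^ 3 * exp (- (4000 * real (Suc j ^ 2 div 16) * g.L ^ 3 / real (Suc j)))"
  proof (rule g.polymer_sum[where \<delta> = \<delta> and B = base and w = "\<lambda>K. lam ^ card K" and v = v])
    show "finite (polymers s)" by (rule finite_polymers)
    show "base K \<subseteq> layer n (Suc j)" for K by (rule baseX)
    show "conn_from g.link v (base K)" if "K \<in> polymers s" for K
      by (rule conn_base[OF Ktop[OF that] Kconn[OF that] s v])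
    show "0 \<le> lam ^ card K" for K :: "nat set set" using lam0 by simp
    show "0 \<le> \<delta>" by (rule \<delta>_nonneg)
    show "\<delta> * real (Suc j) ^ 2 \<le> 1000" by (rule \<delta>_le)
    show "exp (1000 * g.L ^ 2 / sqrt (real (Suc j))) \<le> 1 + lam" unfolding g.L_def by (rule lam_g)
    show "4900 + 10000 * g.L \<le> 750 * sqrt (real (Suc j))" unfolding g.L_def by (rule large_g)
    show "Suc j \<le> 5 * (Suc j ^ 2 div 16)"
    proof -
      have "16 * Suc j \<le> Suc j * Suc j" using j_ge by (intro mult_right_mono) auto
      then have "16 * Suc j \<le> Suc j ^ 2" by (simp only: power2_eq_square)
      then have "16 * Suc j div 16 \<le> Suc j ^ 2 div 16" by (rule div_le_mono)
      then show ?thesis by simp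
    qed
    show "card (g.ncl (base K)) + Suc j ^ 2 div 16 \<le> card (g.NS (base K))" if K: "K \<in> polymers s" for K
    proof -
      note conn = conn_base[OF Ktop[OF K] Kconn[OF K] s v]
      note cl = g.closed_ncl[OF baseX conn]
      interpret c: c4_free_closed "layer n (Suc j)" "layer n j" shad "Suc j" "g.ncl (base K)" v
        by (rule cl(1))
      have "s \<in> K" using Kconn[OF K] by (simp add: conn_from_def)
      then have "shad s \<subseteq> base K" using shad_layer[OF s] by (auto simp: base_def)
      then have "shad s \<subseteq> g.ncl (base K)" using cl(3) by blast
      then have "Suc j ^ 2 div 16 \<le> c.t" by (rule t_large[OF s v cl(1)])
      moreover have "card (g.NS (base K)) = card (g.ncl (base K)) + c.t"
        using c.card_G cl(2) by (simp add: c.G_def)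
      ultimately show ?thesis by simp
    qed
    show "(\<Sum>K\<in>{K\<in>polymers s. base K \<subseteq> C}. lam ^ card K) \<le> (1 + lam) ^ card C * exp (\<delta> * real (card C))"
      if C: "C \<subseteq> layer n (Suc j)" for C
    proof -
      let ?U = "C \<union> {z\<in>layer n (Suc (Suc j)). shad z \<subseteq> C}"
      have "finite ?U" using C finite_layer[of n "Suc j"] finite_layer[of n "Suc (Suc j)"]
        by (auto intro: finite_subset)
      then have fin: "finite {\<A>. \<A> \<subseteq> ?U \<and> antichain \<A>}" by (rule finite_antichains)
      have "(\<Sum>K\<in>{K\<in>polymers s. base K \<subseteq> C}. lam ^ card K) \<le> antichain_Z ?U lam"
        unfolding antichain_Z_def
      proof (rule sum_mono2[OF fin])
        show "{K\<in>polymers s. base K \<subseteq> C} \<subseteq> {\<A>. \<A> \<subseteq> ?U \<and> antichain \<A>}"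
        proof
          fix K assume K: "K \<in> {K\<in>polymers s. base K \<subseteq> C}"
          have "z \<in> ?U" if z: "z \<in> K" for z
          proof (cases "z \<in> layer n (Suc j)")
            case True
            then have "z \<in> base K" using z by (auto simp: base_def)
            then show ?thesis using K by blast
          next
            case False
            then have zl: "z \<in> layer n (Suc (Suc j))" using z K by (auto simp: polymers_def top_def)
            have "shad z \<subseteq> base K" using shad_layer[OF zl] z by (auto simp: base_def)
            then show ?thesis using K zl by blast
          qed
          then show "K \<in> {\<A>. \<A> \<subseteq> ?U \<and> antichain \<A>}" using K by (auto simp: polymers_def)
        qed
        show "0 \<le> lam ^ card K" for K :: "nat set set" using lam0 by simp
      qed
      also have "\<dots> \<le> (1 + lam) ^ card C * exp (\<delta> * real (card C))" by (rule pair_weight[OF C])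
      finally show ?thesis .
    qed
  qed
  also have "(\<Sum>K\<in>polymers s. lam ^ card K / (1 + lam) ^ card (g.NS (base K))) =
      (\<Sum>K\<in>polymers s. lam ^ card K / (1 + lam) ^ card (\<Union>z\<in>K. shad2 z))"
    by (intro sum.cong refl) (simp add: NS_base[OF Ktop])
  finally show ?thesis unfolding \<epsilon>_def g.L_def .
qed

text \<open>Smaller sets in \<open>U\<close> do no harm: a member of \<open>\<A>\<close> below a
  member of \<open>E\<close> would also be below a member of \<open>K\<close>. A member of
  \<open>\<A>\<close> of size \<open>j + 1\<close> or \<open>j + 2\<close> above a member of
  \<open>E\<close> shares it with a member of \<open>K\<close> and thus belongs to the
  component.\<close>

lemma antichain_Z_insert_top:
  assumes s: "s \<in> layer n (Suc (Suc j))" "s \<notin> U" and finU: "finite U"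
    and U: "\<And>x. x \<in> U \<Longrightarrow> x \<subseteq> {1..n} \<and> card x \<le> Suc (Suc j)" and low: "layer n j \<subseteq> U"
  shows "antichain_Z (insert s U) lam \<le> (1 + \<epsilon>) * antichain_Z U lam"
proof -
  let ?R = "\<lambda>K. \<Union>z\<in>K. shad2 z"
  have "antichain_Z (insert s U) lam \<le>
      (1 + (\<Sum>K\<in>polymers s. lam ^ card K / (1 + lam) ^ card (?R K))) * antichain_Z U lam"
  proof (rule antichain_Z_insert_le[OF finU s(2) lam0 finite_polymers])
    fix \<A> assume \<A>: "\<A> \<subseteq> insert s U" "antichain \<A>" "s \<in> \<A>"
    have ac: "a = b" if "a \<in> \<A>" "b \<in> \<A>" "a \<subseteq> b" for a b
      using \<A>(2) that unfolding antichain_iff by blast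
    have "finite (\<A> \<inter> top)" using finite_top by blast
    moreover have "s \<in> \<A> \<inter> top" using \<A> s by (auto simp: top_def)
    moreover have "link2 x y \<Longrightarrow> link2 y x" for x y by (auto simp: link2_def)
    ultimately obtain K where K: "K \<subseteq> \<A> \<inter> top" "conn_from link2 s K"
      "\<And>x y. x \<in> K \<Longrightarrow> y \<in> \<A> \<inter> top - K \<Longrightarrow> \<not> link2 x y"
      using component_exists[where r = link2 and S = "\<A> \<inter> top" and s = s] by metis
    have sK: "s \<in> K" using K(2) by (simp add: conn_from_def)
    have acK: "antichain K" using ac K(1) unfolding antichain_iff by blast
    have R: "y \<in> layer n j \<and> (\<exists>z\<in>K. y \<subseteq> z \<and> y \<noteq> z)" if y: "y \<in> ?R K" for y
    proof -
      obtain z where z: "z \<in> K" "y \<in> layer n j" "y \<subseteq> z" using y by (auto simp: shad2_def)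
      have "z \<in> top" using z K(1) by blast
      then have "z \<noteq> y" using z(2) layer_disj[of y n j "Suc j"] layer_disj[of y n j "Suc (Suc j)"]
        by (auto simp: top_def)
      then show ?thesis using z by blast
    qed
    have "antichain ((\<A> - K) \<union> E)" if E: "E \<subseteq> ?R K" for E
      unfolding antichain_iff
    proof (intro ballI impI)
      fix a b assume ab: "a \<in> (\<A> - K) \<union> E" "b \<in> (\<A> - K) \<union> E" "a \<subseteq> b"
      show "a = b"
      proof (cases "b \<in> E")
        case True
        have bl: "b \<in> layer n j" using R[OF subsetD[OF E True]] by simp
        obtain z where z: "z \<in> K" "b \<subseteq> z" using R[OF subsetD[OF E True]] by auto
        show ?thesis
        proof (cases "a \<in> E")
          case True
          have "a \<in> layer n j" using R[OF subsetD[OF E True]] by simp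
          then show ?thesis using layer_sub_eq[OF bl _ ab(3)] layerD(2)[OF bl] layerD(2)[of a n j] by simp
        next
          case False
          then have "a \<in> \<A>" "a \<notin> K" using ab by auto
          moreover have "z \<in> \<A>" using z K(1) by blast
          ultimately have "a = z" using ac[of a z] ab(3) z(2) by blast
          then show ?thesis using \<open>a \<notin> K\<close> z(1) by blast
        qed
      next
        case bE: False
        then have b: "b \<in> \<A>" "b \<notin> K" using ab by auto
        show ?thesis
        proof (cases "a \<in> E")
          case True
          have al: "a \<in> layer n j" using R[OF subsetD[OF E True]] by simp
          obtain z where z: "z \<in> K" "a \<in> shad2 z" using subsetD[OF E True] by auto
          have bU: "b \<subseteq> {1..n}" "card b \<le> Suc (Suc j)"
            using b \<A>(1) U[of b] s(1) by (auto simp: layer_def)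
          have finb: "finite b" using bU(1) finite_subset by blast
          have "card a \<le> card b" using card_mono[OF finb ab(3)] .
          then have "card b = j \<or> card b = Suc j \<or> card b = Suc (Suc j)"
            using bU(2) layerD(2)[OF al] by linarith
          then have "card b = j \<or> b \<in> top" using bU(1) by (simp add: top_def layer_def)
          then consider "card b = j" | "b \<in> top" by blast
          then show ?thesis
          proof cases
            case 1
            then show ?thesis using card_subset_eq[OF finb ab(3)] layerD(2)[OF al] by simp
          next
            case 2
            have "a \<in> shad2 b" using al ab(3) by (simp add: shad2_def)
            then have "link2 z b" using z(2) by (auto simp: link2_def)
            then show ?thesis using K(3)[OF z(1), of b] b 2 by blast
          qed
        next
          case False
          then show ?thesis using ab ac b by blast
        qed
      qed
    qed
    moreover have "\<A> \<inter> ?R K = {}"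
    proof (rule ccontr)
      assume "\<A> \<inter> ?R K \<noteq> {}"
      then obtain y z where "y \<in> \<A>" "z \<in> K" "y \<subseteq> z" "y \<noteq> z" using R by blast
      then show False using ac[of y z] K(1) by blast
    qed
    moreover have "?R K \<subseteq> U" using R low by blast
    moreover have "K \<in> polymers s" using K(1,2) acK by (auto simp: polymers_def)
    ultimately show "\<exists>K\<in>polymers s. s \<in> K \<and> K \<subseteq> \<A> \<and> ?R K \<subseteq> U \<and> \<A> \<inter> ?R K = {} \<and>
        (\<forall>E\<subseteq>?R K. antichain ((\<A> - K) \<union> E))"
      using sK K(1) by (intro bexI[of _ K]) auto
  qed
  also have "\<dots> \<le> (1 + \<epsilon>) * antichain_Z U lam"
  proof (rule mult_right_mono)
    show "0 \<le> antichain_Z U lam" unfolding antichain_Z_def using lam0 by (intro sum_nonneg) auto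
  qed (use polymer_weight[OF s(1)] in simp)
  finally show ?thesis .
qed

end

section \<open>Peeling all outer layers\<close>

lemma antichain_Z_nonneg: "0 \<le> lam \<Longrightarrow> 0 \<le> antichain_Z U lam"
  unfolding antichain_Z_def by (intro sum_nonneg) auto

lemma antichain_Z_mono:
  assumes "0 \<le> lam" "finite V" "U \<subseteq> V"
  shows "antichain_Z U lam \<le> antichain_Z V lam"
  unfolding antichain_Z_def
  by (rule sum_mono2[OF finite_antichains[OF assms(2)]]) (use assms in auto)

lemma antichain_Z_ge_1:
  fixes U :: "'a set set"
  assumes "0 \<le> lam" "finite U"
  shows "1 \<le> antichain_Z U lam"
proof -
  have "antichain_Z ({} :: 'a set set) lam = 1"
    by (simp add: antichain_Z_def antichain_def cong: conj_cong)
  then show ?thesis using antichain_Z_mono[OF assms, of "{}"] by simp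
qed

lemma antichain_Z_complement:
  assumes "U \<subseteq> Pow T"
  shows "antichain_Z ((\<lambda>A. T - A) ` U) lam = antichain_Z U lam"
proof -
  define c where "c = (\<lambda>A. T - A)"
  have cc: "c (c A) = A" if "A \<in> U" for A using that assms by (auto simp: c_def)
  have inj: "inj_on c U" by (rule inj_on_inverseI[of _ c]) (rule cc)
  have sub_iff: "c a \<subseteq> c b \<longleftrightarrow> b \<subseteq> a" if "a \<in> U" "b \<in> U" for a b
    using that assms by (auto simp: c_def)
  have ac: "antichain (c ` \<A>) \<longleftrightarrow> antichain \<A>" if "\<A> \<subseteq> U" for \<A>
  proof -
    have "c a = c b \<longleftrightarrow> a = b" if "a \<in> \<A>" "b \<in> \<A>" for a b
      using inj that \<open>\<A> \<subseteq> U\<close> by (meson inj_on_def subsetD)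
    moreover have "c a \<subseteq> c b \<longleftrightarrow> b \<subseteq> a" if "a \<in> \<A>" "b \<in> \<A>" for a b
      using sub_iff that \<open>\<A> \<subseteq> U\<close> by blast
    ultimately have "antichain (c ` \<A>) \<longleftrightarrow> (\<forall>a\<in>\<A>. \<forall>b\<in>\<A>. b \<subseteq> a \<longrightarrow> a = b)"
      unfolding antichain_iff by simp
    also have "\<dots> \<longleftrightarrow> antichain \<A>" unfolding antichain_iff by blast
    finally show ?thesis .
  qed
  have img: "{\<A>. \<A> \<subseteq> c ` U \<and> antichain \<A>} = (`) c ` {\<A>. \<A> \<subseteq> U \<and> antichain \<A>}"
  proof
    show "{\<A>. \<A> \<subseteq> c ` U \<and> antichain \<A>} \<subseteq> (`) c ` {\<A>. \<A> \<subseteq> U \<and> antichain \<A>}"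
    proof
      fix \<B> assume "\<B> \<in> {\<A>. \<A> \<subseteq> c ` U \<and> antichain \<A>}"
      then obtain \<A> where "\<A> \<subseteq> U" "\<B> = c ` \<A>" "antichain \<B>" by (auto simp: subset_image_iff)
      then show "\<B> \<in> (`) c ` {\<A>. \<A> \<subseteq> U \<and> antichain \<A>}" using ac by blast
    qed
    show "(`) c ` {\<A>. \<A> \<subseteq> U \<and> antichain \<A>} \<subseteq> {\<A>. \<A> \<subseteq> c ` U \<and> antichain \<A>}"
      using ac by auto
  qed
  have "inj_on ((`) c) {\<A>. \<A> \<subseteq> U \<and> antichain \<A>}"
    by (rule inj_on_subset[OF inj_on_image_Pow[OF inj]]) auto
  then have "antichain_Z (c ` U) lam = (\<Sum>\<A> | \<A> \<subseteq> U \<and> antichain \<A>. lam ^ card (c ` \<A>))"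
    unfolding antichain_Z_def img by (simp add: sum.reindex)
  also have "\<dots> = antichain_Z U lam"
    unfolding antichain_Z_def
  proof (rule sum.cong[OF refl])
    fix \<A> assume "\<A> \<in> {\<A>. \<A> \<subseteq> U \<and> antichain \<A>}"
    then have "card (c ` \<A>) = card \<A>" by (intro card_image inj_on_subset[OF inj]) auto
    then show "lam ^ card (c ` \<A>) = lam ^ card \<A>" by simp
  qed
  finally show ?thesis by (simp add: c_def)
qed

definition band :: "nat \<Rightarrow> nat \<Rightarrow> nat \<Rightarrow> nat set set" where
  "band n a b = {A. A \<subseteq> {1..n} \<and> a \<le> card A \<and> card A \<le> b}"

lemma finite_band: "finite (band n a b)"
  by (rule finite_subset[of _ "Pow {1..n}"]) (auto simp: band_def)

lemma (in three_layers) antichain_Z_add_layer: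
  assumes a: "a \<le> j" and V: "V \<subseteq> layer n (Suc (Suc j))"
  shows "antichain_Z (band n a (Suc j) \<union> V) lam \<le> (1 + \<epsilon>) ^ card V * antichain_Z (band n a (Suc j)) lam"
proof -
  have "finite V" using V finite_layer finite_subset by blast
  then show ?thesis using V
  proof (induction V rule: finite_induct)
    case (insert s V)
    have \<epsilon>0: "0 \<le> \<epsilon>" by (simp add: \<epsilon>_def)
    let ?U = "band n a (Suc j) \<union> V"
    have s: "s \<in> layer n (Suc (Suc j))" and VL: "V \<subseteq> layer n (Suc (Suc j))" using insert.prems by auto
    have "antichain_Z (insert s ?U) lam \<le> (1 + \<epsilon>) * antichain_Z ?U lam"
    proof (rule antichain_Z_insert_top[OF s])
      show "s \<notin> ?U" using insert.hyps s by (auto simp: band_def layer_def)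
      show "finite ?U" using insert.hyps finite_band by blast
      show "x \<subseteq> {1..n} \<and> card x \<le> Suc (Suc j)" if "x \<in> ?U" for x
        using that VL by (auto simp: band_def layer_def)
      show "layer n j \<subseteq> ?U" using a by (auto simp: band_def layer_def)
    qed
    also have "\<dots> \<le> (1 + \<epsilon>) * ((1 + \<epsilon>) ^ card V * antichain_Z (band n a (Suc j)) lam)"
      using insert.IH[OF VL] \<epsilon>0 by (intro mult_left_mono) auto
    finally show ?case using insert.hyps by simp
  qed simp
qed

text \<open>A crude charge of \<open>2 ^ n\<close> insertions for each layer passed, of which there
  are at most \<open>k\<close>; the eventual \<open>\<eta> = (1 / 8) ^ n\<close> can afford
  it.\<close>

lemma antichain_Z_band_le:
  assumes three: "\<And>j. b \<le> Suc j \<Longrightarrow> Suc (Suc j) \<le> n \<Longrightarrow> three_layers n j lam \<and> three_layers.\<epsilon> j \<le> \<eta>"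
    and a: "a < b" and k: "b \<le> k" "k \<le> n" and \<eta>: "0 \<le> \<eta>" and lam: "0 \<le> lam"
  shows "antichain_Z (band n a k) lam \<le> (1 + \<eta>) ^ (k * 2 ^ n) * antichain_Z (band n a b) lam"
  using k
proof (induction k rule: dec_induct)
  case base
  have "1 \<le> (1 + \<eta>) ^ (b * 2 ^ n)" using \<eta> by (intro one_le_power) auto
  from mult_right_mono[OF this antichain_Z_nonneg[OF lam]] show ?case by simp
next
  case (step k)
  obtain j where j: "k = Suc j" using step.hyps(1) a by (cases k) auto
  have "three_layers n j lam" and \<epsilon>: "three_layers.\<epsilon> j \<le> \<eta>"
    using three[of j] step j by auto
  interpret three_layers n j lam by fact
  let ?V = "layer n (Suc (Suc j))"
  have "band n a (Suc k) = band n a (Suc j) \<union> ?V"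
    using step.hyps(1) a j by (auto simp: band_def layer_def)
  then have "antichain_Z (band n a (Suc k)) lam \<le> (1 + \<epsilon>) ^ card ?V * antichain_Z (band n a k) lam"
    using antichain_Z_add_layer[of a ?V] step.hyps(1) a j by simp
  also have "\<dots> \<le> (1 + \<eta>) ^ (2 ^ n) * antichain_Z (band n a k) lam"
  proof (rule mult_right_mono[OF _ antichain_Z_nonneg[OF lam]])
    have "card ?V \<le> card (Pow {1..n})" by (intro card_mono) (auto simp: layer_def)
    then have "card ?V \<le> 2 ^ n" by (simp add: card_Pow)
    have "(1 + \<epsilon>) ^ card ?V \<le> (1 + \<eta>) ^ card ?V" using \<epsilon> by (intro power_mono) (auto simp: \<epsilon>_def)
    also have "\<dots> \<le> (1 + \<eta>) ^ (2 ^ n)" using \<eta> \<open>card ?V \<le> 2 ^ n\<close> by (intro power_increasing) auto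
    finally show "(1 + \<epsilon>) ^ card ?V \<le> (1 + \<eta>) ^ (2 ^ n)" .
  qed
  also have "\<dots> \<le> (1 + \<eta>) ^ (2 ^ n) * ((1 + \<eta>) ^ (k * 2 ^ n) * antichain_Z (band n a b) lam)"
    using step \<eta> by (intro mult_left_mono) auto
  also have "\<dots> = (1 + \<eta>) ^ (Suc k * 2 ^ n) * antichain_Z (band n a b) lam"
    by (simp add: power_add)
  finally show ?case .
qed

lemma band_complement:
  assumes "b \<le> n"
  shows "(\<lambda>A. {1..n} - A) ` band n 0 b = band n (n - b) n"
proof -
  have card: "card ({1..n} - A) = n - card A" "card A \<le> n" if "A \<subseteq> {1..n}" for A
    using that card_mono[OF _ that] by (simp_all add: card_Diff_subset finite_subset)
  show ?thesis
  proof
    show "(\<lambda>A. {1..n} - A) ` band n 0 b \<subseteq> band n (n - b) n"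
      using card by (auto simp: band_def)
    show "band n (n - b) n \<subseteq> (\<lambda>A. {1..n} - A) ` band n 0 b"
    proof
      fix A assume "A \<in> band n (n - b) n"
      then have A: "A \<subseteq> {1..n}" "n - b \<le> card A" by (auto simp: band_def)
      have "{1..n} - A \<in> band n 0 b" using card[OF A(1)] A(2) by (auto simp: band_def)
      moreover have "A = {1..n} - ({1..n} - A)" using A(1) by blast
      ultimately show "A \<in> (\<lambda>A. {1..n} - A) ` band n 0 b" by blast
    qed
  qed
qed

lemma central_layers_band:
  assumes "2 \<le> n"
  shows "central_layers n = band n (n div 2 - 1) ((n + 1) div 2 + 1)"
proof -
  have fl: "\<lfloor>real n / 2\<rfloor> = int (n div 2)"
    by (metis floor_divide_of_nat_eq of_nat_numeral)
  have ce: "\<lceil>real n / 2\<rceil> = int ((n + 1) div 2)"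
  proof (rule ceiling_unique)
    have "2 * ((n + 1) div 2) \<le> n + 1" "n \<le> 2 * ((n + 1) div 2)" by linarith+
    then have "2 * real ((n + 1) div 2) \<le> real n + 1" "real n \<le> 2 * real ((n + 1) div 2)"
      by linarith+
    then show "real_of_int (int ((n + 1) div 2)) - 1 < real n / 2"
      "real n / 2 \<le> real_of_int (int ((n + 1) div 2))" by simp_all
  qed
  show ?thesis
    using assms unfolding central_layers_def band_def boolean_lattice_def fl ce by auto
qed

lemma antichain_Z_boolean_lattice_le:
  assumes n: "4 \<le> n" and lam: "0 \<le> lam" and \<eta>: "0 \<le> \<eta>"
    and three: "\<And>j. n \<le> 2 * j \<Longrightarrow> Suc (Suc j) \<le> n \<Longrightarrow> three_layers n j lam \<and> three_layers.\<epsilon> j \<le> \<eta>"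
  shows "antichain_Z (boolean_lattice n) lam \<le> (1 + \<eta>) ^ (2 * (n * 2 ^ n)) * antichain_Z (central_layers n) lam"
proof -
  \<comment> \<open>\<open>b <= Suc j\<close> amounts to \<open>n <= 2 * j\<close>, so peeling stops
    where the upper degree \<open>j + 1\<close> ceases to exceed \<open>n - j\<close>. As
    \<open>n - b\<close> is the lower end of the central layers, complementing and peeling once more
    ends there.\<close>
  define b where "b = (n + 1) div 2 + 1"
  have b: "b \<le> n" "n - b = n div 2 - 1" "n - b < b" using n by (auto simp: b_def)
  have three': "three_layers n j lam \<and> three_layers.\<epsilon> j \<le> \<eta>" if "b \<le> Suc j" "Suc (Suc j) \<le> n" for j
    using that by (intro three) (auto simp: b_def)
  let ?P = "(1 + \<eta>) ^ (n * 2 ^ n)"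
  have P0: "0 \<le> ?P" using \<eta> by simp
  have "boolean_lattice n = band n 0 n"
    using card_mono[of "{1..n}"] by (fastforce simp: boolean_lattice_def band_def)
  then have "antichain_Z (boolean_lattice n) lam \<le> ?P * antichain_Z (band n 0 b) lam"
    using antichain_Z_band_le[of b n lam \<eta> 0 n, OF three'] b \<eta> lam by simp
  also have "antichain_Z (band n 0 b) lam = antichain_Z (band n (n - b) n) lam"
  proof -
    have "band n 0 b \<subseteq> Pow {1..n}" by (auto simp: band_def)
    from antichain_Z_complement[OF this, of lam] show ?thesis
      unfolding band_complement[OF b(1)] by simp
  qed
  also have "?P * \<dots> \<le> ?P * (?P * antichain_Z (band n (n - b) b) lam)"
    using antichain_Z_band_le[of b n lam \<eta> "n - b" n, OF three'] b \<eta> lam P0 by (intro mult_left_mono) auto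
  also have "band n (n - b) b = central_layers n"
    using central_layers_band n b by (simp add: b_def)
  also have "?P * (?P * antichain_Z (central_layers n) lam) = (1 + \<eta>) ^ (2 * (n * 2 ^ n)) * antichain_Z (central_layers n) lam"
    by (simp add: mult_2 power_add)
  finally show ?thesis .
qed

section \<open>Asymptotics: the size of the error and the constant 4000\<close>

lemma (in three_layers) \<epsilon>_le: "\<epsilon> \<le> (1 / 8) ^ n"
proof -
  define D where "D = Suc j"
  define d where "d = real D"
  define L where "L = ln d"
  have d: "100 \<le> d" using j_ge by (simp add: d_def D_def)
  have "exp 1 \<le> d" using exp_le d by linarith
  then have L1: "1 \<le> L" unfolding L_def using d by (subst ln_ge_iff) auto
  have Ld: "L \<le> d" unfolding L_def using d ln_le_minus_one[of d] by simp
  have "d ^ 2 / 32 \<le> real (D ^ 2 div 16)"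
  proof -
    have "D ^ 2 \<le> 16 * (D ^ 2 div 16) + 16" by linarith
    then have "real (D ^ 2) \<le> real (16 * (D ^ 2 div 16) + 16)" by (rule of_nat_mono)
    then have "d ^ 2 \<le> 16 * real (D ^ 2 div 16) + 16"
      by (simp only: d_def of_nat_power of_nat_add of_nat_mult of_nat_numeral)
    moreover have "100 * 100 \<le> d ^ 2" unfolding power2_eq_square using d by (intro mult_mono) auto
    ultimately show ?thesis by linarith
  qed
  \<comment> \<open>With only \<open>L >= 1\<close> the exponent is at least
    \<open>4000 / 32 * d = 125 * d\<close>: the quadratic lower bound on the defect, divided by
    \<open>d\<close>, makes it linear in \<open>n\<close>.\<close>
  then have "4000 * (d ^ 2 / 32) * 1 / d \<le> 4000 * real (D ^ 2 div 16) * L ^ 3 / d"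
    using d L1 by (intro divide_right_mono mult_mono) auto
  then have ex: "125 * d \<le> 4000 * real (D ^ 2 div 16) * L ^ 3 / d"
    using d by (simp add: power2_eq_square)
  have "4 * d ^ 3 \<le> d * d ^ 3" using d by (intro mult_right_mono) auto
  also have "\<dots> = exp L ^ 4" using d by (simp add: L_def numeral_eq_Suc)
  also have "\<dots> = exp (4 * L)" using exp_of_nat_mult[of 4 L] by simp
  also have "\<dots> \<le> exp (4 * d)" using Ld by simp
  finally have d3: "4 * d ^ 3 \<le> exp (4 * d)" .
  have "4 * d ^ 3 * exp (- (4000 * real (D ^ 2 div 16) * L ^ 3 / d)) \<le> exp (4 * d) * exp (- (125 * d))"
    using d3 ex d by (intro mult_mono) auto
  also have "\<dots> = exp (- (121 * d))" by (simp add: exp_add[symmetric])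
  also have "\<dots> \<le> exp (- (7 * real n))"
  proof -
    have "real n \<le> 2 * d" using nj by (simp add: d_def D_def)
    then show ?thesis using d by simp
  qed
  also have "\<dots> = exp (- 7) ^ n" using exp_of_nat_mult[of n "- 7 :: real"] by (simp add: mult.commute)
  also have "\<dots> \<le> (1 / 8) ^ n"
  proof (rule power_mono)
    have "8 \<le> exp (7::real)" using exp_ge_add_one_self[of "7::real"] by simp
    then show "exp (- 7) \<le> 1 / (8::real)" by (simp add: exp_minus field_simps)
  qed simp
  finally show ?thesis
    unfolding \<epsilon>_def D_def d_def L_def .
qed

text \<open>The constant is \<open>4 * 1000\<close>: one factor 2 comes from
  \<open>exp y <= 1 + 2 * y\<close> on the unit interval, the other from
  \<open>sqrt n <= 2 * sqrt x\<close> for layer sizes \<open>x >= n / 2\<close>. Passing from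
  \<open>log 2\<close> to \<open>ln\<close> only helps.\<close>

lemma eventually_three_layers:
  assumes lam: "\<forall>\<^sub>F n in sequentially. lam n \<ge> 4000 * (log 2 (real n))\<^sup>2 / sqrt (real n)"
  shows "\<forall>\<^sub>F n in sequentially. 0 \<le> lam n \<and>
    (\<forall>j. n \<le> 2 * j \<longrightarrow> Suc (Suc j) \<le> n \<longrightarrow> three_layers n j (lam n))"
proof -
  have "\<forall>\<^sub>F x::real in at_top. 4900 + 10000 * ln x \<le> 750 * sqrt x" by real_asymp
  moreover have "\<forall>\<^sub>F x::real in at_top. 1000 * ln x ^ 2 / sqrt x \<le> 1" by real_asymp
  ultimately have "\<forall>\<^sub>F x::real in at_top. 4900 + 10000 * ln x \<le> 750 * sqrt x \<and> 1000 * ln x ^ 2 / sqrt x \<le> 1"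
    by (rule eventually_conj)
  then obtain x0 :: real where x0: "\<And>x. x \<ge> x0 \<Longrightarrow> 4900 + 10000 * ln x \<le> 750 * sqrt x"
    "\<And>x. x \<ge> x0 \<Longrightarrow> 1000 * ln x ^ 2 / sqrt x \<le> 1"
    by (auto simp: eventually_at_top_linorder)
  have "\<forall>\<^sub>F n in sequentially. 2 * x0 \<le> real n" by real_asymp
  moreover have "\<forall>\<^sub>F n in sequentially. 200 \<le> n" by (rule eventually_ge_at_top)
  ultimately show ?thesis using lam
  proof eventually_elim
    case (elim n)
    have n: "200 \<le> real n" using elim by simp
    have log_ge: "ln (real n) \<le> log 2 (real n)"
    proof -
      have "ln (2::real) \<le> 1" using ln_le_minus_one[of "2::real"] by simp
      then have "ln (real n) * ln 2 \<le> ln (real n) * 1" using n by (intro mult_left_mono) auto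
      then show ?thesis by (simp add: log_def field_simps)
    qed
    have lam_ge: "4000 * ln (real n) ^ 2 / sqrt (real n) \<le> lam n"
    proof -
      have "ln (real n) ^ 2 \<le> log 2 (real n) ^ 2" using log_ge n by (intro power_mono) auto
      then have "4000 * ln (real n) ^ 2 / sqrt (real n) \<le> 4000 * log 2 (real n) ^ 2 / sqrt (real n)"
        by (intro divide_right_mono mult_left_mono) auto
      then show ?thesis using elim by linarith
    qed
    have lam0: "0 \<le> lam n" by (rule order_trans[OF _ lam_ge]) simp
    have bound: "exp (1000 * ln x ^ 2 / sqrt x) \<le> 1 + lam n" if x: "real n \<le> 2 * x" "x \<le> real n" for x
    proof -
      define y where "y = 1000 * ln x ^ 2 / sqrt x"
      have y: "0 \<le> y" "y \<le> 1" using x0(2)[of x] x elim n by (auto simp: y_def)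
      have "exp y \<le> 1 + y + y ^ 2" by (rule exp_bound[OF y])
      moreover have "y ^ 2 \<le> y" using y by (simp add: power2_eq_square mult_left_le)
      ultimately have "exp y \<le> 1 + 2 * y" by linarith
      also have "2 * y \<le> 4000 * ln (real n) ^ 2 / sqrt (real n)"
      proof -
        have "sqrt (real n) \<le> sqrt (4 * x)" using x n by (intro real_sqrt_le_mono) linarith
        then have s: "sqrt (real n) \<le> 2 * sqrt x" by (simp add: real_sqrt_mult)
        have "ln x \<le> ln (real n)" using x n by simp
        moreover have "0 \<le> ln x" using x n by simp
        ultimately have l: "ln x ^ 2 \<le> ln (real n) ^ 2" by (rule power_mono)
        have "2 * y = 4000 * ln x ^ 2 / (2 * sqrt x)" by (simp add: y_def)
        also have "\<dots> \<le> 4000 * ln (real n) ^ 2 / sqrt (real n)"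
          using l s n by (intro frac_le) auto
        finally show ?thesis .
      qed
      finally show ?thesis using lam_ge by (simp add: y_def)
    qed
    have "three_layers n j (lam n)" if j: "n \<le> 2 * j" "Suc (Suc j) \<le> n" for j
    proof
      have x: "real n \<le> 2 * real (Suc j)" "real (Suc j) \<le> real n"
        "real n \<le> 2 * real (Suc (Suc j))" "real (Suc (Suc j)) \<le> real n"
        using j by auto
      have x00: "2 * x0 \<le> real n" using elim by simp
      have "2 * x0 \<le> 2 * real (Suc j)" "2 * x0 \<le> 2 * real (Suc (Suc j))"
        using x00 x(1,3) by (blast intro: order_trans)+
      then have big: "x0 \<le> real (Suc j)" and big': "x0 \<le> real (Suc (Suc j))"
        by (simp_all only: mult_le_cancel_left_pos zero_less_numeral)
      show "n \<le> 2 * j" by fact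
      show "100 \<le> j" using j elim by linarith
      show "0 \<le> lam n" by fact
      show "exp (1000 * ln (real (Suc j)) ^ 2 / sqrt (real (Suc j))) \<le> 1 + lam n"
        by (rule bound[OF x(1,2)])
      show "exp (1000 * ln (real (Suc (Suc j))) ^ 2 / sqrt (real (Suc (Suc j)))) \<le> 1 + lam n"
        by (rule bound[OF x(3,4)])
      show "4900 + 10000 * ln (real (Suc j)) \<le> 750 * sqrt (real (Suc j))"
        by (rule x0(1)[OF big])
      show "4900 + 10000 * ln (real (Suc (Suc j))) \<le> 750 * sqrt (real (Suc (Suc j)))"
        by (rule x0(1)[OF big'])
    qed
    then show ?case using lam0 by blast
  qed
qed

text \<open>The product of \<open>(1 / 8) ^ n\<close> with the number \<open>2 * n * 2 ^ n\<close>
  of charged insertions is at most \<open>2 / 2 ^ n\<close>, since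
  \<open>n <= 2 ^ n\<close>.\<close>

lemma error_factor_le: "(1 + (1 / 8 :: real) ^ n) ^ (2 * (n * 2 ^ n)) \<le> 1 + 4 / (2::real) ^ n"
proof (cases "n = 0")
  case False
  have n2: "real n \<le> 2 ^ n" using less_exp[of n] of_nat_mono[of n "2 ^ n"] by (simp add: less_imp_le)
  define x where "x = 2 / (2::real) ^ n"
  have x: "0 \<le> x" "x \<le> 1"
    using False power_increasing[of 1 n "2::real"] by (auto simp: x_def field_simps)
  have "(1 + (1 / 8 :: real) ^ n) ^ (2 * (n * 2 ^ n)) \<le> exp ((1 / 8) ^ n) ^ (2 * (n * 2 ^ n))"
    by (intro power_mono exp_ge_add_one_self) simp
  also have "\<dots> = exp (real (2 * (n * 2 ^ n)) * (1 / 8) ^ n)" by (rule exp_of_nat_mult[symmetric])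
  also have "\<dots> \<le> exp x"
  proof -
    have "real (2 * (n * 2 ^ n)) * (1 / 8) ^ n \<le> 2 * (2 ^ n * 2 ^ n) * (1 / 8) ^ n"
      using n2 by (intro mult_right_mono) auto
    also have "\<dots> = 2 * (2 * 2 * (1 / 8)) ^ n" by (simp only: power_mult_distrib mult.assoc)
    also have "\<dots> = x" by (simp add: x_def power_divide)
    finally show ?thesis by simp
  qed
  also have "\<dots> \<le> 1 + x + x ^ 2" by (rule exp_bound[OF x])
  also have "x ^ 2 \<le> x" using x by (simp add: power2_eq_square mult_left_le)
  finally show ?thesis using x by (simp add: x_def)
qed simp

theorem theorem1p6:
  shows "\<exists>C::real. C > 0 \<and>
    (\<forall>lam :: nat \<Rightarrow> real.
       (\<forall>\<^sub>F n in sequentially. lam n \<ge> C * (log 2 (real n))\<^sup>2 / sqrt (real n)) \<longrightarrow>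
       (\<exists>\<epsilon> :: nat \<Rightarrow> real.
          \<epsilon> \<in> o(\<lambda>n. 1 / sqrt (real (n choose (n div 2)))) \<and>
          (\<forall>\<^sub>F n in sequentially.
             antichain_Z (boolean_lattice n) (lam n) =
               (1 + \<epsilon> n) * antichain_Z (central_layers n) (lam n))))"
proof (intro exI[of _ 4000] conjI allI impI)
  fix lam :: "nat \<Rightarrow> real"
  assume lam: "\<forall>\<^sub>F n in sequentially. lam n \<ge> 4000 * (log 2 (real n))\<^sup>2 / sqrt (real n)"
  \<comment> \<open>The exact relative error, so the required identity only needs a nonzero
    denominator.\<close>
  define \<epsilon> where "\<epsilon> = (\<lambda>n. antichain_Z (boolean_lattice n) (lam n) / antichain_Z (central_layers n) (lam n) - 1)"
  have ev: "\<forall>\<^sub>F n in sequentially. 1 \<le> antichain_Z (central_layers n) (lam n) \<and> 0 \<le> \<epsilon> n \<and> \<epsilon> n \<le> 4 / 2 ^ n"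
    using eventually_three_layers[OF lam] eventually_ge_at_top[of 200]
  proof eventually_elim
    case (elim n)
    have lam0: "0 \<le> lam n" using elim by blast
    have fin: "finite (boolean_lattice n)" "central_layers n \<subseteq> boolean_lattice n"
      by (auto simp: boolean_lattice_def central_layers_def)
    have one: "1 \<le> antichain_Z (central_layers n) (lam n)"
      using antichain_Z_ge_1[OF lam0] fin finite_subset by blast
    have "antichain_Z (boolean_lattice n) (lam n) \<le>
        (1 + (1 / 8) ^ n) ^ (2 * (n * 2 ^ n)) * antichain_Z (central_layers n) (lam n)"
    proof (rule antichain_Z_boolean_lattice_le[OF _ lam0])
      show "three_layers n j (lam n) \<and> three_layers.\<epsilon> j \<le> (1 / 8) ^ n"
        if "n \<le> 2 * j" "Suc (Suc j) \<le> n" for j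
        using elim that three_layers.\<epsilon>_le by blast
    qed (use elim in auto)
    also have "\<dots> \<le> (1 + 4 / 2 ^ n) * antichain_Z (central_layers n) (lam n)"
      using one by (intro mult_right_mono error_factor_le) auto
    finally have "\<epsilon> n \<le> 4 / 2 ^ n" using one by (simp add: \<epsilon>_def divide_simps algebra_simps)
    moreover have "0 \<le> \<epsilon> n"
      using antichain_Z_mono[OF lam0 fin] one by (simp add: \<epsilon>_def field_simps)
    ultimately show ?case using one by blast
  qed
  show "\<exists>\<epsilon>. \<epsilon> \<in> o(\<lambda>n. 1 / sqrt (real (n choose (n div 2)))) \<and>
    (\<forall>\<^sub>F n in sequentially. antichain_Z (boolean_lattice n) (lam n) =
       (1 + \<epsilon> n) * antichain_Z (central_layers n) (lam n))"
  proof (intro exI[of _ \<epsilon>] conjI)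
    show "\<forall>\<^sub>F n in sequentially. antichain_Z (boolean_lattice n) (lam n) =
       (1 + \<epsilon> n) * antichain_Z (central_layers n) (lam n)"
      using ev by eventually_elim (auto simp: \<epsilon>_def)
    show "\<epsilon> \<in> o(\<lambda>n. 1 / sqrt (real (n choose (n div 2))))"
    proof (rule landau_o.smallI)
      fix c :: real assume c: "0 < c"
      have "(\<lambda>n. 4 / sqrt (2 ^ n)) \<longlonglongrightarrow> (0::real)" by real_asymp
      then have "\<forall>\<^sub>F n in sequentially. 4 / sqrt (2 ^ n) < c" using c by (rule order_tendstoD)
      then show "\<forall>\<^sub>F n in sequentially. norm (\<epsilon> n) \<le> c * norm (1 / sqrt (real (n choose (n div 2))))"
        using ev
      proof eventually_elim
        case (elim n)
        define m where "m = real (n choose (n div 2))"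
        have "0 < n choose (n div 2)" by (simp add: zero_less_binomial_iff)
        then have m0: "0 < m" by (simp add: m_def)
        have "n choose (n div 2) \<le> 2 ^ n" by (rule binomial_le_pow2)
        then have "m \<le> 2 ^ n" unfolding m_def by (metis of_nat_le_iff of_nat_numeral of_nat_power)
        then have s: "sqrt m \<le> sqrt (2 ^ n)" by simp
        have "norm (\<epsilon> n) \<le> 4 / 2 ^ n" using elim by simp
        \<comment> \<open>One factor \<open>1 / sqrt (2 ^ n)\<close> is at most
          \<open>1 / sqrt m\<close> because \<open>m <= 2 ^ n\<close>; the other, tending to 0,
          falls below \<open>c\<close>.\<close>
        also have "\<dots> = 4 / sqrt (2 ^ n) * (1 / sqrt (2 ^ n))" by simp
        also have "\<dots> \<le> c * (1 / sqrt m)"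
          using elim s m0 c by (intro mult_mono frac_le) auto
        finally show "norm (\<epsilon> n) \<le> c * norm (1 / sqrt (real (n choose (n div 2))))"
          using m0 by (simp add: m_def)
      qed
    qed
  qed
qed simp

end
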